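(* Let $B$ be a standard $d$-dimensional Brownian motion on $[0,T]$, $\mathcal F$ the $\sigma$-algebra generated by $(B_t)_{t\in[0,T]}$, and $\widetilde B_t=(t,B_t)$. Linear functions on $S(\widetilde B)_{0,T}$, i.e. finite linear combinations of the random variables $\langle w,S(\widetilde B)_{0,T}\rangle$ over words $w$ in $\{\mathtt 0,1,\dots,d\}$, are dense in $L^2(\mathcal F)$.
   Context: $S(\widetilde B)_{0,T}$ is the Stratonovich signature of the time-augmented Brownian motion: for a word $w=\alpha_1\cdots\alpha_n$ in $\{\mathtt 0,1,\dots,d\}$, $\langle w,S(\widetilde B)_{0,T}\rangle=\int_{0<t_1<\dots<t_n<T}d\widetilde B^{\alpha_1}_{t_1}\cdots d\widetilde B^{\alpha_n}_{t_n}$, where $\widetilde B^{\mathtt 0}_t=t$ (Riemann integration), $\widetilde B^{\alpha}=B^\alpha$ for $\alpha\ge1$ (iterated Stratonovich integration), and the empty word gives $1$. *)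

theory Defs
  imports "HOL-Probability.Probability"
begin

section \<open>Partitions\<close>

text \<open>\<open>p 0 < p 1 < \<dots> < p n\<close> is a subdivision of \<open>[0, t]\<close>. For \<open>t = 0\<close> only \<open>n = 0\<close> is possible.\<close>

definition is_partition :: "real \<Rightarrow> nat \<Rightarrow> (nat \<Rightarrow> real) \<Rightarrow> bool" where
  "is_partition t n p \<longleftrightarrow> p 0 = 0 \<and> p n = t \<and> (\<forall>k<n. p k < p (Suc k))"

definition mesh_less :: "nat \<Rightarrow> (nat \<Rightarrow> real) \<Rightarrow> real \<Rightarrow> bool" where
  "mesh_less n p \<delta> \<longleftrightarrow> (\<forall>k<n. p (Suc k) - p k < \<delta>)"


section \<open>Brownian motion\<close>

text \<open>
  A process with values in \<open>\<real>\<^sup>d\<close> is given by its coordinates \<open>B i t\<close> with \<open>1 \<le> i \<le> d\<close>; values of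
  \<open>B\<close> at other indices or at times outside \<open>[0, T]\<close> are irrelevant. The independence clause
  expresses at once that the vector increments over successive intervals are independent and that
  the coordinates of each increment are independent; with the Gaussian clause this says
  \<open>B\<^sub>t - B\<^sub>s \<sim> N(0, (t - s) I\<^sub>d)\<close>. No filtration other than the natural one is involved.
\<close>

definition standard_brownian_motion ::
    "'a measure \<Rightarrow> nat \<Rightarrow> real \<Rightarrow> (nat \<Rightarrow> real \<Rightarrow> 'a \<Rightarrow> real) \<Rightarrow> bool" where
  "standard_brownian_motion M d T B \<longleftrightarrow>
     prob_space M \<and>
     (\<forall>i\<in>{1..d}. \<forall>t\<in>{0..T}. B i t \<in> borel_measurable M) \<and>
     (\<forall>i\<in>{1..d}. AE \<omega> in M. B i 0 \<omega> = 0) \<and>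
     (\<forall>i\<in>{1..d}. AE \<omega> in M. continuous_on {0..T} (\<lambda>t. B i t \<omega>)) \<and>
     (\<forall>i\<in>{1..d}. \<forall>s t. 0 \<le> s \<and> s < t \<and> t \<le> T \<longrightarrow>
        distributed M lborel (\<lambda>\<omega>. B i t \<omega> - B i s \<omega>) (normal_density 0 (sqrt (t - s)))) \<and>
     (\<forall>n p. is_partition T n p \<longrightarrow>
        prob_space.indep_vars M (\<lambda>_. borel)
          (\<lambda>(i, k) \<omega>. B i (p (Suc k)) \<omega> - B i (p k) \<omega>) ({1..d} \<times> {..<n}))"

definition brownian_sigma ::
    "'a measure \<Rightarrow> nat \<Rightarrow> real \<Rightarrow> (nat \<Rightarrow> real \<Rightarrow> 'a \<Rightarrow> real) \<Rightarrow> 'a measure" where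
  "brownian_sigma M d T B =
     sigma (space M) {B i t -` A \<inter> space M | i t A. i \<in> {1..d} \<and> t \<in> {0..T} \<and> A \<in> sets borel}"


section \<open>Stratonovich integral and signature\<close>

definition stratonovich_sum ::
    "(real \<Rightarrow> 'a \<Rightarrow> real) \<Rightarrow> (real \<Rightarrow> 'a \<Rightarrow> real) \<Rightarrow> nat \<Rightarrow> (nat \<Rightarrow> real) \<Rightarrow> 'a \<Rightarrow> real" where
  "stratonovich_sum Y X n p \<omega> =
     (\<Sum>k<n. (Y (p k) \<omega> + Y (p (Suc k)) \<omega>) / 2 * (X (p (Suc k)) \<omega> - X (p k) \<omega>))"

text \<open>
  \<open>I\<close> is a version of \<open>\<integral>\<^sub>0\<^sup>t Y \<circ> dX\<close>: the symmetric sums along deterministic subdivisions of \<open>[0, t]\<close>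
  converge to \<open>I\<close> in probability as the mesh tends to \<open>0\<close>. For continuous semimartingales this
  limit exists and is the Ito integral plus half the covariation.
\<close>

definition has_stratonovich_integral ::
    "'a measure \<Rightarrow> (real \<Rightarrow> 'a \<Rightarrow> real) \<Rightarrow> (real \<Rightarrow> 'a \<Rightarrow> real) \<Rightarrow> real \<Rightarrow> ('a \<Rightarrow> real) \<Rightarrow> bool" where
  "has_stratonovich_integral M Y X t I \<longleftrightarrow>
     I \<in> borel_measurable M \<and>
     (\<forall>\<epsilon>>0. \<forall>\<eta>>0. \<exists>\<delta>>0. \<forall>n p. is_partition t n p \<and> mesh_less n p \<delta> \<longrightarrow>
        measure M {\<omega> \<in> space M. \<bar>stratonovich_sum Y X n p \<omega> - I \<omega>\<bar> > \<epsilon>} < \<eta>)"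

definition words :: "nat \<Rightarrow> nat list set" where
  "words d = {w. set w \<subseteq> {0..d}}"

text \<open>
  \<open>S w t \<omega>\<close> is a version of \<open>\<langle>w, S(\<tilde>B)\<^bsub>0,t\<^esub>\<rangle>\<close> with continuous paths, where \<open>\<tilde>B\<^sub>t = (t, B\<^sub>t)\<close>. As the
  iterated integral runs over \<open>0 < t\<^sub>1 < \<dots> < t\<^sub>n < t\<close>, the last letter of the word is the outermost
  integrator: \<open>S (w @ [\<alpha>]) t = \<integral>\<^sub>0\<^sup>t S w s d\<tilde>B\<^sup>\<alpha>\<^sub>s\<close>, where letter \<open>0\<close> stands for time. Its integral
  is pathwise and, the integrands being continuous, a Riemann integral. Stochastic integrals are
  defined up to null sets only, so the signature is a relation rather than a function; it
  determines \<open>S\<close> on \<open>words d\<close> and \<open>[0, T]\<close> up to indistinguishability.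
\<close>

definition is_stratonovich_signature ::
    "'a measure \<Rightarrow> nat \<Rightarrow> real \<Rightarrow> (nat \<Rightarrow> real \<Rightarrow> 'a \<Rightarrow> real) \<Rightarrow>
     (nat list \<Rightarrow> real \<Rightarrow> 'a \<Rightarrow> real) \<Rightarrow> bool" where
  "is_stratonovich_signature M d T B S \<longleftrightarrow>
     (\<forall>w\<in>words d. \<forall>t\<in>{0..T}. S w t \<in> borel_measurable M) \<and>
     (\<forall>w\<in>words d. AE \<omega> in M. continuous_on {0..T} (\<lambda>t. S w t \<omega>)) \<and>
     (\<forall>t\<in>{0..T}. \<forall>\<omega>\<in>space M. S [] t \<omega> = 1) \<and>
     (\<forall>w\<in>words d. AE \<omega> in M. \<forall>t\<in>{0..T}.
        ((\<lambda>s. S w s \<omega>) has_integral S (w @ [0]) t \<omega>) {0..t}) \<and>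
     (\<forall>w\<in>words d. \<forall>\<alpha>\<in>{1..d}. \<forall>t\<in>{0..T}.
        has_stratonovich_integral M (S w) (B \<alpha>) t (S (w @ [\<alpha>]) t))"

definition signature_linear_functions ::
    "nat \<Rightarrow> real \<Rightarrow> (nat list \<Rightarrow> real \<Rightarrow> 'a \<Rightarrow> real) \<Rightarrow> ('a \<Rightarrow> real) set" where
  "signature_linear_functions d T S =
     {(\<lambda>\<omega>. \<Sum>w\<in>W. c w * S w T \<omega>) | W c. finite W \<and> W \<subseteq> words d}"


section \<open>Density in \<open>L\<^sup>2\<close>\<close>

text \<open>
  For a sub-\<open>\<sigma>\<close>-algebra \<open>F\<close> of \<open>M\<close>, the representatives of the elements of \<open>L\<^sup>2(F)\<close> among all random
  variables: elements are equivalence classes modulo \<open>M\<close>-null sets, and it is enough that one member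
  of the class is \<open>F\<close>-measurable. This matters because versions of stochastic integrals need only be
  measurable with respect to the completion of \<open>F\<close>.
\<close>

definition L2_space :: "'a measure \<Rightarrow> 'a measure \<Rightarrow> ('a \<Rightarrow> real) set" where
  "L2_space M F = {f \<in> borel_measurable M. integrable M (\<lambda>\<omega>. (f \<omega>)\<^sup>2) \<and>
     (\<exists>g\<in>borel_measurable F. AE \<omega> in M. f \<omega> = g \<omega>)}"

definition L2_norm :: "'a measure \<Rightarrow> ('a \<Rightarrow> real) \<Rightarrow> real" where
  "L2_norm M f = sqrt (\<integral>\<omega>. (f \<omega>)\<^sup>2 \<partial>M)"

definition dense_in_L2 :: "'a measure \<Rightarrow> 'a measure \<Rightarrow> ('a \<Rightarrow> real) set \<Rightarrow> bool" where
  "dense_in_L2 M F V \<longleftrightarrow>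
     V \<subseteq> L2_space M F \<and>
     (\<forall>f\<in>L2_space M F. \<forall>\<epsilon>>0. \<exists>g\<in>V. L2_norm M (\<lambda>\<omega>. f \<omega> - g \<omega>) < \<epsilon>)"

end

theory Submission
  imports Defs "HOL-Computational_Algebra.Polynomial"
begin

text \<open>
  Square integrability. By its recursive definition, every \<open>S w T\<close> is a limit in probability of
  polynomials of degree at most \<open>length w\<close> in Brownian increments. Refining a dyadic partition turns
  the square of an increment into off-diagonal products plus a constant, so these polynomials may be
  taken multilinear in independent Gaussians. Multilinear polynomials satisfy
  \<open>E f^4 \<le> 9^m (E f^2)^2\<close>, hence a sequence of them that is bounded in probability is bounded in
  \<open>L\<^sup>2\<close>, and Fatou's lemma applies to the limit.

  Density. Let \<open>X\<^sub>t = \<Sum>\<^sub>i \<integral>\<^sub>0\<^sup>t \<phi>\<^sub>i dB\<^sup>i\<close> with polynomials \<open>\<phi>\<^sub>i\<close>. The Stratonovich chain rule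
  \<open>d(t^k X^n) = k t^(k-1) X^n dt + \<Sum>\<^sub>i n t^k \<phi>\<^sub>i X^(n-1) \<circ> dB\<^sup>i\<close> follows from a pathwise error bound
  and \<open>E \<Sum> (\<Delta>B)\<^sup>2 = d t\<close>; by induction on \<open>n\<close> and then \<open>k\<close> it shows that \<open>t^k X^n\<close> is a linear
  combination of signature entries, without any appeal to the shuffle product. If \<open>\<phi>\<^sub>i(T) = 0\<close> then
  \<open>X\<^sub>T = - \<Sum>\<^sub>i \<integral>\<^sub>0\<^sup>T \<phi>\<^sub>i' B\<^sup>i dt\<close> has exponential moments, so the closed span contains \<open>cos X\<^sub>T\<close> and
  \<open>sin X\<^sub>T\<close>. Letting \<open>- \<phi>\<^sub>i'\<close> approximate Dirac masses gives the trigonometric functions of all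
  linear combinations of values of \<open>B\<close>; these form an algebra, and a monotone class argument
  concludes.
\<close>

text \<open>Signature entries are given only as limits in probability of trapezoidal sums, so a
  priori they have no moments at all; a comparison of moments takes the place of the Ito isometry.
  Multilinearity keeps this elementary: independence, vanishing first and third moments and
  \<open>E g^4 <= 3 (E g^2)^2\<close> suffice, and 9 is the base for which the mixed term
  \<open>6 v E Q^2 R^2\<close> becomes the double product of a square. In the chain rule the error
  over an interval is small only relative to its length plus the squared increments. Sums of the
  latter are bounded in mean, not path by path, hence the division by 1 plus this sum before the
  limit is taken. The Taylor series of cosine and sine are summed in L2 by means of exponential
  moments; finiteness of all moments would not be enough. The condition that the integrands vanish
  at \<open>T\<close> turns the Wiener integral into an ordinary integral of the paths, to which
  Jensen's inequality applies, so its law is never computed. The condition is free of cost, because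
  an antiderivative comes with a free constant.\<close>

section \<open>Convergence in probability\<close>

text \<open>The L1 distance truncated at 1. It metrizes convergence in probability, so such limits
  become limits of real numbers and L1 theorems apply to variables without moments.\<close>

definition pdist :: "'a measure \<Rightarrow> ('a \<Rightarrow> real) \<Rightarrow> ('a \<Rightarrow> real) \<Rightarrow> real" where
  "pdist M X Y = (\<integral>\<omega>. min 1 \<bar>X \<omega> - Y \<omega>\<bar> \<partial>M)"

context prob_space
begin

lemma pdist_integrable [simp]:
  assumes "X \<in> borel_measurable M" "Y \<in> borel_measurable M"
  shows "integrable M (\<lambda>\<omega>. min 1 \<bar>X \<omega> - Y \<omega>\<bar> :: real)"
  by (rule integrable_const_bound[where B=1]) (use assms in auto)

lemma pdist_nonneg: "0 \<le> pdist M X Y"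
  unfolding pdist_def by (rule integral_nonneg_AE) auto

lemma pdist_triangle:
  assumes "X \<in> borel_measurable M" "Y \<in> borel_measurable M" "Z \<in> borel_measurable M"
  shows "pdist M X Z \<le> pdist M X Y + pdist M Y Z"
proof -
  have "pdist M X Z \<le> (\<integral>\<omega>. min 1 \<bar>X \<omega> - Y \<omega>\<bar> + min 1 \<bar>Y \<omega> - Z \<omega>\<bar> \<partial>M)"
    unfolding pdist_def by (rule integral_mono) (use assms in auto)
  also have "\<dots> = pdist M X Y + pdist M Y Z"
    unfolding pdist_def by (rule Bochner_Integration.integral_add) (use assms in auto)
  finally show ?thesis .
qed

lemma pdist_commute: "pdist M X Y = pdist M Y X"
  unfolding pdist_def by (simp add: abs_minus_commute)

lemma pdist_cong_AE:
  assumes "X \<in> borel_measurable M" "Y \<in> borel_measurable M"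
    and "X' \<in> borel_measurable M" "Y' \<in> borel_measurable M"
    and "AE \<omega> in M. X \<omega> = X' \<omega>" "AE \<omega> in M. Y \<omega> = Y' \<omega>"
  shows "pdist M X Y = pdist M X' Y'"
  unfolding pdist_def by (rule integral_cong_AE) (use assms in auto)

lemma pdist_eq_0_AE:
  assumes "X \<in> borel_measurable M" "Y \<in> borel_measurable M" "pdist M X Y = 0"
  shows "AE \<omega> in M. X \<omega> = Y \<omega>"
proof -
  have "AE \<omega> in M. min 1 \<bar>X \<omega> - Y \<omega>\<bar> = 0"
    using assms integral_nonneg_eq_0_iff_AE[of M "\<lambda>\<omega>. min 1 \<bar>X \<omega> - Y \<omega>\<bar>"] by (simp add: pdist_def)
  then show ?thesis by eventually_elim (auto simp: min_def split: if_splits)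
qed

lemma pdist_add:
  assumes "X \<in> borel_measurable M" "Y \<in> borel_measurable M"
    "X' \<in> borel_measurable M" "Y' \<in> borel_measurable M"
  shows "pdist M (\<lambda>\<omega>. X \<omega> + Y \<omega>) (\<lambda>\<omega>. X' \<omega> + Y' \<omega>) \<le> pdist M X X' + pdist M Y Y'"
proof -
  have "pdist M (\<lambda>\<omega>. X \<omega> + Y \<omega>) (\<lambda>\<omega>. X' \<omega> + Y' \<omega>)
      \<le> (\<integral>\<omega>. min 1 \<bar>X \<omega> - X' \<omega>\<bar> + min 1 \<bar>Y \<omega> - Y' \<omega>\<bar> \<partial>M)"
    unfolding pdist_def by (rule integral_mono) (use assms in auto)
  also have "\<dots> = pdist M X X' + pdist M Y Y'"
    unfolding pdist_def by (rule Bochner_Integration.integral_add) (use assms in auto)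
  finally show ?thesis .
qed

lemma pdist_tendsto_AE:
  assumes "\<And>n. X n \<in> borel_measurable M" "Y \<in> borel_measurable M"
    and "AE \<omega> in M. (\<lambda>n. X n \<omega>) \<longlonglongrightarrow> Y \<omega>"
  shows "(\<lambda>n. pdist M (X n) Y) \<longlonglongrightarrow> 0"
proof -
  have "(\<lambda>n. \<integral>\<omega>. min 1 \<bar>X n \<omega> - Y \<omega>\<bar> \<partial>M) \<longlonglongrightarrow> (\<integral>\<omega>. 0 \<partial>M)"
  proof (rule integral_dominated_convergence[where w="\<lambda>_. 1"])
    show "AE \<omega> in M. (\<lambda>n. min 1 \<bar>X n \<omega> - Y \<omega>\<bar>) \<longlonglongrightarrow> 0"
      using assms(3)
    proof eventually_elim
      case (elim \<omega>)
      then have "(\<lambda>n. min 1 \<bar>X n \<omega> - Y \<omega>\<bar>) \<longlonglongrightarrow> min 1 \<bar>Y \<omega> - Y \<omega>\<bar>"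
        by (intro tendsto_intros)
      then show ?case by simp
    qed
  qed (use assms in auto)
  then show ?thesis unfolding pdist_def by simp
qed

lemma pdist_AE_subseq:
  assumes "\<And>n. X n \<in> borel_measurable M" "Y \<in> borel_measurable M"
    and "(\<lambda>n. pdist M (X n) Y) \<longlonglongrightarrow> 0"
  obtains r :: "nat \<Rightarrow> nat" where "strict_mono r" "AE \<omega> in M. (\<lambda>n. X (r n) \<omega>) \<longlonglongrightarrow> Y \<omega>"
proof -
  have "\<exists>r::nat\<Rightarrow>nat. strict_mono r \<and> (AE \<omega> in M. (\<lambda>n. min 1 \<bar>X (r n) \<omega> - Y \<omega>\<bar>) \<longlonglongrightarrow> 0)"
    by (rule tendsto_L1_AE_subseq) (use assms in \<open>auto simp: pdist_def\<close>)
  then obtain r :: "nat \<Rightarrow> nat" where r: "strict_mono r"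
      and "AE \<omega> in M. (\<lambda>n. min 1 \<bar>X (r n) \<omega> - Y \<omega>\<bar>) \<longlonglongrightarrow> 0"
    by auto
  from this(2) have "AE \<omega> in M. (\<lambda>n. X (r n) \<omega>) \<longlonglongrightarrow> Y \<omega>"
  proof eventually_elim
    case (elim \<omega>)
    \<comment> \<open>Once a truncated distance is below 1 the truncation is inactive, so the
      untruncated one tends to 0 as well.\<close>
    have "eventually (\<lambda>n. min 1 \<bar>X (r n) \<omega> - Y \<omega>\<bar> < 1) sequentially"
      using order_tendstoD(2)[OF elim, of 1] by simp
    then have "eventually (\<lambda>n. min 1 \<bar>X (r n) \<omega> - Y \<omega>\<bar> = \<bar>X (r n) \<omega> - Y \<omega>\<bar>) sequentially"
      by eventually_elim auto
    with elim have "(\<lambda>n. \<bar>X (r n) \<omega> - Y \<omega>\<bar>) \<longlonglongrightarrow> 0"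
      by (rule Lim_transform_eventually)
    then show ?case
      using LIM_zero_cancel tendsto_rabs_zero_iff by blast
  qed
  with r that show thesis by blast
qed

text \<open>Markov's inequality at the truncation level. The threshold 1 is all that the tail bound
  in \<open>wchaos_square_integrable\<close> asks for.\<close>

lemma measure_ge_1_le_pdist:
  assumes "X \<in> borel_measurable M" "Y \<in> borel_measurable M"
  shows "measure M {\<omega>\<in>space M. 1 \<le> \<bar>X \<omega> - Y \<omega>\<bar>} \<le> pdist M X Y"
proof -
  have "measure M {\<omega>\<in>space M. 1 \<le> \<bar>X \<omega> - Y \<omega>\<bar>} = (\<integral>\<omega>. indicator {\<omega>\<in>space M. 1 \<le> \<bar>X \<omega> - Y \<omega>\<bar>} \<omega> \<partial>M)"
    using assms by (subst Bochner_Integration.integral_indicator) auto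
  also have "\<dots> \<le> pdist M X Y"
    unfolding pdist_def
  proof (rule integral_mono)
    show "integrable M (\<lambda>\<omega>. indicator {\<omega>\<in>space M. 1 \<le> \<bar>X \<omega> - Y \<omega>\<bar>} \<omega> :: real)"
      by (rule integrable_const_bound[where B=1]) (use assms in auto)
  qed (use assms in \<open>auto simp: indicator_def\<close>)
  finally show ?thesis .
qed

text \<open>Splitting at the level \<open>\<epsilon>\<close> translates the tail probabilities in
  \<open>has_stratonovich_integral\<close> into \<open>pdist\<close>.\<close>

lemma pdist_le_measure:
  assumes "X \<in> borel_measurable M" "Y \<in> borel_measurable M" "0 \<le> \<epsilon>"
  shows "pdist M X Y \<le> \<epsilon> + measure M {\<omega>\<in>space M. \<bar>X \<omega> - Y \<omega>\<bar> > \<epsilon>}"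
proof -
  let ?A = "{\<omega>\<in>space M. \<bar>X \<omega> - Y \<omega>\<bar> > \<epsilon>}"
  have "?A \<in> sets M" using assms by measurable
  then have i: "integrable M (\<lambda>\<omega>. indicator ?A \<omega> :: real)"
    by (intro integrable_const_bound[where B=1]) auto
  have "pdist M X Y \<le> (\<integral>\<omega>. \<epsilon> + indicator ?A \<omega> \<partial>M)"
    unfolding pdist_def
    by (rule integral_mono) (use assms i in \<open>auto simp: indicator_def\<close>)
  also have "\<dots> = \<epsilon> + measure M ?A"
    using i \<open>?A \<in> sets M\<close> by (subst Bochner_Integration.integral_add) (auto simp: prob_space)
  finally show ?thesis .
qed

text \<open>Multiplication by an unbounded \<open>Z\<close> is not Lipschitz for
  \<open>pdist\<close>. An almost surely convergent subsequence avoids this, which is why only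
  arbitrarily large good indices are asserted; approximation arguments need no more.\<close>

lemma pdist_mult_tendsto:
  assumes "\<And>n. X n \<in> borel_measurable M" "Y \<in> borel_measurable M" "Z \<in> borel_measurable M"
    and "(\<lambda>n. pdist M (X n) Y) \<longlonglongrightarrow> 0" "0 < \<epsilon>"
  shows "\<exists>n\<ge>k. pdist M (\<lambda>\<omega>. X n \<omega> * Z \<omega>) (\<lambda>\<omega>. Y \<omega> * Z \<omega>) < \<epsilon>"
proof -
  obtain r :: "nat \<Rightarrow> nat" where r: "strict_mono r" "AE \<omega> in M. (\<lambda>n. X (r n) \<omega>) \<longlonglongrightarrow> Y \<omega>"
    using pdist_AE_subseq assms by blast
  have "(\<lambda>n. pdist M (\<lambda>\<omega>. X (r n) \<omega> * Z \<omega>) (\<lambda>\<omega>. Y \<omega> * Z \<omega>)) \<longlonglongrightarrow> 0"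
    by (rule pdist_tendsto_AE) (use assms r in \<open>auto intro!: tendsto_intros\<close>)
  then have "\<forall>\<^sub>F n in sequentially. pdist M (\<lambda>\<omega>. X (r n) \<omega> * Z \<omega>) (\<lambda>\<omega>. Y \<omega> * Z \<omega>) < \<epsilon>"
    using order_tendstoD(2) assms(5) by blast
  then have "\<forall>\<^sub>F n in sequentially. n \<ge> k \<and> pdist M (\<lambda>\<omega>. X (r n) \<omega> * Z \<omega>) (\<lambda>\<omega>. Y \<omega> * Z \<omega>) < \<epsilon>"
    by (intro eventually_conj eventually_ge_at_top)
  then obtain n where "n \<ge> k" "pdist M (\<lambda>\<omega>. X (r n) \<omega> * Z \<omega>) (\<lambda>\<omega>. Y \<omega> * Z \<omega>) < \<epsilon>"
    using eventually_happens'[OF sequentially_bot] by auto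
  then show ?thesis using seq_suble[OF r(1), of n] by (meson le_trans)
qed

text \<open>A factor tending to 0 almost surely times a factor bounded in L1 tends to 0 in
  probability. In the application \<open>Q n\<close> is a sum of squared Brownian increments and
  \<open>X n\<close> the error in the chain rule.\<close>

lemma pdist_tendsto_0_mult_L1_bounded:
  assumes X: "\<And>n. X n \<in> borel_measurable M"
    and Q: "\<And>n. integrable M (Q n)" "\<And>n \<omega>. 0 \<le> Q n \<omega>" "\<And>n. (\<integral>\<omega>. Q n \<omega> \<partial>M) \<le> c"
    and lim: "AE \<omega> in M. (\<lambda>n. X n \<omega> / (1 + Q n \<omega>)) \<longlonglongrightarrow> 0"
  shows "(\<lambda>n. pdist M (X n) (\<lambda>_. 0)) \<longlonglongrightarrow> 0"
proof -
  let ?A = "\<lambda>n \<omega>. X n \<omega> / (1 + Q n \<omega>)"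
  have [measurable]: "X n \<in> borel_measurable M" "Q n \<in> borel_measurable M" for n
    using X Q(1)[of n] by auto
  have A0: "(\<lambda>n. pdist M (?A n) (\<lambda>_. 0)) \<longlonglongrightarrow> 0"
    by (rule pdist_tendsto_AE) (use lim in auto)
  have c0: "0 \<le> c"
    by (rule order_trans[OF Bochner_Integration.integral_nonneg Q(3)[of 0]]) (use Q(2) in auto)
  have bound: "pdist M (X n) (\<lambda>_. 0) \<le> \<delta> * (1 + c) + pdist M (?A n) (\<lambda>_. 0) / \<delta>"
    if \<delta>: "0 < \<delta>" "\<delta> \<le> 1" for n \<delta>
  proof -
    \<comment> \<open>Where the quotient is at most \<open>\<delta>\<close> the first summand
      dominates; elsewhere the second is at least 1, as in Markov's inequality.\<close>
    have pw: "min 1 \<bar>X n \<omega> - 0\<bar> \<le> \<delta> * (1 + Q n \<omega>) + min 1 \<bar>?A n \<omega> - 0\<bar> / \<delta>" for \<omega>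
    proof (cases "\<bar>?A n \<omega>\<bar> \<le> \<delta>")
      case True
      have p: "1 + Q n \<omega> > 0" using Q(2)[of n \<omega>] by linarith
      have "\<bar>X n \<omega>\<bar> = \<bar>?A n \<omega>\<bar> * (1 + Q n \<omega>)"
        using p by (simp only: abs_divide abs_of_pos) simp
      also have "\<dots> \<le> \<delta> * (1 + Q n \<omega>)" using True p by (intro mult_right_mono) auto
      finally have "min 1 \<bar>X n \<omega> - 0\<bar> \<le> \<delta> * (1 + Q n \<omega>)" by simp
      moreover have "0 \<le> min 1 \<bar>?A n \<omega> - 0\<bar> / \<delta>" using \<delta> by auto
      ultimately show ?thesis by linarith
    next
      case False
      have "0 \<le> \<delta> * (1 + Q n \<omega>)" using Q(2)[of n \<omega>] \<delta> by simp
      moreover have "min 1 \<bar>?A n \<omega> - 0\<bar> / \<delta> \<ge> 1" using False \<delta> by (auto simp: field_simps min_def)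
      ultimately show ?thesis by linarith
    qed
    have i1: "integrable M (\<lambda>\<omega>. \<delta> * (1 + Q n \<omega>))" using Q(1)[of n] by simp
    have i2: "integrable M (\<lambda>\<omega>. min 1 \<bar>?A n \<omega> - 0\<bar> / \<delta>)"
      by (intro Bochner_Integration.integrable_divide impI pdist_integrable) auto
    have "pdist M (X n) (\<lambda>_. 0) \<le> (\<integral>\<omega>. \<delta> * (1 + Q n \<omega>) + min 1 \<bar>?A n \<omega> - 0\<bar> / \<delta> \<partial>M)"
      unfolding pdist_def
      by (rule integral_mono[OF pdist_integrable Bochner_Integration.integrable_add[OF i1 i2]]) (use pw in auto)
    also have "\<dots> = \<delta> * (1 + (\<integral>\<omega>. Q n \<omega> \<partial>M)) + pdist M (?A n) (\<lambda>_. 0) / \<delta>"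
      using Q(1)[of n] by (subst Bochner_Integration.integral_add[OF i1 i2]) (simp add: pdist_def prob_space)
    also have "\<dots> \<le> \<delta> * (1 + c) + pdist M (?A n) (\<lambda>_. 0) / \<delta>"
      using Q(3)[of n] \<delta> by (intro add_mono mult_left_mono) auto
    finally show ?thesis .
  qed
  show ?thesis
  proof (rule LIMSEQ_I)
    fix e :: real assume e: "0 < e"
    define \<delta> where "\<delta> = min 1 (e / (2 * (1 + c)))"
    have \<delta>: "0 < \<delta>" "\<delta> \<le> 1"
      using e c0 by (auto simp: \<delta>_def min_def field_simps)
    have "\<delta> * (1 + c) \<le> e / (2 * (1 + c)) * (1 + c)"
      using c0 by (intro mult_right_mono) (auto simp: \<delta>_def)
    also have "\<dots> = e / 2" using c0 by (simp add: divide_simps)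
    finally have \<delta>': "\<delta> * (1 + c) \<le> e / 2" .
    have "\<forall>\<^sub>F n in sequentially. pdist M (?A n) (\<lambda>_. 0) < \<delta> * (e / 2)"
      using order_tendstoD(2)[OF A0, of "\<delta> * (e / 2)"] \<delta> e by auto
    then obtain N where N: "\<And>n. n \<ge> N \<Longrightarrow> pdist M (?A n) (\<lambda>_. 0) < \<delta> * (e / 2)"
      by (auto simp: eventually_sequentially)
    have "norm (pdist M (X n) (\<lambda>_. 0) - 0) < e" if "n \<ge> N" for n
    proof -
      have "pdist M (?A n) (\<lambda>_. 0) / \<delta> < e / 2" using N[OF that] \<delta> by (simp add: field_simps)
      then show ?thesis using bound[OF \<delta>(1,2), of n] \<delta>' pdist_nonneg[of "X n" "\<lambda>_. 0"]
        unfolding real_norm_def by linarith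
    qed
    then show "\<exists>N. \<forall>n\<ge>N. norm (pdist M (X n) (\<lambda>_. 0) - 0) < e" by blast
  qed
qed

end

section \<open>Multilinear Gaussian polynomials\<close>

text \<open>Polynomials of total degree at most \<open>m\<close> and of degree at most 1 in each
  variable. The coefficient \<open>h\<close> avoids the index \<open>j\<close>, so no square of a
  variable arises, while the summand \<open>f\<close> may contain \<open>g j\<close> again. Being a
  predicate on functions, it keeps the degree bound without a syntax of polynomials.\<close>

inductive multilin :: "('i \<Rightarrow> 'a \<Rightarrow> real) \<Rightarrow> nat \<Rightarrow> 'i set \<Rightarrow> ('a \<Rightarrow> real) \<Rightarrow> bool" for g where
  const: "multilin g m J (\<lambda>_. c)"
| step: "multilin g (Suc m) J f \<Longrightarrow> j \<in> J \<Longrightarrow> multilin g m (J - {j}) h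
    \<Longrightarrow> multilin g (Suc m) J (\<lambda>\<omega>. f \<omega> + g j \<omega> * h \<omega>)"

lemma multilin_mono:
  assumes "multilin g m J f" "m \<le> m'" "J \<subseteq> J'"
  shows "multilin g m' J' f"
  using assms
proof (induction arbitrary: m' J')
  case (step m J f j h)
  then obtain m'' where m'': "m' = Suc m''" "m \<le> m''" by (cases m') auto
  have "J - {j} \<subseteq> J' - {j}" using step by auto
  then show ?case using step m'' by (auto intro!: multilin.step)
qed (rule multilin.const)

lemma multilin_add_const: "multilin g m J f \<Longrightarrow> multilin g m J (\<lambda>\<omega>. f \<omega> + c)"
proof (induction rule: multilin.induct)
  case (step m J f j h)
  then have "multilin g (Suc m) J (\<lambda>\<omega>. (f \<omega> + c) + g j \<omega> * h \<omega>)" by (intro multilin.step)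
  then show ?case by (simp add: algebra_simps)
qed (simp add: multilin.const)

lemma multilin_add: "multilin g m J f \<Longrightarrow> multilin g m J f' \<Longrightarrow> multilin g m J (\<lambda>\<omega>. f \<omega> + f' \<omega>)"
proof (induction rule: multilin.induct)
  case (const m J c)
  then show ?case using multilin_add_const[of g m J f' c] by (simp add: add.commute)
next
  case (step m J f j h)
  then have "multilin g (Suc m) J (\<lambda>\<omega>. (f \<omega> + f' \<omega>) + g j \<omega> * h \<omega>)" by (intro multilin.step)
  then show ?case by (simp add: algebra_simps)
qed

lemma multilin_cmult: "multilin g m J f \<Longrightarrow> multilin g m J (\<lambda>\<omega>. c * f \<omega>)"
proof (induction rule: multilin.induct)
  case (step m J f j h)
  then have "multilin g (Suc m) J (\<lambda>\<omega>. c * f \<omega> + g j \<omega> * (c * h \<omega>))" by (intro multilin.step)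
  then show ?case by (simp add: algebra_simps)
qed (simp add: multilin.const)

lemma multilin_sum:
  assumes "\<And>x. x \<in> A \<Longrightarrow> multilin g m J (f x)"
  shows "multilin g m J (\<lambda>\<omega>. \<Sum>x\<in>A. f x \<omega>)"
  using assms
  by (induction A rule: infinite_finite_induct) (auto intro: multilin.const multilin_add)

lemma multilin_mult_var:
  assumes "multilin g m (J - {j}) h" "j \<in> J"
  shows "multilin g (Suc m) J (\<lambda>\<omega>. g j \<omega> * h \<omega>)"
  using multilin.step[OF multilin.const[where c=0] assms(2,1)] by simp

text \<open>Expansion along a single variable, the basis of both the moment induction and the
  product with an increment. The last clause records that a constant has no linear part, which
  \<open>m - 1\<close> cannot express at \<open>m = 0\<close>.\<close>

lemma multilin_decompose:
  assumes "multilin g m J f" "j \<in> J"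
  obtains Q R where "f = (\<lambda>\<omega>. Q \<omega> + g j \<omega> * R \<omega>)" "multilin g m (J - {j}) Q"
    "multilin g (m - 1) (J - {j}) R" "m = 0 \<longrightarrow> R = (\<lambda>_. 0)"
proof -
  from assms have "\<exists>Q R. f = (\<lambda>\<omega>. Q \<omega> + g j \<omega> * R \<omega>) \<and> multilin g m (J - {j}) Q \<and>
    multilin g (m - 1) (J - {j}) R \<and> (m = 0 \<longrightarrow> R = (\<lambda>_. 0))"
  proof (induction arbitrary: j rule: multilin.induct)
    case (const m J c)
    show ?case
      by (rule exI[where x="\<lambda>_. c"], rule exI[where x="\<lambda>_. 0"]) (auto intro: multilin.const)
  next
    case (step m J f i h)
    obtain Q R where f: "f = (\<lambda>\<omega>. Q \<omega> + g j \<omega> * R \<omega>)" "multilin g (Suc m) (J - {j}) Q"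
        "multilin g m (J - {j}) R"
      using step.IH(1)[OF \<open>j \<in> J\<close>] by auto
    show ?case
    proof (cases "i = j")
      case True
      have "(\<lambda>\<omega>. f \<omega> + g i \<omega> * h \<omega>) = (\<lambda>\<omega>. Q \<omega> + g j \<omega> * (R \<omega> + h \<omega>))"
        using f True by (auto simp: algebra_simps)
      moreover have "multilin g m (J - {j}) (\<lambda>\<omega>. R \<omega> + h \<omega>)"
        using f step True by (intro multilin_add) auto
      ultimately show ?thesis using f(2)
        by (intro exI[where x=Q] exI[where x="\<lambda>\<omega>. R \<omega> + h \<omega>"]) simp
    next
      case False
      then have "j \<in> J - {i}" using step by auto
      from step.IH(2)[OF this] obtain Q' R' where h: "h = (\<lambda>\<omega>. Q' \<omega> + g j \<omega> * R' \<omega>)"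
          "multilin g m (J - {i} - {j}) Q'" "multilin g (m - 1) (J - {i} - {j}) R'" "m = 0 \<longrightarrow> R' = (\<lambda>_. 0)"
        by (elim exE conjE) (rule that)
      have e: "J - {i} - {j} = J - {j} - {i}" and i: "i \<in> J - {j}" using step False by auto
      have 1: "(\<lambda>\<omega>. f \<omega> + g i \<omega> * h \<omega>) = (\<lambda>\<omega>. (Q \<omega> + g i \<omega> * Q' \<omega>) + g j \<omega> * (R \<omega> + g i \<omega> * R' \<omega>))"
        using f h by (auto simp: algebra_simps)
      have 2: "multilin g (Suc m) (J - {j}) (\<lambda>\<omega>. Q \<omega> + g i \<omega> * Q' \<omega>)"
        using f h i unfolding e by (intro multilin.step)
      \<comment> \<open>The product with \<open>g i\<close> needs one more degree than
        \<open>R'\<close> has; at \<open>m = 0\<close> none is left, but there \<open>R'\<close>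
        vanishes.\<close>
      have 3: "multilin g m (J - {j}) (\<lambda>\<omega>. R \<omega> + g i \<omega> * R' \<omega>)"
      proof (cases m)
        case 0
        then show ?thesis using f h by simp
      next
        case (Suc m')
        then show ?thesis using f h i unfolding e by (auto intro!: multilin.step)
      qed
      show ?thesis
        using 1 2 3 by (intro exI[where x="\<lambda>\<omega>. Q \<omega> + g i \<omega> * Q' \<omega>"]
            exI[where x="\<lambda>\<omega>. R \<omega> + g i \<omega> * R' \<omega>"]) simp
    qed
  qed
  then show thesis
  proof (elim exE conjE)
    fix Q R assume a: "f = (\<lambda>\<omega>. Q \<omega> + g j \<omega> * R \<omega>)" "multilin g m (J - {j}) Q"
      "multilin g (m - 1) (J - {j}) R" "m = 0 \<longrightarrow> R = (\<lambda>_. 0)"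
    show thesis by (rule that[OF a])
  qed
qed

text \<open>Distinct variables are replaced by sums over disjoint blocks, so a product of distinct
  variables expands into products of distinct new variables and stays multilinear.\<close>

lemma multilin_refine:
  assumes "multilin g m J f"
    and "\<And>j \<omega>. j \<in> J \<Longrightarrow> g j \<omega> = (\<Sum>l\<in>Bl j. g' l \<omega>)"
    and "disjoint_family_on Bl J" "\<And>j. j \<in> J \<Longrightarrow> Bl j \<subseteq> J'"
  shows "multilin g' m J' f"
  using assms
proof (induction arbitrary: J' rule: multilin.induct)
  case (step m J f j h)
  have f: "multilin g' (Suc m) J' f" by (rule step.IH(1)) (use step in auto)
  have h: "multilin g' m (J' - Bl j) h"
  proof (rule step.IH(2))
    show "disjoint_family_on Bl (J - {j})"
      using step by (auto simp: disjoint_family_on_def)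
    show "Bl i \<subseteq> J' - Bl j" if "i \<in> J - {j}" for i
    proof -
      have "Bl i \<inter> Bl j = {}" "Bl i \<subseteq> J'"
        using step.prems(2) step.prems(3)[of i] step.hyps that by (auto simp: disjoint_family_on_def)
      then show ?thesis by auto
    qed
  qed (use step in auto)
  have "multilin g' (Suc m) J' (\<lambda>\<omega>. g' l \<omega> * h \<omega>)" if "l \<in> Bl j" for l
    by (rule multilin_mult_var, rule multilin_mono[OF h]) (use that step.prems(3)[OF step.hyps(2)] in auto)
  then have "multilin g' (Suc m) J' (\<lambda>\<omega>. f \<omega> + (\<Sum>l\<in>Bl j. g' l \<omega> * h \<omega>))"
    by (intro multilin_add f multilin_sum)
  then show ?case using step by (simp add: sum_distrib_right)
qed (simp add: multilin.const)

text \<open>Factoring through the restricted family of variables is the form in which independence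
  of disjoint groups can be applied.\<close>

lemma multilin_factor:
  assumes "multilin g m J f"
  shows "\<exists>F\<in>borel_measurable (PiM J (\<lambda>_. borel)). \<forall>\<omega>. f \<omega> = F (restrict (\<lambda>i. g i \<omega>) J)"
  using assms
proof (induction rule: multilin.induct)
  case (const m J c)
  show ?case by (rule bexI[where x="\<lambda>_. c"]) auto
next
  case (step m J f j h)
  from step.IH(1) obtain F where F: "F \<in> borel_measurable (PiM J (\<lambda>_. borel))"
    "\<And>\<omega>. f \<omega> = F (restrict (\<lambda>i. g i \<omega>) J)" by blast
  from step.IH(2) obtain H where H: "H \<in> borel_measurable (PiM (J - {j}) (\<lambda>_. borel))"
    "\<And>\<omega>. h \<omega> = H (restrict (\<lambda>i. g i \<omega>) (J - {j}))" by blast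
  have [measurable]: "(\<lambda>x. H (restrict x (J - {j}))) \<in> borel_measurable (PiM J (\<lambda>_. borel))"
    by (rule measurable_compose[OF measurable_restrict_subset H(1)]) auto
  have [measurable]: "(\<lambda>x. x j) \<in> borel_measurable (PiM J (\<lambda>_. borel))"
    using step by (intro measurable_component_singleton)
  note F(1)[measurable]
  have "(\<lambda>x. F x + x j * H (restrict x (J - {j}))) \<in> borel_measurable (PiM J (\<lambda>_. borel))"
    by measurable
  moreover have "f \<omega> + g j \<omega> * h \<omega> = (\<lambda>x. F x + x j * H (restrict x (J - {j}))) (restrict (\<lambda>i. g i \<omega>) J)" for \<omega>
  proof -
    have "restrict (restrict (\<lambda>i. g i \<omega>) J) (J - {j}) = restrict (\<lambda>i. g i \<omega>) (J - {j})" by auto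
    then show ?thesis using F(2) H(2) step.hyps(2) by simp
  qed
  ultimately show ?case
    by (intro bexI[where x="\<lambda>x. F x + x j * H (restrict x (J - {j}))"] allI)
qed

lemma multilin_measurable:
  assumes "multilin g m J f" "\<And>j. j \<in> J \<Longrightarrow> g j \<in> borel_measurable N"
  shows "f \<in> borel_measurable N"
  using assms by (induction rule: multilin.induct) auto

text \<open>Optimising the weight: for \<open>A > 0\<close> take \<open>l = x / A\<close>. For
  \<open>A = 0\<close> the best weight is infinite, and a large one such as
  \<open>(B + 1) / x\<close> yields a contradiction with \<open>x > 0\<close>.\<close>

lemma square_le_of_AM_GM:
  fixes x A B :: real
  assumes "\<And>l. 0 < l \<Longrightarrow> 2 * x \<le> l * A + B / l" "0 \<le> A" "0 \<le> B" "0 \<le> x"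
  shows "x\<^sup>2 \<le> A * B"
proof (cases "x = 0")
  case False
  then have x: "x > 0" using assms by simp
  show ?thesis
  proof (cases "A = 0")
    case True
    have "2 * x \<le> B / ((B + 1) / x)" using assms(1)[of "(B + 1) / x"] x assms(3) True by simp
    also have "\<dots> \<le> x" using x assms(3) by (simp add: field_simps)
    finally show ?thesis using x by simp
  next
    case False
    then have A: "A > 0" using assms by simp
    have "2 * x \<le> x + B * A / x" using assms(1)[of "x / A"] x A by (simp add: field_simps)
    then have "x \<le> B * A / x" by simp
    then show ?thesis using x by (simp add: field_simps power2_eq_square)
  qed
qed (use assms in simp)

section \<open>Fourth-moment comparison and second moments of limits in probability\<close>

context prob_space
begin

lemma Cauchy_Schwarz_squares:
  assumes "X \<in> borel_measurable M" "Y \<in> borel_measurable M"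
    and i: "integrable M (\<lambda>\<omega>. (X \<omega>)^2 :: real)" "integrable M (\<lambda>\<omega>. (Y \<omega>)^2 :: real)"
  shows "integrable M (\<lambda>\<omega>. X \<omega> * Y \<omega>)"
    and "(\<integral>\<omega>. X \<omega> * Y \<omega> \<partial>M)\<^sup>2 \<le> (\<integral>\<omega>. (X \<omega>)^2 \<partial>M) * (\<integral>\<omega>. (Y \<omega>)^2 \<partial>M)"
proof -
  have pw: "2 * \<bar>x * y\<bar> \<le> l * x\<^sup>2 + y\<^sup>2 / l" if "0 < l" for x y l :: real
  proof -
    have "0 \<le> (l * \<bar>x\<bar> - \<bar>y\<bar>)\<^sup>2" by simp
    then have "2 * l * \<bar>x * y\<bar> \<le> l\<^sup>2 * x\<^sup>2 + y\<^sup>2"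
      by (simp add: power2_diff power_mult_distrib abs_mult algebra_simps)
    then show ?thesis using that by (simp add: field_simps power2_eq_square)
  qed
  have pw': "\<bar>x * y\<bar> \<le> x\<^sup>2 + y\<^sup>2" for x y :: real
    using pw[of 1 x y] by simp
  show int: "integrable M (\<lambda>\<omega>. X \<omega> * Y \<omega>)"
    by (rule Bochner_Integration.integrable_bound[OF Bochner_Integration.integrable_add[OF i]])
      (use assms pw' in auto)
  have "2 * \<bar>\<integral>\<omega>. X \<omega> * Y \<omega> \<partial>M\<bar> \<le> l * (\<integral>\<omega>. (X \<omega>)^2 \<partial>M) + (\<integral>\<omega>. (Y \<omega>)^2 \<partial>M) / l" if "0 < l" for l
  proof -
    have "2 * \<bar>\<integral>\<omega>. X \<omega> * Y \<omega> \<partial>M\<bar> \<le> 2 * (\<integral>\<omega>. \<bar>X \<omega> * Y \<omega>\<bar> \<partial>M)"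
      by (simp add: integral_abs_bound)
    also have "\<dots> = (\<integral>\<omega>. 2 * \<bar>X \<omega> * Y \<omega>\<bar> \<partial>M)" by simp
    also have "\<dots> \<le> (\<integral>\<omega>. l * (X \<omega>)^2 + (Y \<omega>)^2 / l \<partial>M)"
      using pw[OF that] int i by (intro integral_mono) auto
    also have "\<dots> = l * (\<integral>\<omega>. (X \<omega>)^2 \<partial>M) + (\<integral>\<omega>. (Y \<omega>)^2 \<partial>M) / l"
      using i by simp
    finally show ?thesis .
  qed
  from square_le_of_AM_GM[OF this]
  show "(\<integral>\<omega>. X \<omega> * Y \<omega> \<partial>M)\<^sup>2 \<le> (\<integral>\<omega>. (X \<omega>)^2 \<partial>M) * (\<integral>\<omega>. (Y \<omega>)^2 \<partial>M)" by simp
qed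

lemma integrable_power_le_4:
  assumes "X \<in> borel_measurable M" "integrable M (\<lambda>\<omega>. (X \<omega>)^4 :: real)" "k \<le> 4"
  shows "integrable M (\<lambda>\<omega>. (X \<omega>)^k)"
proof -
  have b: "\<bar>x ^ k\<bar> \<le> 1 + x^4" for x :: real
  proof (cases "\<bar>x\<bar> \<le> 1")
    case True
    then have "\<bar>x\<bar> ^ k \<le> 1" by (simp add: power_le_one)
    moreover have "0 \<le> x^4" by simp
    ultimately show ?thesis unfolding power_abs by linarith
  next
    case False
    then have "\<bar>x\<bar> ^ k \<le> \<bar>x\<bar>^4" using assms(3) by (intro power_increasing) auto
    then show ?thesis by (simp add: power_abs)
  qed
  show ?thesis
    by (rule Bochner_Integration.integrable_bound[where f="\<lambda>\<omega>. 1 + (X \<omega>)^4"])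
      (use assms b in auto)
qed

text \<open>The odd moments of \<open>g j\<close> vanish, so the mixed terms of \<open>(Q + g j R)^4\<close> leave
  \<open>E Q^4 + 6 v E Q^2 R^2 + 3 v^2 E R^4\<close>, and the constants \<open>9^m\<close> close the induction.\<close>

lemma multilin_hypercontractive:
  assumes "finite J" "indep_vars (\<lambda>_. borel) g J"
    and g: "\<And>j. j \<in> J \<Longrightarrow> integrable M (\<lambda>\<omega>. (g j \<omega>)^4)" "\<And>j. j \<in> J \<Longrightarrow> expectation (g j) = 0"
      "\<And>j. j \<in> J \<Longrightarrow> expectation (\<lambda>\<omega>. (g j \<omega>)^3) = 0"
      "\<And>j. j \<in> J \<Longrightarrow> expectation (\<lambda>\<omega>. (g j \<omega>)^4) \<le> 3 * (expectation (\<lambda>\<omega>. (g j \<omega>)^2))\<^sup>2"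
    and "multilin g m J f"
  shows "integrable M (\<lambda>\<omega>. (f \<omega>)^4) \<and> expectation (\<lambda>\<omega>. (f \<omega>)^4) \<le> 9^m * (expectation (\<lambda>\<omega>. (f \<omega>)^2))\<^sup>2"
  using assms
proof (induction J arbitrary: m f rule: finite_induct)
  case empty
  have "multilin g m K f \<Longrightarrow> K = {} \<Longrightarrow> \<exists>c. f = (\<lambda>_. c)" for K
    by (induction rule: multilin.induct) auto
  with empty obtain c where f: "f = (\<lambda>_. c)" by blast
  have "1 * c^4 \<le> 9^m * c^4" by (intro mult_right_mono) auto
  then show ?case unfolding f by (simp add: prob_space)
next
  case (insert j J)
  have gm: "g i \<in> borel_measurable M" if "i \<in> insert j J" for i
    using insert.prems(1) that by (auto simp: indep_vars_def)
  obtain Q R where f: "f = (\<lambda>\<omega>. Q \<omega> + g j \<omega> * R \<omega>)" and Q: "multilin g m J Q"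
    and R: "multilin g (m - 1) J R" and m0: "m = 0 \<longrightarrow> R = (\<lambda>_. 0)"
    using multilin_decompose[OF insert.prems(6), of j] insert.hyps by auto
  have [measurable]: "Q \<in> borel_measurable M" "R \<in> borel_measurable M" "g j \<in> borel_measurable M"
    using Q R gm by (auto intro: multilin_measurable)
  have ind: "indep_vars (\<lambda>_. borel) g J" using insert.prems(1) by (rule indep_vars_subset) auto
  note IH = insert.IH[OF ind]
  have IQ: "integrable M (\<lambda>\<omega>. (Q \<omega>)^4)" "expectation (\<lambda>\<omega>. (Q \<omega>)^4) \<le> 9^m * (expectation (\<lambda>\<omega>. (Q \<omega>)^2))\<^sup>2"
    using IH[OF _ _ _ _ Q] insert.prems by auto
  have IR: "integrable M (\<lambda>\<omega>. (R \<omega>)^4)" "expectation (\<lambda>\<omega>. (R \<omega>)^4) \<le> 9^(m-1) * (expectation (\<lambda>\<omega>. (R \<omega>)^2))\<^sup>2"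
    using IH[OF _ _ _ _ R] insert.prems by auto
  obtain FQ where FQ: "FQ \<in> borel_measurable (PiM J (\<lambda>_. borel))" "\<And>\<omega>. Q \<omega> = FQ (restrict (\<lambda>i. g i \<omega>) J)"
    using multilin_factor[OF Q] by blast
  obtain FR where FR: "FR \<in> borel_measurable (PiM J (\<lambda>_. borel))" "\<And>\<omega>. R \<omega> = FR (restrict (\<lambda>i. g i \<omega>) J)"
    using multilin_factor[OF R] by blast
  \<comment> \<open>\<open>Q\<close> and \<open>R\<close> are measurable functions of the variables
    in \<open>J\<close>, which does not contain \<open>j\<close>. General exponents cover all mixed
    moments in the expansions of \<open>f^2\<close> and \<open>f^4\<close>.\<close>
  have iv: "indep_var borel (\<lambda>\<omega>. (g j \<omega>)^a) borel (\<lambda>\<omega>. (Q \<omega>)^b * (R \<omega>)^c)" for a b c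
  proof -
    have 1: "indep_var (PiM {j} (\<lambda>_. borel)) (\<lambda>\<omega>. restrict (\<lambda>i. g i \<omega>) {j})
        (PiM J (\<lambda>_. borel)) (\<lambda>\<omega>. restrict (\<lambda>i. g i \<omega>) J)"
      by (rule indep_var_restrict[OF insert.prems(1)]) (use insert.hyps in auto)
    have "indep_var borel ((\<lambda>x. (x j)^a) \<circ> (\<lambda>\<omega>. restrict (\<lambda>i. g i \<omega>) {j}))
        borel ((\<lambda>x. (FQ x)^b * (FR x)^c) \<circ> (\<lambda>\<omega>. restrict (\<lambda>i. g i \<omega>) J))"
      by (rule indep_var_compose[OF 1]) (use FQ(1) FR(1) in measurable)
    then show ?thesis using FQ(2) FR(2) by (simp add: comp_def)
  qed
  have g4: "integrable M (\<lambda>\<omega>. (g j \<omega>)^4)" using insert.prems by auto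
  have gk: "integrable M (\<lambda>\<omega>. (g j \<omega>)^k)" if "k \<le> 4" for k
    using integrable_power_le_4[OF _ g4 that] by auto
  have Q2: "integrable M (\<lambda>\<omega>. ((Q \<omega>)^2)^2)" and R2: "integrable M (\<lambda>\<omega>. ((R \<omega>)^2)^2)"
    using IQ IR by simp_all
  have QR2: "integrable M (\<lambda>\<omega>. (Q \<omega>)^2 * (R \<omega>)^2)"
    by (rule Cauchy_Schwarz_squares(1)[OF _ _ Q2 R2]) auto
  have QR: "integrable M (\<lambda>\<omega>. (Q \<omega>)^b * (R \<omega>)^c)" if "b + c = 4 \<or> b + c = 2" for b c
  proof -
    have bd: "\<bar>x^b * y^c\<bar> \<le> 1 + x^4 + y^4" for x y :: real
    proof -
      define z where "z = max \<bar>x\<bar> \<bar>y\<bar>"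
      have z: "\<bar>x\<bar> \<le> z" "\<bar>y\<bar> \<le> z" "0 \<le> z" by (auto simp: z_def)
      have "\<bar>x^b * y^c\<bar> = \<bar>x\<bar>^b * \<bar>y\<bar>^c" by (simp add: abs_mult power_abs)
      also have "\<dots> \<le> z^b * z^c" using z by (intro mult_mono power_mono) auto
      also have "\<dots> = z^(b+c)" by (simp add: power_add)
      also have "\<dots> \<le> 1 + z^4"
      proof (cases "z \<le> 1")
        case True
        then have "z^(b+c) \<le> 1" using z by (simp add: power_le_one)
        moreover have "0 \<le> z^4" by simp
        ultimately show ?thesis by linarith
      next
        case False
        then have "z^(b+c) \<le> z^4" using that by (intro power_increasing) auto
        then show ?thesis by linarith
      qed
      also have "z^4 \<le> x^4 + y^4"
        by (cases "\<bar>x\<bar> \<le> \<bar>y\<bar>") (auto simp: z_def max_def)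
      finally show ?thesis by simp
    qed
    show ?thesis
      by (rule Bochner_Integration.integrable_bound[where f="\<lambda>\<omega>. 1 + (Q \<omega>)^4 + (R \<omega>)^4"])
        (use IQ IR bd in auto)
  qed
  have E: "integrable M (\<lambda>\<omega>. (g j \<omega>)^a * ((Q \<omega>)^b * (R \<omega>)^c)) \<and>
      expectation (\<lambda>\<omega>. (g j \<omega>)^a * ((Q \<omega>)^b * (R \<omega>)^c)) =
      expectation (\<lambda>\<omega>. (g j \<omega>)^a) * expectation (\<lambda>\<omega>. (Q \<omega>)^b * (R \<omega>)^c)"
    if "a \<le> 4" "b + c = 4 \<or> b + c = 2" for a b c
    using indep_var_integrable[OF iv gk[OF that(1)] QR[OF that(2)]]
      indep_var_lebesgue_integral[OF iv gk[OF that(1)] QR[OF that(2)]] by auto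
  define v where "v = expectation (\<lambda>\<omega>. (g j \<omega>)^2)"
  define q where "q = expectation (\<lambda>\<omega>. (Q \<omega>)^2)"
  define r where "r = expectation (\<lambda>\<omega>. (R \<omega>)^2)"
  have nn: "0 \<le> v" "0 \<le> q" "0 \<le> r" by (auto simp: v_def q_def r_def)
  have f4: "(f \<omega>)^4 = (Q \<omega>)^4 + 4 * ((g j \<omega>)^1 * ((Q \<omega>)^3 * (R \<omega>)^1)) + 6 * ((g j \<omega>)^2 * ((Q \<omega>)^2 * (R \<omega>)^2))
      + 4 * ((g j \<omega>)^3 * ((Q \<omega>)^1 * (R \<omega>)^3)) + ((g j \<omega>)^4 * ((Q \<omega>)^0 * (R \<omega>)^4))" for \<omega>
    unfolding f by (simp add: power4_eq_xxxx power3_eq_cube power2_eq_square algebra_simps)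
  have f2: "(f \<omega>)^2 = (Q \<omega>)^2 + 2 * ((g j \<omega>)^1 * ((Q \<omega>)^1 * (R \<omega>)^1)) + ((g j \<omega>)^2 * ((Q \<omega>)^0 * (R \<omega>)^2))" for \<omega>
    unfolding f by (simp add: power2_eq_square algebra_simps)
  have int4: "integrable M (\<lambda>\<omega>. (f \<omega>)^4)"
    unfolding f4
    by (rule Bochner_Integration.integrable_add Bochner_Integration.integrable_mult_right
      IQ(1) E[THEN conjunct1] impI | simp)+
  have "expectation (\<lambda>\<omega>. (f \<omega>)^4) = expectation (\<lambda>\<omega>. (Q \<omega>)^4) + 6 * v * expectation (\<lambda>\<omega>. (Q \<omega>)^2 * (R \<omega>)^2)
      + expectation (\<lambda>\<omega>. (g j \<omega>)^4) * expectation (\<lambda>\<omega>. (R \<omega>)^4)"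
    unfolding f4 using IQ E[of 1 3 1] E[of 2 2 2] E[of 3 1 3] E[of 4 0 4] insert.prems(3,4)[of j]
    by (simp add: v_def)
  \<comment> \<open>The middle bound is Cauchy-Schwarz with the two induction hypotheses: the root
    of \<open>9^m * 9^(m-1)\<close> is \<open>9^m / 3\<close>. The last one uses the Gaussian fourth
    moment and \<open>3 * 9^(m-1) <= 9^m\<close>. Since \<open>6 / 3 = 2\<close>, the three terms
    then form the square of \<open>q + v * r\<close>.\<close>
  also have "\<dots> \<le> 9^m * q^2 + 6 * v * (9^m * q * r / 3) + 9^m * (v * r)^2"
  proof (intro add_mono mult_left_mono)
    show "expectation (\<lambda>\<omega>. (Q \<omega>)^4) \<le> 9^m * q^2" using IQ(2) by (simp add: q_def)
    show "expectation (\<lambda>\<omega>. (Q \<omega>)^2 * (R \<omega>)^2) \<le> 9^m * q * r / 3"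
    proof (cases m)
      case 0
      then show ?thesis using m0 nn by simp
    next
      case (Suc k)
      have "(expectation (\<lambda>\<omega>. (Q \<omega>)^2 * (R \<omega>)^2))\<^sup>2 \<le> expectation (\<lambda>\<omega>. ((Q \<omega>)^2)^2) * expectation (\<lambda>\<omega>. ((R \<omega>)^2)^2)"
        by (rule Cauchy_Schwarz_squares(2)[OF _ _ Q2 R2]) auto
      also have "\<dots> \<le> (9^m * q^2) * (9^k * r^2)"
        using IQ(2) IR(2) Suc by (intro mult_mono) (auto simp: q_def r_def)
      also have "\<dots> = (9^m * q * r / 3)\<^sup>2"
        using Suc by (simp add: power2_eq_square field_simps)
      finally show ?thesis by (rule power2_le_imp_le) (use nn in auto)
    qed
    show "expectation (\<lambda>\<omega>. (g j \<omega>)^4) * expectation (\<lambda>\<omega>. (R \<omega>)^4) \<le> 9^m * (v * r)^2"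
    proof (cases m)
      case 0
      then show ?thesis using m0 nn by simp
    next
      case (Suc k)
      have "expectation (\<lambda>\<omega>. (g j \<omega>)^4) * expectation (\<lambda>\<omega>. (R \<omega>)^4) \<le> (3 * v^2) * (9^k * r^2)"
        using IR(2) Suc insert.prems(5)[of j] by (intro mult_mono) (auto simp: v_def r_def)
      also have "\<dots> \<le> (9 * v^2) * (9^k * r^2)" by (intro mult_right_mono) auto
      finally show ?thesis using Suc by (simp add: power_mult_distrib algebra_simps)
    qed
  qed (use nn in auto)
  also have "\<dots> = 9^m * (q + v * r)^2" by (simp add: power2_eq_square algebra_simps)
  also have "q + v * r = expectation (\<lambda>\<omega>. (f \<omega>)^2)"
    unfolding f2 using E[of 1 1 1] E[of 2 0 2] insert.prems(3)[of j] QR[of 2 0]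
    by (simp add: q_def v_def r_def)
  finally show ?case using int4 by blast
qed

lemma normal_moments:
  assumes D: "distributed M lborel X (normal_density 0 \<sigma>)" and \<sigma>: "0 < \<sigma>"
  shows "integrable M (\<lambda>\<omega>. (X \<omega>)^k)" "expectation (\<lambda>\<omega>. (X \<omega>)^2) = \<sigma>\<^sup>2"
    "expectation (\<lambda>\<omega>. (X \<omega>)^4) = 3 * (\<sigma>\<^sup>2)\<^sup>2" "odd k \<Longrightarrow> expectation (\<lambda>\<omega>. (X \<omega>)^k) = 0"
proof -
  have E: "expectation (\<lambda>\<omega>. (X \<omega>)^k) = (\<integral>x. normal_density 0 \<sigma> x * (x - 0)^k \<partial>lborel)" for k
    using distributed_integral[OF D, of "\<lambda>x. x^k"] by (simp add: normal_density_nonneg)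
  show "integrable M (\<lambda>\<omega>. (X \<omega>)^k)"
    using distributed_integrable[OF D, of "\<lambda>x. x^k"] integrable_normal_moment[OF \<sigma>, of 0 k]
    by (simp add: normal_density_nonneg)
  show "expectation (\<lambda>\<omega>. (X \<omega>)^2) = \<sigma>\<^sup>2"
    unfolding E using integral_normal_moment_even[OF \<sigma>, of 0 1] by simp
  show "expectation (\<lambda>\<omega>. (X \<omega>)^4) = 3 * (\<sigma>\<^sup>2)\<^sup>2"
    unfolding E using integral_normal_moment_even[OF \<sigma>, of 0 2] \<sigma>
    by (simp add: fact_numeral power2_eq_square field_simps)
  assume "odd k"
  then obtain j where "k = 2 * j + 1" by (elim oddE)
  then show "expectation (\<lambda>\<omega>. (X \<omega>)^k) = 0"
    unfolding E using integral_normal_moment_odd[OF \<sigma>, of 0 j] by simp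
qed

lemma indep_sum_square:
  fixes X :: "'i \<Rightarrow> 'a \<Rightarrow> real"
  assumes "finite I" "indep_vars (\<lambda>_. borel) X I"
    and "\<And>i. i \<in> I \<Longrightarrow> integrable M (\<lambda>\<omega>. (X i \<omega>)^2)" "\<And>i. i \<in> I \<Longrightarrow> expectation (X i) = 0"
  shows "integrable M (\<lambda>\<omega>. (\<Sum>i\<in>I. X i \<omega>)^2) \<and>
    expectation (\<lambda>\<omega>. (\<Sum>i\<in>I. X i \<omega>)^2) = (\<Sum>i\<in>I. expectation (\<lambda>\<omega>. (X i \<omega>)^2))"
  using assms
proof (induction I rule: finite_induct)
  case (insert j I)
  have meas: "X i \<in> borel_measurable M" if "i \<in> insert j I" for i
    using insert.prems(1) that by (auto simp: indep_vars_def)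
  have int: "integrable M (X i)" if "i \<in> insert j I" for i
    using square_integrable_imp_integrable[OF meas[OF that] insert.prems(2)[OF that]] .
  have IH: "integrable M (\<lambda>\<omega>. (\<Sum>i\<in>I. X i \<omega>)^2)"
    "expectation (\<lambda>\<omega>. (\<Sum>i\<in>I. X i \<omega>)^2) = (\<Sum>i\<in>I. expectation (\<lambda>\<omega>. (X i \<omega>)^2))"
    using insert.IH[OF indep_vars_subset[OF insert.prems(1)]] insert.prems by auto
  have iv: "indep_var borel (X j) borel (\<lambda>\<omega>. \<Sum>i\<in>I. X i \<omega>)"
    using insert by (intro indep_vars_sum) auto
  have iS: "integrable M (\<lambda>\<omega>. \<Sum>i\<in>I. X i \<omega>)" using int by auto
  have X: "integrable M (\<lambda>\<omega>. X j \<omega> * (\<Sum>i\<in>I. X i \<omega>))" "expectation (\<lambda>\<omega>. X j \<omega> * (\<Sum>i\<in>I. X i \<omega>)) = 0"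
    using indep_var_integrable[OF iv _ iS] indep_var_lebesgue_integral[OF iv _ iS] int insert.prems(3)[of j]
    by auto
  have sq: "(\<Sum>i\<in>insert j I. X i \<omega>)^2 = (X j \<omega>)^2 + 2 * (X j \<omega> * (\<Sum>i\<in>I. X i \<omega>)) + (\<Sum>i\<in>I. X i \<omega>)^2" for \<omega>
    using insert.hyps by (simp add: power2_sum)
  show ?case unfolding sq using X IH insert.prems(2)[of j] insert.hyps by simp
qed simp

lemma pdist_le_L2:
  assumes "X \<in> borel_measurable M" "Y \<in> borel_measurable M" "integrable M (\<lambda>\<omega>. (X \<omega> - Y \<omega>)^2)"
  shows "pdist M X Y \<le> sqrt (expectation (\<lambda>\<omega>. (X \<omega> - Y \<omega>)^2))"
proof (rule real_le_rsqrt)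
  let ?Z = "\<lambda>\<omega>. min 1 \<bar>X \<omega> - Y \<omega>\<bar>"
  have m: "min 1 \<bar>x\<bar> ^ 2 \<le> x^2" for x :: real
    using power_mono[of "min 1 \<bar>x\<bar>" "\<bar>x\<bar>" 2] by simp
  have i: "integrable M (\<lambda>\<omega>. (?Z \<omega>)^2)"
    by (rule Bochner_Integration.integrable_bound[OF assms(3)]) (use assms m in auto)
  have "(pdist M X Y)\<^sup>2 \<le> expectation (\<lambda>\<omega>. (?Z \<omega>)^2)"
    using Cauchy_Schwarz_squares(2)[of ?Z "\<lambda>_. 1"] i assms by (simp add: pdist_def prob_space)
  also have "\<dots> \<le> expectation (\<lambda>\<omega>. (X \<omega> - Y \<omega>)^2)"
    using i assms m by (intro integral_mono) auto
  finally show "(pdist M X Y)\<^sup>2 \<le> expectation (\<lambda>\<omega>. (X \<omega> - Y \<omega>)^2)" .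
qed

text \<open>Reverse Paley-Zygmund: under a fourth-moment bound, a tail bound in probability
  controls the second moment.\<close>

lemma second_moment_le_of_tail:
  assumes [measurable]: "f \<in> borel_measurable M" and i4: "integrable M (\<lambda>\<omega>. (f \<omega>)^4)"
    and C: "expectation (\<lambda>\<omega>. (f \<omega>)^4) \<le> C * (expectation (\<lambda>\<omega>. (f \<omega>)^2))\<^sup>2" "0 < C"
    and tail: "prob {\<omega>\<in>space M. L < \<bar>f \<omega>\<bar>} \<le> 1 / (4 * C)" and L: "0 \<le> L"
  shows "expectation (\<lambda>\<omega>. (f \<omega>)^2) \<le> 2 * L\<^sup>2"
proof -
  define A where "A = {\<omega>\<in>space M. L < \<bar>f \<omega>\<bar>}"
  have [measurable]: "A \<in> sets M" by (simp add: A_def)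
  have i2: "integrable M (\<lambda>\<omega>. (f \<omega>)^2)" using integrable_power_le_4[OF _ i4] by simp
  have iA: "integrable M (\<lambda>\<omega>. (indicator A \<omega> :: real)^2)"
    by (rule integrable_const_bound[where B=1]) (auto simp: indicator_def)
  have PA: "expectation (\<lambda>\<omega>. (indicator A \<omega> :: real)^2) = prob A"
    by (subst Bochner_Integration.integral_cong[where g="indicator A" and N=M])
      (auto simp: indicator_def)
  define V where "V = expectation (\<lambda>\<omega>. (f \<omega>)^2)"
  have V: "0 \<le> V" by (simp add: V_def)
  have i22: "integrable M (\<lambda>\<omega>. ((f \<omega>)^2)^2)" using i4 by simp
  note CS = Cauchy_Schwarz_squares[of "\<lambda>\<omega>. (f \<omega>)^2" "\<lambda>\<omega>. indicator A \<omega> :: real", OF _ _ i22 iA]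
  \<comment> \<open>Cauchy-Schwarz on the tail event \<open>A\<close>: the fourth-moment bound and
    its small probability leave at most half of the second moment on \<open>A\<close>. The other
    half lives where \<open>f^2\<close> is at most \<open>L^2\<close>.\<close>
  have "(expectation (\<lambda>\<omega>. (f \<omega>)^2 * indicator A \<omega>))\<^sup>2 \<le> expectation (\<lambda>\<omega>. (f \<omega>)^4) * prob A"
    using CS(2) PA by simp
  also have "\<dots> \<le> (C * V\<^sup>2) * (1 / (4 * C))"
    using C tail by (intro mult_mono) (auto simp: V_def A_def)
  also have "\<dots> = (V / 2)\<^sup>2" using C(2) by (simp add: power2_eq_square)
  finally have *: "expectation (\<lambda>\<omega>. (f \<omega>)^2 * indicator A \<omega>) \<le> V / 2"
    by (rule power2_le_imp_le) (use V in simp)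
  have iA': "integrable M (\<lambda>\<omega>. (f \<omega>)^2 * indicator A \<omega>)" using CS(1) by simp
  have "V \<le> expectation (\<lambda>\<omega>. L\<^sup>2 + (f \<omega>)^2 * indicator A \<omega>)"
    unfolding V_def
  proof (rule integral_mono)
    fix \<omega> assume "\<omega> \<in> space M"
    then show "(f \<omega>)^2 \<le> L\<^sup>2 + (f \<omega>)^2 * indicator A \<omega>"
      using power_mono[of "\<bar>f \<omega>\<bar>" L 2] by (auto simp: A_def indicator_def)
  qed (use i2 iA' in auto)
  also have "\<dots> = L\<^sup>2 + expectation (\<lambda>\<omega>. (f \<omega>)^2 * indicator A \<omega>)"
    using iA' by (simp add: prob_space)
  finally show ?thesis using * by (simp add: V_def)
qed

lemma L2_Fatou:
  fixes f :: "nat \<Rightarrow> 'a \<Rightarrow> real"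
  assumes [measurable]: "\<And>n. f n \<in> borel_measurable M" "Y \<in> borel_measurable M"
    and lim: "AE \<omega> in M. (\<lambda>n. f n \<omega>) \<longlonglongrightarrow> Y \<omega>"
    and int: "\<And>n. integrable M (\<lambda>\<omega>. (f n \<omega>)^2)" "\<And>n. expectation (\<lambda>\<omega>. (f n \<omega>)^2) \<le> K"
  shows "integrable M (\<lambda>\<omega>. (Y \<omega>)^2)"
proof (rule integrableI_bounded)
  have "(\<integral>\<^sup>+\<omega>. ennreal ((Y \<omega>)^2) \<partial>M) = (\<integral>\<^sup>+\<omega>. liminf (\<lambda>n. ennreal ((f n \<omega>)^2)) \<partial>M)"
  proof (rule nn_integral_cong_AE)
    from lim show "AE \<omega> in M. ennreal ((Y \<omega>)^2) = liminf (\<lambda>n. ennreal ((f n \<omega>)^2))"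
    proof eventually_elim
      case (elim \<omega>)
      then have "(\<lambda>n. ennreal ((f n \<omega>)^2)) \<longlonglongrightarrow> ennreal ((Y \<omega>)^2)" by (intro tendsto_intros)
      then show ?case using lim_imp_Liminf[OF sequentially_bot] by force
    qed
  qed
  also have "\<dots> \<le> liminf (\<lambda>n. \<integral>\<^sup>+\<omega>. ennreal ((f n \<omega>)^2) \<partial>M)"
    by (rule nn_integral_liminf) auto
  also have "\<dots> \<le> liminf (\<lambda>n::nat. ennreal K)"
  proof (rule Liminf_mono, rule always_eventually, rule allI)
    fix n show "(\<integral>\<^sup>+\<omega>. ennreal ((f n \<omega>)^2) \<partial>M) \<le> ennreal K"
      using int(2)[of n] by (subst nn_integral_eq_integral[OF int(1)]) (auto intro: ennreal_leI)
  qed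
  also have "\<dots> = ennreal K" by (simp add: Liminf_const)
  finally show "(\<integral>\<^sup>+\<omega>. ennreal (norm ((Y \<omega>)^2)) \<partial>M) < \<infinity>"
    by (auto simp: less_top[symmetric] top_unique)
qed simp

end

section \<open>Square integrability of the signature\<close>

locale brownian_signature =
  fixes M :: "'a measure" and d :: nat and T :: real
    and B :: "nat \<Rightarrow> real \<Rightarrow> 'a \<Rightarrow> real" and S :: "nat list \<Rightarrow> real \<Rightarrow> 'a \<Rightarrow> real"
  assumes T_pos: "0 < T" and brownian: "standard_brownian_motion M d T B"
    and signature: "is_stratonovich_signature M d T B S"
begin

sublocale prob_space M
  using brownian by (simp add: standard_brownian_motion_def)

lemma B_measurable [measurable]: "i \<in> {1..d} \<Longrightarrow> t \<in> {0..T} \<Longrightarrow> B i t \<in> borel_measurable M"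
  using brownian by (simp add: standard_brownian_motion_def)

lemma S_measurable [measurable]: "w \<in> words d \<Longrightarrow> t \<in> {0..T} \<Longrightarrow> S w t \<in> borel_measurable M"
  using signature by (simp add: is_stratonovich_signature_def)

section \<open>Brownian increments over nested dyadic grids\<close>

lemma B_increment_normal:
  assumes "i \<in> {1..d}" "0 \<le> s" "s < t" "t \<le> T"
  shows "distributed M lborel (\<lambda>\<omega>. B i t \<omega> - B i s \<omega>) (normal_density 0 (sqrt (t - s)))"
  using brownian assms by (simp add: standard_brownian_motion_def)

definition dinc :: "nat \<Rightarrow> nat \<times> nat \<Rightarrow> 'a \<Rightarrow> real" where
  "dinc N j \<omega> = B (fst j) (T * real (Suc (snd j)) / 2 ^ N) \<omega> - B (fst j) (T * real (snd j) / 2 ^ N) \<omega>"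

definition didx :: "nat \<Rightarrow> (nat \<times> nat) set" where
  "didx N = {1..d} \<times> {..<2 ^ N}"

lemma finite_didx [simp]: "finite (didx N)" by (simp add: didx_def)

lemma dyadic_in: "k \<le> 2 ^ N \<Longrightarrow> T * real k / 2 ^ N \<in> {0..T}"
  using T_pos of_nat_mono[of k "2 ^ N", where 'a=real] by (auto simp: field_simps)

lemma dinc_measurable [measurable]: "j \<in> didx N \<Longrightarrow> dinc N j \<in> borel_measurable M"
  unfolding dinc_def by (intro borel_measurable_diff B_measurable dyadic_in) (auto simp: didx_def)

lemma dinc_indep: "indep_vars (\<lambda>_. borel) (dinc N) (didx N)"
proof -
  have "is_partition T (2 ^ N) (\<lambda>k. T * real k / 2 ^ N)"
    using T_pos by (auto simp: is_partition_def divide_strict_right_mono)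
  with brownian have "indep_vars (\<lambda>_. borel)
      (\<lambda>(i, k) \<omega>. B i (T * real (Suc k) / 2 ^ N) \<omega> - B i (T * real k / 2 ^ N) \<omega>) ({1..d} \<times> {..<2 ^ N})"
    unfolding standard_brownian_motion_def by blast
  moreover have "(\<lambda>(i, k) \<omega>. B i (T * real (Suc k) / 2 ^ N) \<omega> - B i (T * real k / 2 ^ N) \<omega>) = dinc N"
    by (auto simp: dinc_def fun_eq_iff)
  ultimately show ?thesis by (simp add: didx_def)
qed

lemma dinc_normal:
  assumes "j \<in> didx N"
  shows "distributed M lborel (dinc N j) (normal_density 0 (sqrt (T / 2 ^ N)))"
proof -
  have "distributed M lborel (\<lambda>\<omega>. B (fst j) (T * real (Suc (snd j)) / 2 ^ N) \<omega> - B (fst j) (T * real (snd j) / 2 ^ N) \<omega>)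
      (normal_density 0 (sqrt (T * real (Suc (snd j)) / 2 ^ N - T * real (snd j) / 2 ^ N)))"
    using assms dyadic_in[of "Suc (snd j)" N] T_pos
    by (intro B_increment_normal) (auto simp: didx_def divide_strict_right_mono)
  moreover have "T * real (Suc (snd j)) / 2 ^ N - T * real (snd j) / 2 ^ N = T / 2 ^ N"
    by (simp add: field_simps)
  ultimately show ?thesis by (simp add: dinc_def[abs_def])
qed

lemma dinc_moments:
  assumes "j \<in> didx N"
  shows "integrable M (\<lambda>\<omega>. (dinc N j \<omega>)^k)" "expectation (\<lambda>\<omega>. (dinc N j \<omega>)^2) = T / 2 ^ N"
    "expectation (\<lambda>\<omega>. (dinc N j \<omega>)^4) = 3 * (T / 2 ^ N)\<^sup>2" "odd k \<Longrightarrow> expectation (\<lambda>\<omega>. (dinc N j \<omega>)^k) = 0"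
  using normal_moments[OF dinc_normal[OF assms]] T_pos by simp_all

abbreviation mlin :: "nat \<Rightarrow> nat \<Rightarrow> ('a \<Rightarrow> real) \<Rightarrow> bool" where
  "mlin N m \<equiv> multilin (dinc N) m (didx N)"

lemma mlin_measurable: "mlin N m f \<Longrightarrow> f \<in> borel_measurable M"
  by (erule multilin_measurable) (rule dinc_measurable)

lemma mlin_hypercontractive:
  assumes "mlin N m f"
  shows "integrable M (\<lambda>\<omega>. (f \<omega>)^4)" "expectation (\<lambda>\<omega>. (f \<omega>)^4) \<le> 9^m * (expectation (\<lambda>\<omega>. (f \<omega>)^2))\<^sup>2"
proof -
  have "integrable M (\<lambda>\<omega>. (f \<omega>)^4) \<and> expectation (\<lambda>\<omega>. (f \<omega>)^4) \<le> 9^m * (expectation (\<lambda>\<omega>. (f \<omega>)^2))\<^sup>2"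
    by (rule multilin_hypercontractive[OF _ dinc_indep _ _ _ _ assms])
      (use dinc_moments(4)[where k=1] dinc_moments(4)[where k=3] dinc_moments(1,2,3) in simp_all)
  then show "integrable M (\<lambda>\<omega>. (f \<omega>)^4)" "expectation (\<lambda>\<omega>. (f \<omega>)^4) \<le> 9^m * (expectation (\<lambda>\<omega>. (f \<omega>)^2))\<^sup>2"
    by auto
qed

text \<open>The descendants of a dyadic interval \<open>r\<close> levels further down, for the same
  coordinate.\<close>

definition dblock :: "nat \<Rightarrow> nat \<times> nat \<Rightarrow> (nat \<times> nat) set" where
  "dblock r j = {fst j} \<times> {snd j * 2 ^ r..<Suc (snd j) * 2 ^ r}"

lemma finite_dblock [simp]: "finite (dblock r j)" by (simp add: dblock_def)

lemma dblock_subset: "j \<in> didx N \<Longrightarrow> dblock r j \<subseteq> didx (N + r)"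
proof -
  assume "j \<in> didx N"
  then have j: "fst j \<in> {1..d}" "Suc (snd j) \<le> 2 ^ N" by (auto simp: didx_def)
  have "Suc (snd j) * 2 ^ r \<le> 2 ^ (N + r)"
    using mult_right_mono[OF j(2), of "2 ^ r"] by (simp only: power_add)
  then show ?thesis using j by (auto simp: dblock_def didx_def)
qed

text \<open>Division by \<open>2 ^ r\<close> recovers the ancestor of an index.\<close>

lemma dblock_disjoint: "j \<noteq> j' \<Longrightarrow> dblock r j \<inter> dblock r j' = {}"
proof (rule ccontr)
  assume "j \<noteq> j'" "dblock r j \<inter> dblock r j' \<noteq> {}"
  then obtain l where l: "fst j = fst j'" "snd j * 2 ^ r \<le> l" "l < Suc (snd j) * 2 ^ r"
      "snd j' * 2 ^ r \<le> l" "l < Suc (snd j') * 2 ^ r"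
    by (auto simp: dblock_def)
  have "l div 2 ^ r = snd j" using l(2,3) by (intro div_nat_eqI) (auto simp: mult.commute)
  moreover have "l div 2 ^ r = snd j'" using l(4,5) by (intro div_nat_eqI) (auto simp: mult.commute)
  ultimately show False using l(1) \<open>j \<noteq> j'\<close> by (auto simp: prod_eq_iff)
qed

lemma dinc_refine: "dinc N j \<omega> = (\<Sum>l\<in>dblock r j. dinc (N + r) l \<omega>)"
proof -
  define f where "f l = B (fst j) (T * real l / 2 ^ (N + r)) \<omega>" for l
  have "(\<Sum>l\<in>dblock r j. dinc (N + r) l \<omega>) = (\<Sum>l = snd j * 2 ^ r..<Suc (snd j) * 2 ^ r. f (Suc l) - f l)"
    unfolding dblock_def f_def by (simp add: sum.cartesian_product' dinc_def)
  also have "\<dots> = f (Suc (snd j) * 2 ^ r) - f (snd j * 2 ^ r)"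
    by (rule sum_Suc_diff') simp
  also have "\<dots> = dinc N j \<omega>"
  proof -
    have "T * real (k * 2 ^ r) / 2 ^ (N + r) = T * real k / 2 ^ N" for k
      by (simp add: power_add)
    then show ?thesis unfolding f_def dinc_def by (simp only:)
  qed
  finally show ?thesis by simp
qed

lemma multilin_dinc_refine:
  assumes "multilin (dinc N) m J f" "\<And>j. j \<in> J \<Longrightarrow> dblock r j \<subseteq> J'"
  shows "multilin (dinc (N + r)) m J' f"
  by (rule multilin_refine[where Bl="dblock r", OF assms(1)])
    (use assms(2) dblock_disjoint in \<open>auto simp: disjoint_family_on_def intro: dinc_refine\<close>)

lemma mlin_refine: "mlin N m f \<Longrightarrow> mlin (N + r) m f"
  by (erule multilin_dinc_refine) (rule dblock_subset)

text \<open>The \<open>2 ^ r\<close> centred squares are independent, each of variance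
  \<open>2 v^2\<close> with \<open>v = T / 2 ^ (N + r)\<close>. Variances add up to
  \<open>2 (T / 2 ^ N)^2 / 2 ^ r\<close>, which tends to 0, and L2 distance dominates
  \<open>pdist\<close>.\<close>

lemma dyadic_quadratic_variation:
  assumes j: "j \<in> didx N"
  shows "(\<lambda>r. pdist M (\<lambda>\<omega>. \<Sum>l\<in>dblock r j. (dinc (N + r) l \<omega>)^2) (\<lambda>_. T / 2 ^ N)) \<longlonglongrightarrow> 0"
proof (rule tendsto_sandwich[OF _ _ tendsto_const])
  let ?X = "\<lambda>r \<omega>. \<Sum>l\<in>dblock r j. (dinc (N + r) l \<omega>)^2"
  show "\<forall>\<^sub>F r in sequentially. pdist M (?X r) (\<lambda>_. T / 2 ^ N) \<le> sqrt (2 * (T / 2 ^ N)\<^sup>2 * (1 / 2) ^ r)"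
  proof (rule always_eventually, rule allI)
    fix r
    let ?v = "T / 2 ^ (N + r)"
    note sub = dblock_subset[OF j, of r]
    have card: "card (dblock r j) = 2 ^ r" by (simp add: dblock_def)
    let ?Y = "\<lambda>l \<omega>. (dinc (N + r) l \<omega>)^2 - ?v"
    have sq: "(?Y l \<omega>)^2 = (dinc (N + r) l \<omega>)^4 - 2 * ?v * (dinc (N + r) l \<omega>)^2 + ?v\<^sup>2" for l \<omega>
      by (simp add: power2_diff power_mult[symmetric] mult.commute mult.left_commute)
    have Y2: "integrable M (\<lambda>\<omega>. (?Y l \<omega>)^2)" "expectation (\<lambda>\<omega>. (?Y l \<omega>)^2) = 2 * ?v\<^sup>2"
      "expectation (?Y l) = 0" if "l \<in> dblock r j" for l
    proof -
      have l: "l \<in> didx (N + r)" using sub that by auto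
      note m = dinc_moments[OF l]
      show "integrable M (\<lambda>\<omega>. (?Y l \<omega>)^2)" unfolding sq using m(1) by simp
      show "expectation (\<lambda>\<omega>. (?Y l \<omega>)^2) = 2 * ?v\<^sup>2"
      proof -
        have "expectation (\<lambda>\<omega>. (?Y l \<omega>)^2) = 3 * ?v\<^sup>2 - 2 * ?v * ?v + ?v\<^sup>2"
          unfolding sq using m(1,2,3) by (simp add: prob_space)
        then show ?thesis by (simp add: power2_eq_square)
      qed
      show "expectation (?Y l) = 0" using m(1,2) by (simp add: prob_space)
    qed
    have "indep_vars (\<lambda>_. borel) ?Y (dblock r j)"
      by (rule indep_vars_compose2[OF indep_vars_subset[OF dinc_indep sub]]) auto
    from indep_sum_square[OF _ this] Y2
    have i: "integrable M (\<lambda>\<omega>. (\<Sum>l\<in>dblock r j. ?Y l \<omega>)^2)"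
      and E: "expectation (\<lambda>\<omega>. (\<Sum>l\<in>dblock r j. ?Y l \<omega>)^2) = (\<Sum>l\<in>dblock r j. 2 * ?v\<^sup>2)"
      by simp_all
    have e: "(\<Sum>l\<in>dblock r j. ?Y l \<omega>) = ?X r \<omega> - T / 2 ^ N" for \<omega>
      by (simp add: sum_subtractf card power_add)
    have "?X r \<in> borel_measurable M"
      using sub by (intro borel_measurable_sum borel_measurable_power dinc_measurable) auto
    then have "pdist M (?X r) (\<lambda>_. T / 2 ^ N) \<le> sqrt (expectation (\<lambda>\<omega>. (?X r \<omega> - T / 2 ^ N)^2))"
      using i unfolding e by (intro pdist_le_L2) auto
    also have "expectation (\<lambda>\<omega>. (?X r \<omega> - T / 2 ^ N)^2) = 2 * (T / 2 ^ N)\<^sup>2 * (1 / 2) ^ r"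
      using E unfolding e by (simp add: card power_add power2_eq_square field_simps)
    finally show "pdist M (?X r) (\<lambda>_. T / 2 ^ N) \<le> sqrt (2 * (T / 2 ^ N)\<^sup>2 * (1 / 2) ^ r)" .
  qed
  have "(\<lambda>r. sqrt (2 * (T / 2 ^ N)\<^sup>2 * (1 / 2) ^ r)) \<longlonglongrightarrow> sqrt (2 * (T / 2 ^ N)\<^sup>2 * 0)"
    by (intro tendsto_intros LIMSEQ_power_zero) auto
  then show "(\<lambda>r. sqrt (2 * (T / 2 ^ N)\<^sup>2 * (1 / 2) ^ r)) \<longlonglongrightarrow> 0" by simp
qed (auto simp: pdist_nonneg)

text \<open>The closure in probability of the multilinear polynomials of degree at most
  \<open>m\<close>, over all dyadic levels. It serves as the sum of the Wiener chaoses of order at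
  most \<open>m\<close>, without multiple stochastic integrals.\<close>

definition wchaos :: "nat \<Rightarrow> ('a \<Rightarrow> real) \<Rightarrow> bool" where
  "wchaos m Y \<longleftrightarrow> Y \<in> borel_measurable M \<and> (\<forall>\<epsilon>>0. \<exists>N f. mlin N m f \<and> pdist M f Y < \<epsilon>)"

lemma wchaos_mlin: "mlin N m f \<Longrightarrow> wchaos m f"
  unfolding wchaos_def using mlin_measurable
  by (intro conjI allI impI exI[where x=N] exI[where x=f]) (auto simp: pdist_def)

lemma wchaos_measurable: "wchaos m Y \<Longrightarrow> Y \<in> borel_measurable M"
  by (simp add: wchaos_def)

text \<open>Refinement allows the approximants to be taken at any level beyond \<open>K\<close>, so
  that they can be multiplied by an increment of level \<open>K\<close>.\<close>

lemma wchaosE: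
  assumes "wchaos m Y"
  obtains N f where "\<forall>n::nat. mlin (N n) m (f n)" "(\<lambda>n. pdist M (f n) Y) \<longlonglongrightarrow> 0" "\<forall>n. K \<le> N n"
proof -
  have "\<exists>N f. mlin N m f \<and> pdist M f Y < 1 / real (Suc n) \<and> K \<le> N" for n
  proof -
    obtain N f where "mlin N m f" "pdist M f Y < 1 / real (Suc n)"
      using assms unfolding wchaos_def by (meson of_nat_0_less_iff zero_less_Suc zero_less_divide_1_iff)
    then show ?thesis using mlin_refine[of N m f K] by (intro exI[where x="N + K"]) auto
  qed
  then obtain N f where *: "\<And>n. mlin (N n) m (f n) \<and> pdist M (f n) Y < 1 / real (Suc n) \<and> K \<le> N n"
    by metis
  have "(\<lambda>n. pdist M (f n) Y) \<longlonglongrightarrow> 0"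
  proof (rule tendsto_sandwich[OF _ _ tendsto_const])
    show "\<forall>\<^sub>F n in sequentially. pdist M (f n) Y \<le> 1 / real (Suc n)"
      using * by (intro always_eventually allI) (auto intro: less_imp_le)
    show "(\<lambda>n. 1 / real (Suc n)) \<longlonglongrightarrow> 0" by (rule LIMSEQ_Suc[OF lim_1_over_n])
  qed (auto simp: pdist_nonneg)
  with * that[of N f] show thesis by simp
qed

lemma wchaos_closed:
  assumes "Y \<in> borel_measurable M" "\<And>\<epsilon>. 0 < \<epsilon> \<Longrightarrow> \<exists>Z. wchaos m Z \<and> pdist M Z Y < \<epsilon>"
  shows "wchaos m Y"
  unfolding wchaos_def
proof (intro conjI allI impI)
  fix \<epsilon> :: real assume "0 < \<epsilon>"
  then obtain Z where Z: "wchaos m Z" "pdist M Z Y < \<epsilon> / 2" using assms(2)[of "\<epsilon> / 2"] by auto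
  then obtain N f where f: "mlin N m f" "pdist M f Z < \<epsilon> / 2"
    using \<open>0 < \<epsilon>\<close> unfolding wchaos_def by (meson half_gt_zero)
  have "pdist M f Y \<le> pdist M f Z + pdist M Z Y"
    using assms(1) f Z by (intro pdist_triangle) (auto simp: wchaos_def mlin_measurable)
  then show "\<exists>N f. mlin N m f \<and> pdist M f Y < \<epsilon>" using f Z by (intro exI[where x=N] exI[where x=f]) auto
qed (fact assms)

lemma wchaos_limit:
  assumes "\<And>n. wchaos m (X n)" "Y \<in> borel_measurable M" "(\<lambda>n. pdist M (X n) Y) \<longlonglongrightarrow> 0"
  shows "wchaos m Y"
proof (rule wchaos_closed[OF assms(2)])
  fix \<epsilon> :: real assume "0 < \<epsilon>"
  then have "\<forall>\<^sub>F n in sequentially. pdist M (X n) Y < \<epsilon>" using order_tendstoD(2)[OF assms(3)] by auto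
  then show "\<exists>Z. wchaos m Z \<and> pdist M Z Y < \<epsilon>"
    using assms(1) eventually_happens'[OF sequentially_bot] by blast
qed

lemma wchaos_mono: "wchaos m Y \<Longrightarrow> m \<le> m' \<Longrightarrow> wchaos m' Y"
  unfolding wchaos_def by (meson multilin_mono order_refl)

lemma wchaos_const: "wchaos m (\<lambda>_. c)"
  by (rule wchaos_mlin) (rule multilin.const)

lemma wchaos_add:
  assumes "wchaos m X" "wchaos m Y"
  shows "wchaos m (\<lambda>\<omega>. X \<omega> + Y \<omega>)"
  unfolding wchaos_def
proof (intro conjI allI impI)
  fix \<epsilon> :: real assume "0 < \<epsilon>"
  then obtain N f N' h where f: "mlin N m f" "pdist M f X < \<epsilon> / 2" and h: "mlin N' m h" "pdist M h Y < \<epsilon> / 2"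
    using assms unfolding wchaos_def by (meson half_gt_zero)
  have "mlin (N + N') m (\<lambda>\<omega>. f \<omega> + h \<omega>)"
    using mlin_refine[OF f(1), of N'] mlin_refine[OF h(1), of N] by (intro multilin_add) (auto simp: add.commute)
  moreover have "pdist M (\<lambda>\<omega>. f \<omega> + h \<omega>) (\<lambda>\<omega>. X \<omega> + Y \<omega>) \<le> pdist M f X + pdist M h Y"
    using assms f h by (intro pdist_add) (auto simp: wchaos_def mlin_measurable)
  ultimately show "\<exists>N f. mlin N m f \<and> pdist M f (\<lambda>\<omega>. X \<omega> + Y \<omega>) < \<epsilon>"
    using f h by (intro exI[where x="N + N'"] exI[where x="\<lambda>\<omega>. f \<omega> + h \<omega>"]) auto
qed (use assms in \<open>auto simp: wchaos_def\<close>)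

lemma wchaos_cmult:
  assumes "wchaos m Y"
  shows "wchaos m (\<lambda>\<omega>. c * Y \<omega>)"
proof -
  obtain N f where f: "\<forall>n::nat. mlin (N n) m (f n)" "(\<lambda>n. pdist M (f n) Y) \<longlonglongrightarrow> 0" "\<forall>n. 0 \<le> N n"
    by (rule wchaosE[OF assms, where K=0])
  show ?thesis
  proof (rule wchaos_closed)
    fix \<epsilon> :: real assume "0 < \<epsilon>"
    then obtain n where "pdist M (\<lambda>\<omega>. f n \<omega> * c) (\<lambda>\<omega>. Y \<omega> * c) < \<epsilon>"
      using pdist_mult_tendsto[OF mlin_measurable[OF f(1)[rule_format]] wchaos_measurable[OF assms] _ f(2), where Z="\<lambda>_. c"]
      by auto
    then show "\<exists>Z. wchaos m Z \<and> pdist M Z (\<lambda>\<omega>. c * Y \<omega>) < \<epsilon>"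
      using wchaos_mlin[OF multilin_cmult[OF f(1)[rule_format, of n], where c=c]]
      by (intro exI[where x="\<lambda>\<omega>. c * f n \<omega>"]) (auto simp: mult.commute)
  qed (use wchaos_measurable[OF assms] in simp)
qed

lemma wchaos_sum: "(\<And>x. x \<in> A \<Longrightarrow> wchaos m (f x)) \<Longrightarrow> wchaos m (\<lambda>\<omega>. \<Sum>x\<in>A. f x \<omega>)"
  by (induction A rule: infinite_finite_induct) (auto intro: wchaos_const wchaos_add)

text \<open>Only the part of \<open>f\<close> linear in the variable \<open>j\<close> is a problem,
  since it produces the square of an increment. On refinement the square splits into off-diagonal
  products, which are multilinear, and a sum of squares, which converges to the constant
  \<open>T / 2 ^ N\<close>.\<close>

lemma wchaos_mlin_mult_dinc:
  assumes f: "mlin N m f" and j: "j \<in> didx N"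
  shows "wchaos (Suc m) (\<lambda>\<omega>. f \<omega> * dinc N j \<omega>)"
proof -
  obtain Q R where QR: "f = (\<lambda>\<omega>. Q \<omega> + dinc N j \<omega> * R \<omega>)" "multilin (dinc N) m (didx N - {j}) Q"
    "multilin (dinc N) (m - 1) (didx N - {j}) R" "m = 0 \<longrightarrow> R = (\<lambda>_. 0)"
    by (rule multilin_decompose[OF f j])
  have 1: "wchaos (Suc m) (\<lambda>\<omega>. dinc N j \<omega> * Q \<omega>)"
    by (rule wchaos_mlin, rule multilin_mult_var[OF QR(2) j])
  have Rm: "R \<in> borel_measurable M"
    using QR(3) by (rule multilin_measurable) (auto intro: dinc_measurable)
  have 2: "wchaos (Suc m) (\<lambda>\<omega>. R \<omega> * (dinc N j \<omega>)^2)"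
  proof (cases m)
    case 0
    then show ?thesis using QR(4) wchaos_const by simp
  next
    case (Suc m')
    show ?thesis
    proof (rule wchaos_closed)
      fix \<epsilon> :: real assume "0 < \<epsilon>"
      let ?X = "\<lambda>r \<omega>. \<Sum>l\<in>dblock r j. (dinc (N + r) l \<omega>)^2"
      have "?X r \<in> borel_measurable M" for r
        using dblock_subset[OF j, of r] by (intro borel_measurable_sum borel_measurable_power dinc_measurable) auto
      then obtain r where r: "pdist M (\<lambda>\<omega>. ?X r \<omega> * R \<omega>) (\<lambda>\<omega>. T / 2 ^ N * R \<omega>) < \<epsilon>"
        using pdist_mult_tendsto[OF _ _ Rm dyadic_quadratic_variation[OF j] \<open>0 < \<epsilon>\<close>] by auto
      let ?b = "dblock r j"
      let ?g = "\<lambda>l \<omega>. dinc (N + r) l \<omega>"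
      \<comment> \<open>The off-diagonal part together with the limit of the diagonal part. As
        \<open>R\<close> has degree at most \<open>m - 1\<close> and avoids the whole block, both
        pieces are multilinear of degree at most \<open>m + 1\<close>.\<close>
      define F where "F \<omega> = T / 2 ^ N * R \<omega> + (\<Sum>l\<in>?b. \<Sum>l'\<in>?b - {l}. ?g l \<omega> * (?g l' \<omega> * R \<omega>))" for \<omega>
      have R': "multilin (dinc (N + r)) m' (didx (N + r) - ?b) R"
      proof (rule multilin_dinc_refine)
        show "multilin (dinc N) m' (didx N - {j}) R" using QR(3) Suc by simp
        show "dblock r i \<subseteq> didx (N + r) - ?b" if "i \<in> didx N - {j}" for i
          using that dblock_subset[of i N r] dblock_disjoint[of i j r] by auto
      qed
      have "mlin (N + r) (Suc m) (\<lambda>\<omega>. ?g l \<omega> * (?g l' \<omega> * R \<omega>))" if l: "l \<in> ?b" "l' \<in> ?b - {l}" for l l'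
        unfolding Suc using l dblock_subset[OF j, of r]
        by (intro multilin_mult_var multilin_mono[OF R']) auto
      moreover have "mlin (N + r) (Suc m) (\<lambda>\<omega>. T / 2 ^ N * R \<omega>)"
        by (intro multilin_cmult multilin_mono[OF R']) (auto simp: Suc)
      ultimately have "mlin (N + r) (Suc m) F"
        unfolding F_def by (intro multilin_add multilin_sum)
      then have "wchaos (Suc m) F" by (rule wchaos_mlin)
      moreover have "F \<omega> - R \<omega> * (dinc N j \<omega>)^2 = T / 2 ^ N * R \<omega> - ?X r \<omega> * R \<omega>" for \<omega>
      proof -
        have "(dinc N j \<omega>)^2 = (\<Sum>l\<in>?b. ?g l \<omega> * (\<Sum>l'\<in>?b. ?g l' \<omega>))"
          unfolding dinc_refine[of N j \<omega> r] by (simp add: power2_eq_square sum_distrib_right)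
        also have "\<dots> = (\<Sum>l\<in>?b. (?g l \<omega>)^2 + ?g l \<omega> * (\<Sum>l'\<in>?b - {l}. ?g l' \<omega>))"
          by (intro sum.cong refl, subst sum.remove[where A="?b"]) (auto simp: power2_eq_square algebra_simps)
        also have "\<dots> = ?X r \<omega> + (\<Sum>l\<in>?b. ?g l \<omega> * (\<Sum>l'\<in>?b - {l}. ?g l' \<omega>))"
          by (rule sum.distrib)
        finally show ?thesis unfolding F_def
          by (simp add: algebra_simps sum_distrib_left sum_distrib_right)
      qed
      then have "pdist M F (\<lambda>\<omega>. R \<omega> * (dinc N j \<omega>)^2) < \<epsilon>"
        using r unfolding pdist_commute[of "\<lambda>\<omega>. ?X r \<omega> * R \<omega>"] by (simp add: pdist_def)
      ultimately show "\<exists>Z. wchaos (Suc m) Z \<and> pdist M Z (\<lambda>\<omega>. R \<omega> * (dinc N j \<omega>)^2) < \<epsilon>" by blast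
    qed (use Rm dinc_measurable[OF j] in simp)
  qed
  have "f \<omega> * dinc N j \<omega> = dinc N j \<omega> * Q \<omega> + R \<omega> * (dinc N j \<omega>)^2" for \<omega>
    using QR(1) by (simp add: algebra_simps power2_eq_square)
  then show ?thesis using wchaos_add[OF 1 2] by simp
qed

text \<open>The approximants of \<open>Y\<close> live on finer grids, where the coarse increment is
  a sum over a block; each summand is covered by the polynomial case.\<close>

lemma wchaos_mult_dinc:
  assumes Y: "wchaos m Y" and j: "j \<in> didx N"
  shows "wchaos (Suc m) (\<lambda>\<omega>. Y \<omega> * dinc N j \<omega>)"
proof (rule wchaos_closed)
  fix \<epsilon> :: real assume "0 < \<epsilon>"
  obtain K f where f: "\<forall>n::nat. mlin (K n) m (f n)" "(\<lambda>n. pdist M (f n) Y) \<longlonglongrightarrow> 0" "\<forall>n. N \<le> K n"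
    by (rule wchaosE[OF Y, where K=N])
  obtain n where n: "pdist M (\<lambda>\<omega>. f n \<omega> * dinc N j \<omega>) (\<lambda>\<omega>. Y \<omega> * dinc N j \<omega>) < \<epsilon>"
    using pdist_mult_tendsto[OF mlin_measurable[OF f(1)[rule_format]] wchaos_measurable[OF Y] dinc_measurable[OF j] f(2) \<open>0 < \<epsilon>\<close>]
    by auto
  obtain r where r: "K n = N + r" using f(3)[rule_format, of n] le_Suc_ex by blast
  have "wchaos (Suc m) (\<lambda>\<omega>. \<Sum>l\<in>dblock r j. f n \<omega> * dinc (N + r) l \<omega>)"
    using dblock_subset[OF j, of r] f(1)[rule_format, of n] unfolding r
    by (intro wchaos_sum wchaos_mlin_mult_dinc) auto
  also have "(\<lambda>\<omega>. \<Sum>l\<in>dblock r j. f n \<omega> * dinc (N + r) l \<omega>) = (\<lambda>\<omega>. f n \<omega> * dinc N j \<omega>)"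
    by (simp add: dinc_refine[of N j _ r] sum_distrib_left)
  finally show "\<exists>Z. wchaos (Suc m) Z \<and> pdist M Z (\<lambda>\<omega>. Y \<omega> * dinc N j \<omega>) < \<epsilon>" using n by blast
qed (use wchaos_measurable[OF Y] dinc_measurable[OF j] in simp)

lemma wchaos_mult_increment:
  assumes Y: "wchaos m Y" and i: "i \<in> {1..d}" and k: "k \<le> k'" "k' \<le> 2 ^ N"
  shows "wchaos (Suc m) (\<lambda>\<omega>. Y \<omega> * (B i (T * real k' / 2 ^ N) \<omega> - B i (T * real k / 2 ^ N) \<omega>))"
proof -
  have "wchaos (Suc m) (\<lambda>\<omega>. \<Sum>l\<in>{k..<k'}. Y \<omega> * dinc N (i, l) \<omega>)"
    using i k by (intro wchaos_sum wchaos_mult_dinc[OF Y]) (auto simp: didx_def)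
  also have "(\<lambda>\<omega>. \<Sum>l\<in>{k..<k'}. Y \<omega> * dinc N (i, l) \<omega>)
      = (\<lambda>\<omega>. Y \<omega> * (B i (T * real k' / 2 ^ N) \<omega> - B i (T * real k / 2 ^ N) \<omega>))"
    using sum_Suc_diff'[OF k(1), of "\<lambda>l. B i (T * real l / 2 ^ N) _"]
    by (simp add: sum_distrib_left[symmetric] dinc_def)
  finally show ?thesis .
qed

text \<open>Convergence in probability supplies one tail bound common to all late approximants; the
  fourth-moment comparison, whose constant depends on the degree only, turns it into a common
  second-moment bound.\<close>

lemma wchaos_square_integrable:
  assumes Y: "wchaos m Y"
  shows "integrable M (\<lambda>\<omega>. (Y \<omega>)^2)"
proof -
  note [measurable] = wchaos_measurable[OF Y]
  obtain N f where f: "\<forall>n::nat. mlin (N n) m (f n)" "(\<lambda>n. pdist M (f n) Y) \<longlonglongrightarrow> 0" "\<forall>n. 0 \<le> N n"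
    by (rule wchaosE[OF Y, where K=0])
  note [measurable] = mlin_measurable[OF f(1)[rule_format]]
  \<comment> \<open>The tail of \<open>Y\<close> and the distance to \<open>Y\<close> contribute
    \<open>c\<close> each, and \<open>c + c\<close> is the threshold \<open>1 / (4 * 9 ^ m)\<close>
    of \<open>second_moment_le_of_tail\<close>.\<close>
  define c where "c = 1 / (8 * 9 ^ m :: real)"
  have c: "0 < c" by (simp add: c_def)
  have "(\<lambda>n. prob {\<omega>\<in>space M. real n < \<bar>Y \<omega>\<bar>}) \<longlonglongrightarrow> prob (\<Inter>n. {\<omega>\<in>space M. real n < \<bar>Y \<omega>\<bar>})"
    by (rule finite_Lim_measure_decseq) (auto simp: decseq_def)
  moreover have "(\<Inter>n. {\<omega>\<in>space M. real n < \<bar>Y \<omega>\<bar>}) = {}"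
  proof (rule equals0I)
    fix \<omega> assume "\<omega> \<in> (\<Inter>n. {\<omega>\<in>space M. real n < \<bar>Y \<omega>\<bar>})"
    then have "real n < \<bar>Y \<omega>\<bar>" for n by auto
    with reals_Archimedean2[of "\<bar>Y \<omega>\<bar>"] show False by (meson less_asym)
  qed
  ultimately have "(\<lambda>n. prob {\<omega>\<in>space M. real n < \<bar>Y \<omega>\<bar>}) \<longlonglongrightarrow> 0" by simp
  then have "\<forall>\<^sub>F n in sequentially. prob {\<omega>\<in>space M. real n < \<bar>Y \<omega>\<bar>} < c"
    using order_tendstoD(2) c by blast
  then obtain k where k: "prob {\<omega>\<in>space M. real k < \<bar>Y \<omega>\<bar>} < c"
    using eventually_happens'[OF sequentially_bot] by blast
  have "\<forall>\<^sub>F n in sequentially. pdist M (f n) Y < c" using order_tendstoD(2)[OF f(2)] c by blast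
  then obtain n0 where n0: "\<And>n. n0 \<le> n \<Longrightarrow> pdist M (f n) Y < c" by (auto simp: eventually_sequentially)
  \<comment> \<open>Dropping the first \<open>n0\<close> terms makes the tail bound valid for every
    index.\<close>
  define h where "h n = f (n + n0)" for n
  have hm: "mlin (N (n + n0)) m (h n)" for n using f(1) by (simp add: h_def)
  note [measurable] = mlin_measurable[OF hm]
  have h0: "(\<lambda>n. pdist M (h n) Y) \<longlonglongrightarrow> 0" using LIMSEQ_ignore_initial_segment[OF f(2)] by (simp add: h_def)
  have b: "expectation (\<lambda>\<omega>. (h n \<omega>)^2) \<le> 2 * (real k + 1)\<^sup>2" for n
  proof (rule second_moment_le_of_tail[where C="9^m"])
    have "prob {\<omega>\<in>space M. real k + 1 < \<bar>h n \<omega>\<bar>}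
        \<le> prob ({\<omega>\<in>space M. real k < \<bar>Y \<omega>\<bar>} \<union> {\<omega>\<in>space M. 1 \<le> \<bar>h n \<omega> - Y \<omega>\<bar>})"
      by (rule finite_measure_mono) auto
    also have "\<dots> \<le> prob {\<omega>\<in>space M. real k < \<bar>Y \<omega>\<bar>} + prob {\<omega>\<in>space M. 1 \<le> \<bar>h n \<omega> - Y \<omega>\<bar>}"
      by (rule measure_Un_le) auto
    also have "\<dots> \<le> c + c"
    proof (rule add_mono)
      have "prob {\<omega>\<in>space M. 1 \<le> \<bar>h n \<omega> - Y \<omega>\<bar>} \<le> pdist M (h n) Y"
        by (rule measure_ge_1_le_pdist) auto
      also have "\<dots> \<le> c" using n0[of "n + n0"] by (simp add: h_def)
      finally show "prob {\<omega>\<in>space M. 1 \<le> \<bar>h n \<omega> - Y \<omega>\<bar>} \<le> c" .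
    qed (use k in simp)
    finally show "prob {\<omega>\<in>space M. real k + 1 < \<bar>h n \<omega>\<bar>} \<le> 1 / (4 * 9 ^ m)" by (simp add: c_def)
  qed (use mlin_hypercontractive[OF hm] in auto)
  obtain r :: "nat \<Rightarrow> nat" where r: "strict_mono r" "AE \<omega> in M. (\<lambda>n. h (r n) \<omega>) \<longlonglongrightarrow> Y \<omega>"
    by (rule pdist_AE_subseq[OF mlin_measurable[OF hm] wchaos_measurable[OF Y] h0])
  have "integrable M (\<lambda>\<omega>. (h n \<omega>)^2)" for n
    using integrable_power_le_4[OF _ mlin_hypercontractive(1)[OF hm]] by simp
  then show ?thesis using L2_Fatou[of "\<lambda>n. h (r n)" Y] r b by auto
qed

lemma brownian_sigma_B: "i \<in> {1..d} \<Longrightarrow> t \<in> {0..T} \<Longrightarrow> B i t \<in> borel_measurable (brownian_sigma M d T B)"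
  unfolding brownian_sigma_def
  by (rule measurableI) (auto simp: space_measure_of_conv intro!: in_measure_of)

text \<open>A subsequence of the approximants converges almost surely, and \<open>lim\<close> of it
  is measurable for the Brownian sigma-algebra at every point, convergent or not. \<open>Y\<close>
  itself need only agree with it almost surely.\<close>

lemma wchaos_brownian_measurable:
  assumes Y: "wchaos m Y"
  shows "\<exists>g\<in>borel_measurable (brownian_sigma M d T B). AE \<omega> in M. Y \<omega> = g \<omega>"
proof -
  obtain N f where f: "\<forall>n::nat. mlin (N n) m (f n)" "(\<lambda>n. pdist M (f n) Y) \<longlonglongrightarrow> 0" "\<forall>n. 0 \<le> N n"
    by (rule wchaosE[OF Y, where K=0])
  obtain r :: "nat \<Rightarrow> nat" where r: "strict_mono r" "AE \<omega> in M. (\<lambda>n. f (r n) \<omega>) \<longlonglongrightarrow> Y \<omega>"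
    by (rule pdist_AE_subseq[OF mlin_measurable[OF f(1)[rule_format]] wchaos_measurable[OF Y] f(2)])
  have "f n \<in> borel_measurable (brownian_sigma M d T B)" for n
  proof (rule multilin_measurable[OF f(1)[rule_format]])
    fix j assume "j \<in> didx (N n)"
    then show "dinc (N n) j \<in> borel_measurable (brownian_sigma M d T B)"
      unfolding dinc_def by (intro borel_measurable_diff brownian_sigma_B dyadic_in) (auto simp: didx_def)
  qed
  then have "(\<lambda>\<omega>. lim (\<lambda>n. f (r n) \<omega>)) \<in> borel_measurable (brownian_sigma M d T B)" by measurable
  moreover have "AE \<omega> in M. Y \<omega> = lim (\<lambda>n. f (r n) \<omega>)"
    using r(2) by eventually_elim (simp add: limI)
  ultimately show ?thesis by (intro bexI[where x="\<lambda>\<omega>. lim (\<lambda>n. f (r n) \<omega>)"])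
qed

end

section \<open>Riemann sums along uniform partitions\<close>

lemma integral_uniform_partition:
  fixes f :: "real \<Rightarrow> real"
  assumes f: "continuous_on {0..t} f" and t: "0 \<le> t" and m: "m \<le> n"
  shows "(\<Sum>k<m. integral {t * real k / real n..t * real (Suc k) / real n} f) = integral {0..t * real m / real n} f"
  using m
proof (induction m)
  case (Suc m)
  have le: "t * real m / real n \<le> t * real (Suc m) / real n"
    using t by (intro divide_right_mono mult_left_mono) auto
  have "t * real (Suc m) / real n \<le> t * real n / real n"
    using t Suc.prems by (intro divide_right_mono mult_left_mono) auto
  also have "\<dots> \<le> t" using t by (cases "n = 0") auto
  finally have "f integrable_on {0..t * real (Suc m) / real n}"
    by (intro integrable_continuous_interval continuous_on_subset[OF f]) auto
  then have "integral {0..t * real m / real n} f + integral {t * real m / real n..t * real (Suc m) / real n} f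
      = integral {0..t * real (Suc m) / real n} f"
    using le t by (intro Henstock_Kurzweil_Integration.integral_combine) auto
  then show ?case using Suc by simp
qed simp

lemma uniform_partition_mem:
  fixes t :: real
  assumes "0 \<le> t" "k \<le> n"
  shows "t * real k / real n \<in> {0..t}"
proof -
  have "t * real k / real n \<le> t * real n / real n"
    using assms by (intro divide_right_mono mult_left_mono) auto
  also have "\<dots> \<le> t" using assms by (cases "n = 0") auto
  finally show ?thesis using assms by simp
qed

text \<open>The tags are arbitrary so that left and right endpoints are both covered; trapezoidal
  sums are the averages of these two.\<close>

lemma riemann_sum_tendsto:
  fixes f :: "real \<Rightarrow> real"
  assumes f: "continuous_on {0..t} f" and t: "0 \<le> t"
    and \<xi>: "\<And>n k. k < n \<Longrightarrow> \<xi> n k \<in> {t * real k / real n..t * real (Suc k) / real n}"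
  shows "(\<lambda>n. \<Sum>k<n. f (\<xi> n k) * (t / real n)) \<longlonglongrightarrow> integral {0..t} f"
proof (rule LIMSEQ_I)
  fix e :: real assume e: "0 < e"
  \<comment> \<open>Dividing by \<open>t + 1\<close> gives \<open>\<epsilon> * t < e\<close> also
    for \<open>t = 0\<close>.\<close>
  define \<epsilon> where "\<epsilon> = e / (t + 1)"
  have \<epsilon>: "0 < \<epsilon>" "\<epsilon> * t < e" using e t by (auto simp: \<epsilon>_def field_simps)
  have "uniformly_continuous_on {0..t} f" by (rule compact_uniformly_continuous[OF f]) simp
  then obtain \<delta> where \<delta>: "0 < \<delta>" "\<And>x y. x \<in> {0..t} \<Longrightarrow> y \<in> {0..t} \<Longrightarrow> dist y x < \<delta> \<Longrightarrow> dist (f y) (f x) < \<epsilon>"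
    using \<epsilon>(1) unfolding uniformly_continuous_on_def by metis
  obtain N where N: "t / \<delta> < real N" using reals_Archimedean2 by blast
  have "norm ((\<Sum>k<n. f (\<xi> n k) * (t / real n)) - integral {0..t} f) < e" if n: "n \<ge> Suc N" for n
  proof -
    have n0: "0 < real n" using n by simp
    have "t < \<delta> * real N" using N \<delta>(1) by (simp add: field_simps)
    also have "\<dots> \<le> \<delta> * real n" using n \<delta>(1) by (intro mult_left_mono) auto
    finally have h: "t / real n < \<delta>" using n0 by (simp add: field_simps)
    have step: "\<bar>f (\<xi> n k) * (t / real n) - integral {t * real k / real n..t * real (Suc k) / real n} f\<bar> \<le> \<epsilon> * (t / real n)"
      if k: "k < n" for k
    proof -
      let ?a = "t * real k / real n" and ?b = "t * real (Suc k) / real n"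
      have ab: "?b - ?a = t / real n" by (simp add: algebra_simps add_divide_distrib)
      have le: "?a \<le> ?b" using t by (intro divide_right_mono mult_left_mono) auto
      have sub: "{?a..?b} \<subseteq> {0..t}"
        using uniform_partition_mem[OF t, of k n] uniform_partition_mem[OF t, of "Suc k" n] k by auto
      have fc: "continuous_on {?a..?b} f" by (rule continuous_on_subset[OF f sub])
      have "integral {?a..?b} (\<lambda>x. f x - f (\<xi> n k)) = integral {?a..?b} f - f (\<xi> n k) * (?b - ?a)"
        using le integrable_continuous_interval[OF fc]
        by (subst Henstock_Kurzweil_Integration.integral_diff) auto
      moreover have "norm (integral {?a..?b} (\<lambda>x. f x - f (\<xi> n k))) \<le> \<epsilon> * (?b - ?a)"
      proof (rule integral_bound[OF le])
        show "norm (f x - f (\<xi> n k)) \<le> \<epsilon>" if x: "x \<in> {?a..?b}" for x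
        proof -
          have "dist x (\<xi> n k) < \<delta>" using x \<xi>[OF k] h ab by (auto simp: dist_real_def)
          then have "dist (f x) (f (\<xi> n k)) < \<epsilon>" using x \<xi>[OF k] sub by (intro \<delta>(2)) auto
          then show ?thesis by (simp add: dist_real_def)
        qed
      qed (intro continuous_intros fc)
      ultimately show ?thesis unfolding ab by (simp add: abs_minus_commute)
    qed
    have "(\<Sum>k<n. integral {t * real k / real n..t * real (Suc k) / real n} f) = integral {0..t} f"
      using integral_uniform_partition[OF f t order_refl, of n] n0 by simp
    then have "\<bar>(\<Sum>k<n. f (\<xi> n k) * (t / real n)) - integral {0..t} f\<bar>
        = \<bar>\<Sum>k<n. f (\<xi> n k) * (t / real n) - integral {t * real k / real n..t * real (Suc k) / real n} f\<bar>"
      by (simp only: sum_subtractf)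
    also have "\<dots> \<le> (\<Sum>k<n. \<epsilon> * (t / real n))"
      by (rule order_trans[OF sum_abs sum_mono]) (use step in auto)
    also have "\<dots> < e" using n0 \<epsilon> by simp
    finally show ?thesis by simp
  qed
  then show "\<exists>N. \<forall>n\<ge>N. norm ((\<Sum>k<n. f (\<xi> n k) * (t / real n)) - integral {0..t} f) < e" by blast
qed

definition tsum :: "(real \<Rightarrow> 'a \<Rightarrow> real) \<Rightarrow> (real \<Rightarrow> 'a \<Rightarrow> real) \<Rightarrow> real \<Rightarrow> nat \<Rightarrow> 'a \<Rightarrow> real" where
  "tsum Y X t n = stratonovich_sum Y X n (\<lambda>k. t * real k / real n)"

lemma words_snoc: "w @ [\<alpha>] \<in> words d \<longleftrightarrow> w \<in> words d \<and> \<alpha> \<le> d"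
  by (auto simp: words_def)

section \<open>Signature entries as limits of trapezoidal sums\<close>

context brownian_signature
begin

text \<open>The time-augmented path. With time as letter 0 the Riemann and the Stratonovich clauses
  of the signature become one statement about trapezoidal sums.\<close>

definition Bt :: "nat \<Rightarrow> real \<Rightarrow> 'a \<Rightarrow> real" where
  "Bt \<alpha> t \<omega> = (if \<alpha> = 0 then t else B \<alpha> t \<omega>)"

lemma Bt_measurable: "\<alpha> \<le> d \<Longrightarrow> t \<in> {0..T} \<Longrightarrow> Bt \<alpha> t \<in> borel_measurable M"
  using B_measurable[of \<alpha> t] by (cases "\<alpha> = 0") (auto simp: Bt_def[abs_def])

lemma partition_mem: "t \<in> {0..T} \<Longrightarrow> k \<le> n \<Longrightarrow> t * real k / real n \<in> {0..T}"
  using uniform_partition_mem[of t k n] by auto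

lemma tsum_measurable:
  assumes "\<And>s. s \<in> {0..T} \<Longrightarrow> Y s \<in> borel_measurable M" "\<alpha> \<le> d" "t \<in> {0..T}"
  shows "tsum Y (Bt \<alpha>) t n \<in> borel_measurable M"
  unfolding tsum_def stratonovich_sum_def using assms
  by (intro borel_measurable_sum borel_measurable_times borel_measurable_divide borel_measurable_add
      borel_measurable_diff Bt_measurable partition_mem assms(1)) auto

lemma tsum_tendsto:
  assumes w: "w \<in> words d" and \<alpha>: "\<alpha> \<le> d" and t: "t \<in> {0..T}"
  shows "(\<lambda>n. pdist M (tsum (S w) (Bt \<alpha>) t n) (S (w @ [\<alpha>]) t)) \<longlonglongrightarrow> 0"
proof -
  have w\<alpha>: "w @ [\<alpha>] \<in> words d" using w \<alpha> by (simp add: words_snoc)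
  have tm: "tsum (S w) (Bt \<alpha>) t n \<in> borel_measurable M" for n
    by (rule tsum_measurable[OF S_measurable[OF w] \<alpha> t])
  note Sm = S_measurable[OF w\<alpha> t]
  show ?thesis
  proof (cases "\<alpha> = 0")
    case True
    have c: "AE \<omega> in M. continuous_on {0..T} (\<lambda>t. S w t \<omega>)"
      and h: "AE \<omega> in M. \<forall>t\<in>{0..T}. ((\<lambda>s. S w s \<omega>) has_integral S (w @ [0]) t \<omega>) {0..t}"
      using signature w unfolding is_stratonovich_signature_def by blast+
    show ?thesis
    proof (rule pdist_tendsto_AE[OF tm Sm])
      from c h show "AE \<omega> in M. (\<lambda>n. tsum (S w) (Bt \<alpha>) t n \<omega>) \<longlonglongrightarrow> S (w @ [\<alpha>]) t \<omega>"
      proof eventually_elim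
        case (elim \<omega>)
        define f where "f s = S w s \<omega>" for s
        have f: "continuous_on {0..t} f" using continuous_on_subset[OF elim(1), of "{0..t}"] t by (simp add: f_def)
        have int: "integral {0..t} f = S (w @ [0]) t \<omega>"
          using elim(2)[rule_format, OF t] by (simp add: f_def[abs_def] integral_unique)
        have le: "t * real k / real n \<le> t * real (Suc k) / real n" for k n
          using t by (intro divide_right_mono mult_left_mono) auto
        have "(\<lambda>n. ((\<Sum>k<n. f (t * real k / real n) * (t / real n)) +
            (\<Sum>k<n. f (t * real (Suc k) / real n) * (t / real n))) / 2)
          \<longlonglongrightarrow> (integral {0..t} f + integral {0..t} f) / 2"
          using t le by (intro tendsto_intros riemann_sum_tendsto f) auto
        moreover have "tsum (S w) (Bt \<alpha>) t n \<omega> = ((\<Sum>k<n. f (t * real k / real n) * (t / real n)) +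
            (\<Sum>k<n. f (t * real (Suc k) / real n) * (t / real n))) / 2" for n
        proof -
          have "t * real (Suc k) / real n - t * real k / real n = t / real n" for k
            by (simp add: algebra_simps add_divide_distrib)
          then show ?thesis
            unfolding tsum_def stratonovich_sum_def Bt_def f_def[symmetric] True
            by (simp add: sum.distrib[symmetric] sum_divide_distrib ring_distribs add_divide_distrib mult.commute del: of_nat_Suc)
        qed
        ultimately have "(\<lambda>n. tsum (S w) (Bt \<alpha>) t n \<omega>) \<longlonglongrightarrow> (integral {0..t} f + integral {0..t} f) / 2"
          by (simp only:)
        then show ?case using int True by simp
      qed
    qed
  next
    case False
    then have "has_stratonovich_integral M (S w) (B \<alpha>) t (S (w @ [\<alpha>]) t)"
      using signature w \<alpha> t unfolding is_stratonovich_signature_def by simp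
    then have strat: "\<exists>\<delta>>0. \<forall>n p. is_partition t n p \<and> mesh_less n p \<delta> \<longrightarrow>
        measure M {\<omega> \<in> space M. \<bar>stratonovich_sum (S w) (B \<alpha>) n p \<omega> - S (w @ [\<alpha>]) t \<omega>\<bar> > \<epsilon>} < \<eta>"
      if "0 < \<epsilon>" "0 < \<eta>" for \<epsilon> \<eta>
      using that unfolding has_stratonovich_integral_def by blast
    have eq: "tsum (S w) (Bt \<alpha>) t n = stratonovich_sum (S w) (B \<alpha>) n (\<lambda>k. t * real k / real n)" for n
      using False by (simp add: tsum_def Bt_def[abs_def] stratonovich_sum_def fun_eq_iff)
    show ?thesis
    proof (rule LIMSEQ_I)
      fix e :: real assume e: "0 < e"
      obtain \<delta> where \<delta>: "0 < \<delta>" "\<And>n p. is_partition t n p \<Longrightarrow> mesh_less n p \<delta> \<Longrightarrow>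
        measure M {\<omega> \<in> space M. \<bar>stratonovich_sum (S w) (B \<alpha>) n p \<omega> - S (w @ [\<alpha>]) t \<omega>\<bar> > e / 2} < e / 2"
        using strat[of "e / 2" "e / 2"] e by auto
      obtain N where N: "t / \<delta> < real N" using reals_Archimedean2 by blast
      have "measure M {\<omega> \<in> space M. \<bar>tsum (S w) (Bt \<alpha>) t n \<omega> - S (w @ [\<alpha>]) t \<omega>\<bar> > e / 2} < e / 2" if n: "n \<ge> Suc N" for n
      \<comment> \<open>At \<open>t = 0\<close> the uniform points coincide and do not form a
        subdivision. All increments vanish, so the sum equals that of the subdivision with
        \<open>n = 0\<close>, to which the hypothesis applies.\<close>
      proof (cases "t = 0")
        case True
        have "tsum (S w) (Bt \<alpha>) t n = stratonovich_sum (S w) (B \<alpha>) 0 (\<lambda>_. 0)"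
          unfolding eq by (simp add: True stratonovich_sum_def fun_eq_iff)
        then show ?thesis using \<delta>(2)[of 0 "\<lambda>_. 0"] True by (simp add: is_partition_def mesh_less_def)
      next
        case False
        then have t0: "0 < t" using t by simp
        have n0: "0 < real n" using n by simp
        have "t < \<delta> * real N" using N \<delta>(1) by (simp add: field_simps)
        also have "\<dots> \<le> \<delta> * real n" using n \<delta>(1) by (intro mult_left_mono) auto
        finally have h: "t / real n < \<delta>" using n0 by (simp add: field_simps)
        have "t * real (Suc k) / real n - t * real k / real n = t / real n" for k
          by (simp add: algebra_simps add_divide_distrib)
        then have "mesh_less n (\<lambda>k. t * real k / real n) \<delta>" using h by (simp add: mesh_less_def)
        moreover have "is_partition t n (\<lambda>k. t * real k / real n)"
          using t0 n0 by (auto simp: is_partition_def divide_strict_right_mono)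
        ultimately show ?thesis unfolding eq by (rule \<delta>(2)[rotated])
      qed
      note prob_less = this
      have "pdist M (tsum (S w) (Bt \<alpha>) t n) (S (w @ [\<alpha>]) t) < e" if "n \<ge> Suc N" for n
      proof -
        have "0 \<le> e / 2" using e by simp
        from pdist_le_measure[OF tm Sm this, of n] prob_less[OF that] show ?thesis by linarith
      qed
      then show "\<exists>N. \<forall>n\<ge>N. norm (pdist M (tsum (S w) (Bt \<alpha>) t n) (S (w @ [\<alpha>]) t) - 0) < e"
        by (intro exI[where x="Suc N"]) (auto simp: pdist_nonneg)
    qed
  qed
qed

text \<open>Dyadic times suffice and make the induction close: dividing the interval up to a dyadic
  time into \<open>2 ^ r\<close> equal steps gives dyadic nodes again, where the hypothesis for the
  shorter word holds. A Brownian increment raises the degree by one; a time increment is a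
  constant.\<close>

lemma signature_wchaos:
  assumes "w \<in> words d" "k \<le> 2 ^ N"
  shows "wchaos (length w) (S w (T * real k / 2 ^ N))"
  using assms
proof (induction w arbitrary: k N rule: rev_induct)
  case Nil
  have S1: "\<forall>\<omega>\<in>space M. S [] (T * real k / 2 ^ N) \<omega> = 1"
    using signature dyadic_in[OF Nil(2)] unfolding is_stratonovich_signature_def by blast
  show ?case
  proof (rule wchaos_limit[where X="\<lambda>_ _. 1"])
    have "pdist M (\<lambda>_. 1) (S [] (T * real k / 2 ^ N)) = 0"
      unfolding pdist_def by (subst Bochner_Integration.integral_cong[OF refl, where g="\<lambda>_. 0"]) (use S1 in auto)
    then show "(\<lambda>n. pdist M (\<lambda>_. 1) (S [] (T * real k / 2 ^ N))) \<longlonglongrightarrow> 0" by simp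
  qed (use S_measurable[OF Nil(1) dyadic_in[OF Nil(2)]] wchaos_const in auto)
next
  case (snoc \<alpha> w)
  then have w: "w \<in> words d" and \<alpha>: "\<alpha> \<le> d" by (auto simp: words_snoc)
  let ?t = "T * real k / 2 ^ N"
  let ?m = "length w"
  have t: "?t \<in> {0..T}" by (rule dyadic_in[OF snoc.prems(2)])
  have "wchaos (Suc ?m) (tsum (S w) (Bt \<alpha>) ?t (2 ^ r))" for r
  proof -
    have pt: "?t * real l / real (2 ^ r) = T * real (k * l) / 2 ^ (N + r)" for l
      by (simp add: power_add)
    have kl: "k * l \<le> 2 ^ (N + r)" if "l \<le> 2 ^ r" for l
      using mult_mono[OF snoc.prems(2) that] by (simp add: power_add)
    have summand: "wchaos (Suc ?m) (\<lambda>\<omega>. (S w (?t * real l / real (2 ^ r)) \<omega> + S w (?t * real (Suc l) / real (2 ^ r)) \<omega>) / 2 *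
        (Bt \<alpha> (?t * real (Suc l) / real (2 ^ r)) \<omega> - Bt \<alpha> (?t * real l / real (2 ^ r)) \<omega>))" if l: "l < 2 ^ r" for l
    proof -
      have Y: "wchaos ?m (\<lambda>\<omega>. 1 / 2 * (S w (T * real (k * l) / 2 ^ (N + r)) \<omega> + S w (T * real (k * Suc l) / 2 ^ (N + r)) \<omega>))"
        using l by (intro wchaos_cmult wchaos_add snoc.IH w kl) auto
      show ?thesis
      proof (cases "\<alpha> = 0")
        case True
        show ?thesis unfolding pt
          using wchaos_mono[OF wchaos_cmult[OF Y, of "T * real (k * Suc l) / 2 ^ (N + r) - T * real (k * l) / 2 ^ (N + r)"], of "Suc ?m"]
            True by (simp add: Bt_def mult.commute)
      next
        case False
        then have "\<alpha> \<in> {1..d}" using \<alpha> by auto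
        then show ?thesis unfolding pt
          using wchaos_mult_increment[OF Y, of \<alpha> "k * l" "k * Suc l" "N + r"] kl[of "Suc l"] l False by (simp add: Bt_def)
      qed
    qed
    show ?thesis unfolding tsum_def stratonovich_sum_def[abs_def] using summand by (intro wchaos_sum) auto
  qed
  moreover have "(\<lambda>r. pdist M (tsum (S w) (Bt \<alpha>) ?t (2 ^ r)) (S (w @ [\<alpha>]) ?t)) \<longlonglongrightarrow> 0"
  proof -
    have "strict_mono (\<lambda>r::nat. 2 ^ r :: nat)" by (simp add: strict_mono_def)
    from LIMSEQ_subseq_LIMSEQ[OF tsum_tendsto[OF w \<alpha> t] this] show ?thesis by (simp add: comp_def)
  qed
  ultimately have "wchaos (Suc ?m) (S (w @ [\<alpha>]) ?t)"
    by (rule wchaos_limit[OF _ S_measurable[OF snoc.prems(1) t]])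
  then show ?case by simp
qed

lemma signature_linear_functions_L2:
  "signature_linear_functions d T S \<subseteq> L2_space M (brownian_sigma M d T B)"
proof
  fix f assume "f \<in> signature_linear_functions d T S"
  then obtain W c where f: "f = (\<lambda>\<omega>. \<Sum>w\<in>W. c w * S w T \<omega>)" and W: "finite W" "W \<subseteq> words d"
    unfolding signature_linear_functions_def by blast
  \<comment> \<open>A degree common to all words of the combination, so that closure under sums
    applies.\<close>
  have "wchaos (\<Sum>w\<in>W. length w) (S w T)" if "w \<in> W" for w
  proof (rule wchaos_mono)
    show "wchaos (length w) (S w T)" using signature_wchaos[of w 1 0] W that by auto
    show "length w \<le> (\<Sum>w\<in>W. length w)" using W that by (intro member_le_sum) auto
  qed
  then have "wchaos (\<Sum>w\<in>W. length w) f" unfolding f by (intro wchaos_sum wchaos_cmult)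
  then show "f \<in> L2_space M (brownian_sigma M d T B)"
    unfolding L2_space_def
    using wchaos_square_integrable wchaos_brownian_measurable wchaos_measurable by blast
qed

end

section \<open>The pathwise chain rule\<close>

lemma power_Lipschitz:
  fixes R :: real
  assumes "0 \<le> R"
  shows "\<exists>L\<ge>0. \<forall>x y. \<bar>x\<bar> \<le> R \<longrightarrow> \<bar>y\<bar> \<le> R \<longrightarrow> \<bar>y ^ n - x ^ n\<bar> \<le> L * \<bar>y - x\<bar>"
proof (induction n)
  case (Suc n)
  then obtain L where L: "0 \<le> L" "\<And>x y. \<bar>x\<bar> \<le> R \<Longrightarrow> \<bar>y\<bar> \<le> R \<Longrightarrow> \<bar>y ^ n - x ^ n\<bar> \<le> L * \<bar>y - x\<bar>" by blast
  show ?case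
  proof (intro exI[where x="R * L + R ^ n"] conjI allI impI)
    fix x y :: real assume xy: "\<bar>x\<bar> \<le> R" "\<bar>y\<bar> \<le> R"
    have "y ^ Suc n - x ^ Suc n = y * (y ^ n - x ^ n) + x ^ n * (y - x)" by (simp add: algebra_simps)
    then have "\<bar>y ^ Suc n - x ^ Suc n\<bar> \<le> \<bar>y\<bar> * \<bar>y ^ n - x ^ n\<bar> + \<bar>x\<bar> ^ n * \<bar>y - x\<bar>"
      by (metis abs_mult abs_triangle_ineq power_abs)
    also have "\<dots> \<le> R * (L * \<bar>y - x\<bar>) + R ^ n * \<bar>y - x\<bar>"
      using xy L assms by (intro add_mono mult_mono power_mono) auto
    finally show "\<bar>y ^ Suc n - x ^ Suc n\<bar> \<le> (R * L + R ^ n) * \<bar>y - x\<bar>" by (simp add: algebra_simps)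
  qed (use L assms in auto)
qed (auto intro: exI[where x=0])

text \<open>The trapezoidal rule has an error of third order. Summed over a partition, third powers
  of increments disappear in the limit, which is why Stratonovich sums obey the ordinary chain
  rule.\<close>

lemma power_trapezoid:
  fixes R :: real
  assumes "0 \<le> R"
  shows "\<exists>C\<ge>0. \<forall>x y. \<bar>x\<bar> \<le> R \<longrightarrow> \<bar>y\<bar> \<le> R \<longrightarrow>
    \<bar>y ^ n - x ^ n - real n * (x ^ (n - 1) + y ^ (n - 1)) / 2 * (y - x)\<bar> \<le> C * \<bar>y - x\<bar> ^ 3"
proof (induction n)
  case (Suc n)
  then obtain C where C: "0 \<le> C" "\<And>x y. \<bar>x\<bar> \<le> R \<Longrightarrow> \<bar>y\<bar> \<le> R \<Longrightarrow>
    \<bar>y ^ n - x ^ n - real n * (x ^ (n - 1) + y ^ (n - 1)) / 2 * (y - x)\<bar> \<le> C * \<bar>y - x\<bar> ^ 3" by blast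
  obtain L where L: "0 \<le> L" "\<And>x y. \<bar>x\<bar> \<le> R \<Longrightarrow> \<bar>y\<bar> \<le> R \<Longrightarrow> \<bar>y ^ (n - 1) - x ^ (n - 1)\<bar> \<le> L * \<bar>y - x\<bar>"
    using power_Lipschitz[OF assms, of "n - 1"] by blast
  show ?case
  proof (intro exI[where x="R * C + real n * L"] conjI allI impI)
    fix x y :: real assume xy: "\<bar>x\<bar> \<le> R" "\<bar>y\<bar> \<le> R"
    let ?E = "y ^ n - x ^ n - real n * (x ^ (n - 1) + y ^ (n - 1)) / 2 * (y - x)"
    \<comment> \<open>The product rule with averages, \<open>y * b - x * a = (x + y) / 2 * (b - a) +
      (a + b) / 2 * (y - x)\<close>, carries the error from \<open>n\<close> to
      \<open>Suc n\<close>; the last term corrects for averages of products against products of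
      averages.\<close>
    have e: "y ^ Suc n - x ^ Suc n - real (Suc n) * (x ^ (Suc n - 1) + y ^ (Suc n - 1)) / 2 * (y - x)
        = (x + y) / 2 * ?E - real n * ((y ^ (n - 1) - x ^ (n - 1)) * (y - x) ^ 2) / 4"
      by (cases n) (simp_all add: field_simps power2_eq_square)
    have "\<bar>(x + y) / 2 * ?E\<bar> \<le> R * (C * \<bar>y - x\<bar> ^ 3)"
      unfolding abs_mult by (intro mult_mono C) (use xy assms in auto)
    moreover have "\<bar>real n * ((y ^ (n - 1) - x ^ (n - 1)) * (y - x) ^ 2) / 4\<bar> \<le> real n * L * \<bar>y - x\<bar> ^ 3"
    proof -
      define b where "b = \<bar>y - x\<bar>"
      have b: "0 \<le> b" "\<bar>(y - x) ^ 2\<bar> = b ^ 2" by (auto simp: b_def)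
      have "\<bar>(y ^ (n - 1) - x ^ (n - 1)) * (y - x) ^ 2\<bar> \<le> (L * b) * b ^ 2"
        unfolding abs_mult[of _ "(y - x) ^ 2"] b(2) using L(2)[OF xy] by (intro mult_right_mono) (auto simp: b_def)
      then have "real n * \<bar>(y ^ (n - 1) - x ^ (n - 1)) * (y - x) ^ 2\<bar> \<le> real n * ((L * b) * b ^ 2)"
        by (intro mult_left_mono) auto
      also have "\<dots> = real n * L * b ^ 3" by (simp add: power3_eq_cube power2_eq_square)
      finally have "real n * \<bar>(y ^ (n - 1) - x ^ (n - 1)) * (y - x) ^ 2\<bar> \<le> real n * L * b ^ 3" .
      moreover have "0 \<le> real n * \<bar>(y ^ (n - 1) - x ^ (n - 1)) * (y - x) ^ 2\<bar>" by simp
      moreover have "\<bar>real n * z / 4\<bar> = real n * \<bar>z\<bar> / 4" for z :: real by (simp add: abs_mult)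
      ultimately show ?thesis unfolding b_def by linarith
    qed
    ultimately show "\<bar>y ^ Suc n - x ^ Suc n - real (Suc n) * (x ^ (Suc n - 1) + y ^ (Suc n - 1)) / 2 * (y - x)\<bar>
        \<le> (R * C + real n * L) * \<bar>y - x\<bar> ^ 3"
    proof -
      have r: "(R * C + real n * L) * z = R * (C * z) + real n * L * z" for z by (simp add: algebra_simps)
      assume "\<bar>(x + y) / 2 * ?E\<bar> \<le> R * (C * \<bar>y - x\<bar> ^ 3)"
        "\<bar>real n * ((y ^ (n - 1) - x ^ (n - 1)) * (y - x) ^ 2) / 4\<bar> \<le> real n * L * \<bar>y - x\<bar> ^ 3"
      from add_mono[OF this] show ?thesis
        unfolding e r by (rule order_trans[OF abs_triangle_ineq4])
    qed
  qed (use C L assms in auto)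
qed (auto intro: exI[where x=0])

lemma poly_bound_Lipschitz:
  fixes p :: "real poly"
  assumes "0 \<le> R"
  shows "\<exists>K\<ge>0. \<forall>s\<in>{0..R}. \<forall>u\<in>{0..R}. \<bar>poly p u\<bar> \<le> K \<and> \<bar>poly p u - poly p s\<bar> \<le> K * \<bar>u - s\<bar>"
proof (induction p)
  case (pCons a p)
  then obtain K where K: "0 \<le> K" "\<And>s u. s \<in> {0..R} \<Longrightarrow> u \<in> {0..R} \<Longrightarrow> \<bar>poly p u\<bar> \<le> K \<and> \<bar>poly p u - poly p s\<bar> \<le> K * \<bar>u - s\<bar>"
    by blast
  show ?case
  proof (intro exI[where x="\<bar>a\<bar> + R * K + K"] conjI ballI)
    fix s u assume su: "s \<in> {0..R}" "u \<in> {0..R}"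
    have "\<bar>poly (pCons a p) u\<bar> \<le> \<bar>a\<bar> + \<bar>u\<bar> * \<bar>poly p u\<bar>" by (simp add: abs_mult[symmetric])
    also have "\<dots> \<le> \<bar>a\<bar> + R * K" using su K by (intro add_mono mult_mono) auto
    finally show "\<bar>poly (pCons a p) u\<bar> \<le> \<bar>a\<bar> + R * K + K" using K(1) by simp
    have "poly (pCons a p) u - poly (pCons a p) s = u * (poly p u - poly p s) + (u - s) * poly p s"
      by (simp add: algebra_simps)
    then have "\<bar>poly (pCons a p) u - poly (pCons a p) s\<bar> \<le> \<bar>u\<bar> * \<bar>poly p u - poly p s\<bar> + \<bar>u - s\<bar> * \<bar>poly p s\<bar>"
      by (metis abs_mult abs_triangle_ineq)
    also have "\<dots> \<le> R * (K * \<bar>u - s\<bar>) + \<bar>u - s\<bar> * K"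
      using su K by (intro add_mono mult_mono) auto
    also have "\<dots> \<le> (\<bar>a\<bar> + R * K + K) * \<bar>u - s\<bar>" by (simp add: algebra_simps)
    finally show "\<bar>poly (pCons a p) u - poly (pCons a p) s\<bar> \<le> (\<bar>a\<bar> + R * K + K) * \<bar>u - s\<bar>" .
  qed (use K assms in auto)
qed (auto intro: exI[where x=0])

text \<open>The two-variable version, for a power of time and a power of the process. Every
  remainder is a product of three differences and hence cubic.\<close>

lemma monomial_trapezoid:
  fixes R :: real
  assumes R: "0 \<le> R"
  shows "\<exists>C\<ge>0. \<forall>s u x y. \<bar>s\<bar> \<le> R \<longrightarrow> \<bar>u\<bar> \<le> R \<longrightarrow> \<bar>x\<bar> \<le> R \<longrightarrow> \<bar>y\<bar> \<le> R \<longrightarrow>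
    \<bar>u ^ k * y ^ n - s ^ k * x ^ n - (real k * s ^ (k - 1) * x ^ n + real k * u ^ (k - 1) * y ^ n) / 2 * (u - s)
      - real n * (s ^ k * x ^ (n - 1) + u ^ k * y ^ (n - 1)) / 2 * (y - x)\<bar> \<le> C * (\<bar>u - s\<bar> + \<bar>y - x\<bar>) ^ 3"
proof -
  obtain c1 where c1: "0 \<le> c1" "\<And>x y. \<bar>x\<bar> \<le> R \<Longrightarrow> \<bar>y\<bar> \<le> R \<Longrightarrow>
    \<bar>y ^ n - x ^ n - real n * (x ^ (n - 1) + y ^ (n - 1)) / 2 * (y - x)\<bar> \<le> c1 * \<bar>y - x\<bar> ^ 3"
    using power_trapezoid[OF R, of n] by blast
  obtain c2 where c2: "0 \<le> c2" "\<And>x y. \<bar>x\<bar> \<le> R \<Longrightarrow> \<bar>y\<bar> \<le> R \<Longrightarrow>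
    \<bar>y ^ k - x ^ k - real k * (x ^ (k - 1) + y ^ (k - 1)) / 2 * (y - x)\<bar> \<le> c2 * \<bar>y - x\<bar> ^ 3"
    using power_trapezoid[OF R, of k] by blast
  have "\<exists>L\<ge>0. \<forall>x y. \<bar>x\<bar> \<le> R \<longrightarrow> \<bar>y\<bar> \<le> R \<longrightarrow> \<bar>y ^ n - x ^ n\<bar> \<le> L * \<bar>y - x\<bar> \<and> \<bar>y ^ (n - 1) - x ^ (n - 1)\<bar> \<le> L * \<bar>y - x\<bar>
      \<and> \<bar>y ^ k - x ^ k\<bar> \<le> L * \<bar>y - x\<bar> \<and> \<bar>y ^ (k - 1) - x ^ (k - 1)\<bar> \<le> L * \<bar>y - x\<bar>"
  proof -
    obtain l1 l2 l3 l4 where l: "0 \<le> l1" "0 \<le> l2" "0 \<le> l3" "0 \<le> l4"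
      "\<forall>x y. \<bar>x\<bar> \<le> R \<longrightarrow> \<bar>y\<bar> \<le> R \<longrightarrow> \<bar>y ^ n - x ^ n\<bar> \<le> l1 * \<bar>y - x\<bar>"
      "\<forall>x y. \<bar>x\<bar> \<le> R \<longrightarrow> \<bar>y\<bar> \<le> R \<longrightarrow> \<bar>y ^ (n - 1) - x ^ (n - 1)\<bar> \<le> l2 * \<bar>y - x\<bar>"
      "\<forall>x y. \<bar>x\<bar> \<le> R \<longrightarrow> \<bar>y\<bar> \<le> R \<longrightarrow> \<bar>y ^ k - x ^ k\<bar> \<le> l3 * \<bar>y - x\<bar>"
      "\<forall>x y. \<bar>x\<bar> \<le> R \<longrightarrow> \<bar>y\<bar> \<le> R \<longrightarrow> \<bar>y ^ (k - 1) - x ^ (k - 1)\<bar> \<le> l4 * \<bar>y - x\<bar>"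
      using power_Lipschitz[OF R, of n] power_Lipschitz[OF R, of "n - 1"] power_Lipschitz[OF R, of k]
        power_Lipschitz[OF R, of "k - 1"] by blast
    have m: "l1 * a \<le> (l1 + l2 + l3 + l4) * a" "l2 * a \<le> (l1 + l2 + l3 + l4) * a"
      "l3 * a \<le> (l1 + l2 + l3 + l4) * a" "l4 * a \<le> (l1 + l2 + l3 + l4) * a" if "0 \<le> a" for a
      using l that by (auto intro!: mult_right_mono)
    show ?thesis
    proof (intro exI[where x="l1 + l2 + l3 + l4"] conjI allI impI)
      fix x y :: real assume xy: "\<bar>x\<bar> \<le> R" "\<bar>y\<bar> \<le> R"
      note m = m[OF abs_ge_zero[of "y - x"]]
      show "\<bar>y ^ n - x ^ n\<bar> \<le> (l1 + l2 + l3 + l4) * \<bar>y - x\<bar>"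
        "\<bar>y ^ (n - 1) - x ^ (n - 1)\<bar> \<le> (l1 + l2 + l3 + l4) * \<bar>y - x\<bar>"
        "\<bar>y ^ k - x ^ k\<bar> \<le> (l1 + l2 + l3 + l4) * \<bar>y - x\<bar>"
        "\<bar>y ^ (k - 1) - x ^ (k - 1)\<bar> \<le> (l1 + l2 + l3 + l4) * \<bar>y - x\<bar>"
        using l(5-8)[rule_format, OF xy] m by linarith+
    qed (use l in auto)
  qed
  then obtain L where L0: "0 \<le> L" and L: "\<And>x y. \<bar>x\<bar> \<le> R \<Longrightarrow> \<bar>y\<bar> \<le> R \<Longrightarrow>
      \<bar>y ^ n - x ^ n\<bar> \<le> L * \<bar>y - x\<bar> \<and> \<bar>y ^ (n - 1) - x ^ (n - 1)\<bar> \<le> L * \<bar>y - x\<bar>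
      \<and> \<bar>y ^ k - x ^ k\<bar> \<le> L * \<bar>y - x\<bar> \<and> \<bar>y ^ (k - 1) - x ^ (k - 1)\<bar> \<le> L * \<bar>y - x\<bar>" by blast
  let ?C = "R ^ k * c1 + R ^ n * c2 + real n * L * L + real k * L * L"
  show ?thesis
  proof (intro exI[where x="?C"] conjI allI impI)
    fix s u x y :: real assume b: "\<bar>s\<bar> \<le> R" "\<bar>u\<bar> \<le> R" "\<bar>x\<bar> \<le> R" "\<bar>y\<bar> \<le> R"
    define h where "h = \<bar>u - s\<bar>"
    define \<beta> where "\<beta> = \<bar>y - x\<bar>"
    have nn: "0 \<le> h" "0 \<le> \<beta>" by (auto simp: h_def \<beta>_def)
    let ?EC = "y ^ n - x ^ n - real n * (x ^ (n - 1) + y ^ (n - 1)) / 2 * (y - x)"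
    let ?EA = "u ^ k - s ^ k - real k * (s ^ (k - 1) + u ^ (k - 1)) / 2 * (u - s)"
    \<comment> \<open>The symmetric product rule splits the difference into the two one-variable
      errors. Replacing a product of averages by the average of the products costs a quarter of the
      product of the differences, whence the last two terms.\<close>
    have e: "u ^ k * y ^ n - s ^ k * x ^ n - (real k * s ^ (k - 1) * x ^ n + real k * u ^ (k - 1) * y ^ n) / 2 * (u - s)
      - real n * (s ^ k * x ^ (n - 1) + u ^ k * y ^ (n - 1)) / 2 * (y - x)
      = (s ^ k + u ^ k) / 2 * ?EC + (x ^ n + y ^ n) / 2 * ?EA
        - real n * ((u ^ k - s ^ k) * (y ^ (n - 1) - x ^ (n - 1)) * (y - x)) / 4
        - real k * ((y ^ n - x ^ n) * (u ^ (k - 1) - s ^ (k - 1)) * (u - s)) / 4"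
      by (simp add: field_simps)
    have cube: "\<beta> ^ 3 \<le> (h + \<beta>) ^ 3" "h ^ 3 \<le> (h + \<beta>) ^ 3" "h * \<beta> * \<beta> \<le> (h + \<beta>) ^ 3" "\<beta> * h * h \<le> (h + \<beta>) ^ 3"
      using nn by (auto intro!: power_mono mult_mono simp: power3_eq_cube)
    have avg: "\<bar>(a + b) / 2\<bar> \<le> c" if "\<bar>a\<bar> \<le> c" "\<bar>b\<bar> \<le> c" for a b c :: real using that by auto
    have pw: "\<bar>z ^ m\<bar> \<le> R ^ m" if "\<bar>z\<bar> \<le> R" for z m using that by (simp add: power_abs power_mono)
    have 1: "\<bar>(s ^ k + u ^ k) / 2 * ?EC\<bar> \<le> R ^ k * (c1 * (h + \<beta>) ^ 3)"
      unfolding abs_mult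
    proof (intro mult_mono avg pw b)
      show "\<bar>?EC\<bar> \<le> c1 * (h + \<beta>) ^ 3"
        by (rule order_trans[OF c1(2)[OF b(3,4)]]) (use cube(1) c1(1) in \<open>auto simp: \<beta>_def[symmetric] intro: mult_left_mono\<close>)
    qed (use R in auto)
    have 2: "\<bar>(x ^ n + y ^ n) / 2 * ?EA\<bar> \<le> R ^ n * (c2 * (h + \<beta>) ^ 3)"
      unfolding abs_mult
    proof (intro mult_mono avg pw b)
      show "\<bar>?EA\<bar> \<le> c2 * (h + \<beta>) ^ 3"
        by (rule order_trans[OF c2(2)[OF b(1,2)]]) (use cube(2) c2(1) in \<open>auto simp: h_def[symmetric] intro: mult_left_mono\<close>)
    qed (use R in auto)
    have triple: "real m * \<bar>p * q * r\<bar> / 4 \<le> real m * L * L * z" if "\<bar>p\<bar> \<le> L * a" "\<bar>q\<bar> \<le> L * b" "\<bar>r\<bar> = b" "a * b * b \<le> z" "0 \<le> a" "0 \<le> b"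
      for p q r a b z and m :: nat
    proof -
      have "\<bar>p * q * r\<bar> \<le> (L * a) * (L * b) * b"
        unfolding abs_mult using that L0 by (intro mult_mono) auto
      also have "\<dots> = L * L * (a * b * b)" by simp
      also have "\<dots> \<le> L * L * z" using that L0 by (intro mult_left_mono) auto
      finally have "real m * \<bar>p * q * r\<bar> \<le> real m * (L * L * z)" by (intro mult_left_mono) auto
      moreover have "0 \<le> real m * \<bar>p * q * r\<bar>" by simp
      ultimately show ?thesis unfolding mult.assoc by linarith
    qed
    have absq: "\<bar>real m * z / 4\<bar> = real m * \<bar>z\<bar> / 4" for z :: real and m :: nat by (simp add: abs_mult)
    have Lu: "\<bar>u ^ k - s ^ k\<bar> \<le> L * h" "\<bar>u ^ (k - 1) - s ^ (k - 1)\<bar> \<le> L * h" "\<bar>u - s\<bar> = h"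
      using L[OF b(1,2)] by (auto simp: h_def)
    have Ly: "\<bar>y ^ n - x ^ n\<bar> \<le> L * \<beta>" "\<bar>y ^ (n - 1) - x ^ (n - 1)\<bar> \<le> L * \<beta>" "\<bar>y - x\<bar> = \<beta>"
      using L[OF b(3,4)] by (auto simp: \<beta>_def)
    have 3: "\<bar>real n * ((u ^ k - s ^ k) * (y ^ (n - 1) - x ^ (n - 1)) * (y - x)) / 4\<bar> \<le> real n * L * L * (h + \<beta>) ^ 3"
      unfolding absq by (rule triple[OF Lu(1) Ly(2,3) cube(3) nn])
    have 4: "\<bar>real k * ((y ^ n - x ^ n) * (u ^ (k - 1) - s ^ (k - 1)) * (u - s)) / 4\<bar> \<le> real k * L * L * (h + \<beta>) ^ 3"
      unfolding absq by (rule triple[OF Ly(1) Lu(2,3) cube(4) nn(2,1)])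
    have Cz: "?C * z = R ^ k * (c1 * z) + R ^ n * (c2 * z) + real n * L * L * z + real k * L * L * z" for z
      by (simp add: algebra_simps)
    have abs4: "\<bar>p + q - r - z\<bar> \<le> \<bar>p\<bar> + \<bar>q\<bar> + \<bar>r\<bar> + \<bar>z\<bar>" for p q r z :: real by linarith
    show "\<bar>u ^ k * y ^ n - s ^ k * x ^ n - (real k * s ^ (k - 1) * x ^ n + real k * u ^ (k - 1) * y ^ n) / 2 * (u - s)
      - real n * (s ^ k * x ^ (n - 1) + u ^ k * y ^ (n - 1)) / 2 * (y - x)\<bar> \<le> ?C * (\<bar>u - s\<bar> + \<bar>y - x\<bar>) ^ 3"
      unfolding e h_def[symmetric] \<beta>_def[symmetric] Cz
      by (rule order_trans[OF abs4]) (intro add_mono 1 2 3 4)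
  qed (use c1 c2 L0 R in auto)
qed

lemma polys_bound_Lipschitz:
  fixes p :: "'i \<Rightarrow> real poly"
  assumes "0 \<le> R" "finite I"
  shows "\<exists>K\<ge>0. \<forall>i\<in>I. \<forall>s\<in>{0..R}. \<forall>u\<in>{0..R}. \<bar>poly (p i) u\<bar> \<le> K \<and> \<bar>poly (p i) u - poly (p i) s\<bar> \<le> K * \<bar>u - s\<bar>"
proof -
  have "\<forall>i. \<exists>K\<ge>0. \<forall>s\<in>{0..R}. \<forall>u\<in>{0..R}. \<bar>poly (p i) u\<bar> \<le> K \<and> \<bar>poly (p i) u - poly (p i) s\<bar> \<le> K * \<bar>u - s\<bar>"
    using poly_bound_Lipschitz[OF assms(1)] by blast
  then obtain K where K: "\<And>i. 0 \<le> K i" "\<And>i s u. s \<in> {0..R} \<Longrightarrow> u \<in> {0..R} \<Longrightarrow>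
      \<bar>poly (p i) u\<bar> \<le> K i \<and> \<bar>poly (p i) u - poly (p i) s\<bar> \<le> K i * \<bar>u - s\<bar>" by metis
  show ?thesis
  proof (intro exI[where x="\<Sum>i\<in>I. K i"] conjI ballI)
    fix i s u assume i: "i \<in> I" and su: "s \<in> {0..R}" "u \<in> {0..R}"
    have le: "K i \<le> (\<Sum>i\<in>I. K i)" using i K(1) assms(2) by (intro member_le_sum) auto
    show "\<bar>poly (p i) u\<bar> \<le> (\<Sum>i\<in>I. K i)" using K(2)[OF su, of i] le by simp
    have "K i * \<bar>u - s\<bar> \<le> (\<Sum>i\<in>I. K i) * \<bar>u - s\<bar>" using le by (intro mult_right_mono) auto
    then show "\<bar>poly (p i) u - poly (p i) s\<bar> \<le> (\<Sum>i\<in>I. K i) * \<bar>u - s\<bar>" using K(2)[OF su, of i] by linarith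
  qed (use K in \<open>auto intro: sum_nonneg\<close>)
qed

text \<open>The pathwise Wiener integral \<open>\<Sum>\<^sub>i \<integral>\<^sub>0\<^sup>t \<phi>\<^sub>i db\<^sub>i\<close> of polynomials, defined through integration by parts.\<close>

definition pathint :: "nat set \<Rightarrow> (nat \<Rightarrow> real poly) \<Rightarrow> (nat \<Rightarrow> real \<Rightarrow> real) \<Rightarrow> real \<Rightarrow> real" where
  "pathint I \<phi> b t = (\<Sum>i\<in>I. poly (\<phi> i) t * b i t - integral {0..t} (\<lambda>r. poly (pderiv (\<phi> i)) r * b i r))"

text \<open>By parts on \<open>[s, u]\<close>, each summand of the difference is the integral of
  \<open>\<phi>' (r) (b u - b r)\<close>, so it is bounded by the oscillation times the
  length.\<close>

lemma pathint_increment: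
  assumes cont: "\<And>i. i \<in> I \<Longrightarrow> continuous_on {0..T} (b i)"
    and K: "\<And>i r. i \<in> I \<Longrightarrow> r \<in> {0..T} \<Longrightarrow> \<bar>poly (pderiv (\<phi> i)) r\<bar> \<le> K"
    and su: "0 \<le> s" "s \<le> u" "u \<le> T" and \<epsilon>: "\<And>i r. i \<in> I \<Longrightarrow> r \<in> {s..u} \<Longrightarrow> \<bar>b i u - b i r\<bar> \<le> \<epsilon>"
  shows "\<bar>pathint I \<phi> b u - pathint I \<phi> b s - (\<Sum>i\<in>I. poly (\<phi> i) s * (b i u - b i s))\<bar> \<le> real (card I) * (K * \<epsilon> * (u - s))"
proof -
  let ?D = "\<lambda>i. poly (\<phi> i) u * b i u - integral {0..u} (\<lambda>r. poly (pderiv (\<phi> i)) r * b i r)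
      - (poly (\<phi> i) s * b i s - integral {0..s} (\<lambda>r. poly (pderiv (\<phi> i)) r * b i r)) - poly (\<phi> i) s * (b i u - b i s)"
  have step: "\<bar>?D i\<bar> \<le> K * \<epsilon> * (u - s)" if i: "i \<in> I" for i
  proof -
    let ?p = "poly (pderiv (\<phi> i))"
    have cp: "continuous_on A ?p" for A by (rule continuous_on_poly[OF continuous_on_id])
    have cb: "continuous_on {s..u} (b i)" by (rule continuous_on_subset[OF cont[OF i]]) (use su in auto)
    have cu: "continuous_on {0..u} (\<lambda>r. ?p r * b i r)"
      by (intro continuous_on_mult cp continuous_on_subset[OF cont[OF i]]) (use su in auto)
    have comb: "integral {0..s} (\<lambda>r. ?p r * b i r) + integral {s..u} (\<lambda>r. ?p r * b i r) = integral {0..u} (\<lambda>r. ?p r * b i r)"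
      using su by (intro Henstock_Kurzweil_Integration.integral_combine integrable_continuous_interval cu) auto
    have "(?p has_integral (poly (\<phi> i) u - poly (\<phi> i) s)) {s..u}"
    proof (rule fundamental_theorem_of_calculus[OF su(2)])
      fix r assume "r \<in> {s..u}"
      have "(poly (\<phi> i) has_vector_derivative ?p r) (at r)"
        using poly_DERIV[of "\<phi> i" r] by (simp only: has_real_derivative_iff_has_vector_derivative)
      then show "(poly (\<phi> i) has_vector_derivative ?p r) (at r within {s..u})"
        by (rule has_vector_derivative_at_within)
    qed
    then have ftc: "integral {s..u} ?p = poly (\<phi> i) u - poly (\<phi> i) s" by (rule integral_unique)
    have "integral {s..u} (\<lambda>r. ?p r * (b i u - b i r)) = integral {s..u} (\<lambda>r. ?p r * b i u - ?p r * b i r)"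
      by (simp add: right_diff_distrib)
    also have "\<dots> = integral {s..u} (\<lambda>r. ?p r * b i u) - integral {s..u} (\<lambda>r. ?p r * b i r)"
      by (intro Henstock_Kurzweil_Integration.integral_diff integrable_continuous_interval
        continuous_on_mult continuous_on_const cp cb)
    also have "\<dots> = (poly (\<phi> i) u - poly (\<phi> i) s) * b i u - integral {s..u} (\<lambda>r. ?p r * b i r)"
      by (simp add: ftc)
    finally have "?D i = integral {s..u} (\<lambda>r. ?p r * (b i u - b i r))"
      using comb unfolding left_diff_distrib right_diff_distrib by linarith
    moreover have "norm (integral {s..u} (\<lambda>r. ?p r * (b i u - b i r))) \<le> K * \<epsilon> * (u - s)"
    proof (rule integral_bound[OF su(2)])
      show "continuous_on {s..u} (\<lambda>r. ?p r * (b i u - b i r))" by (intro continuous_on_mult continuous_on_diff continuous_on_const cp cb)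
      fix r assume r: "r \<in> {s..u}"
      then have "\<bar>?p r\<bar> \<le> K" "\<bar>b i u - b i r\<bar> \<le> \<epsilon>" using K[OF i, of r] \<epsilon>[OF i r] su by auto
      then show "norm (?p r * (b i u - b i r)) \<le> K * \<epsilon>"
        unfolding real_norm_def abs_mult by (intro mult_mono) auto
    qed
    ultimately show ?thesis by (simp only: real_norm_def)
  qed
  have eq: "pathint I \<phi> b u - pathint I \<phi> b s - (\<Sum>i\<in>I. poly (\<phi> i) s * (b i u - b i s)) = (\<Sum>i\<in>I. ?D i)"
    unfolding pathint_def by (simp only: sum_subtractf)
  have "\<bar>\<Sum>i\<in>I. ?D i\<bar> \<le> (\<Sum>i\<in>I. K * \<epsilon> * (u - s))"
    by (rule order_trans[OF sum_abs sum_mono]) (rule step)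
  then show ?thesis unfolding eq by simp
qed

lemma continuous_on_pathint:
  assumes cont: "\<And>i. i \<in> I \<Longrightarrow> continuous_on {0..T} (b i)"
  shows "continuous_on {0..T} (pathint I \<phi> b)"
  unfolding pathint_def[abs_def]
  by (intro continuous_intros cont indefinite_integral_continuous_1 integrable_continuous_interval)

text \<open>\<open>C\<close> may depend on the path but not on the interval. Of the cubic error one
  factor is spent on \<open>\<epsilon>\<close>, and the other two become the length plus the squared
  increments, quantities that can be summed over a partition.\<close>

lemma chain_rule_path:
  fixes b :: "nat \<Rightarrow> real \<Rightarrow> real" and \<phi> :: "nat \<Rightarrow> real poly"
  assumes I: "finite I" and T: "0 \<le> T" and cont: "\<And>i. i \<in> I \<Longrightarrow> continuous_on {0..T} (b i)"
  defines "x \<equiv> pathint I \<phi> b"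
  shows "\<exists>C\<ge>0. \<forall>\<epsilon> s u. 0 < \<epsilon> \<longrightarrow> \<epsilon> \<le> 1 \<longrightarrow> 0 \<le> s \<longrightarrow> s \<le> u \<longrightarrow> u \<le> T \<longrightarrow> u - s \<le> \<epsilon> \<longrightarrow>
    (\<forall>i\<in>I. \<forall>r\<in>{s..u}. \<bar>b i u - b i r\<bar> \<le> \<epsilon>) \<longrightarrow>
    \<bar>u ^ k * x u ^ n - s ^ k * x s ^ n - (real k * s ^ (k - 1) * x s ^ n + real k * u ^ (k - 1) * x u ^ n) / 2 * (u - s)
      - (\<Sum>i\<in>I. (real n * poly (\<phi> i) s * (s ^ k * x s ^ (n - 1)) + real n * poly (\<phi> i) u * (u ^ k * x u ^ (n - 1))) / 2 * (b i u - b i s))\<bar>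
    \<le> C * \<epsilon> * ((u - s) + (\<Sum>i\<in>I. (b i u - b i s)^2))"
proof -
  obtain K where K0: "0 \<le> K" and K: "\<And>i s u. i \<in> I \<Longrightarrow> s \<in> {0..T} \<Longrightarrow> u \<in> {0..T} \<Longrightarrow>
      \<bar>poly (\<phi> i) u\<bar> \<le> K \<and> \<bar>poly (\<phi> i) u - poly (\<phi> i) s\<bar> \<le> K * \<bar>u - s\<bar> \<and> \<bar>poly (pderiv (\<phi> i)) u\<bar> \<le> K"
  proof -
    obtain K1 where K1: "0 \<le> K1" "\<forall>i\<in>I. \<forall>s\<in>{0..T}. \<forall>u\<in>{0..T}. \<bar>poly (\<phi> i) u\<bar> \<le> K1 \<and> \<bar>poly (\<phi> i) u - poly (\<phi> i) s\<bar> \<le> K1 * \<bar>u - s\<bar>"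
      using polys_bound_Lipschitz[OF T I, of \<phi>] by blast
    obtain K2 where K2: "0 \<le> K2" "\<forall>i\<in>I. \<forall>s\<in>{0..T}. \<forall>u\<in>{0..T}. \<bar>poly (pderiv (\<phi> i)) u\<bar> \<le> K2 \<and> \<bar>poly (pderiv (\<phi> i)) u - poly (pderiv (\<phi> i)) s\<bar> \<le> K2 * \<bar>u - s\<bar>"
      using polys_bound_Lipschitz[OF T I, of "\<lambda>i. pderiv (\<phi> i)"] by blast
    show thesis
    proof (rule that[of "K1 + K2"])
      fix i s u assume a: "i \<in> I" "s \<in> {0..T}" "u \<in> {0..T}"
      have "K1 * \<bar>u - s\<bar> \<le> (K1 + K2) * \<bar>u - s\<bar>" using K2 by (intro mult_right_mono) auto
      then show "\<bar>poly (\<phi> i) u\<bar> \<le> K1 + K2 \<and> \<bar>poly (\<phi> i) u - poly (\<phi> i) s\<bar> \<le> (K1 + K2) * \<bar>u - s\<bar> \<and> \<bar>poly (pderiv (\<phi> i)) u\<bar> \<le> K1 + K2"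
        using K1(1) K2(1) K1(2)[rule_format, OF a] K2(2)[rule_format, OF a] by linarith
    qed (use K1 K2 in auto)
  qed
  have cx: "continuous_on {0..T} x" unfolding x_def by (rule continuous_on_pathint[OF cont])
  obtain R where R: "T \<le> R" "0 \<le> R" "\<And>t. t \<in> {0..T} \<Longrightarrow> \<bar>x t\<bar> \<le> R"
  proof -
    have "bounded (x ` {0..T})" by (intro compact_imp_bounded compact_continuous_image cx) simp
    then obtain R0 where "\<forall>y\<in>x ` {0..T}. \<bar>y\<bar> \<le> R0" unfolding bounded_iff real_norm_def by blast
    then have "\<bar>x t\<bar> \<le> max T (max 0 R0)" if "t \<in> {0..T}" for t
    proof -
      have "\<bar>x t\<bar> \<le> R0" using \<open>\<forall>y\<in>x ` {0..T}. \<bar>y\<bar> \<le> R0\<close> that by blast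
      then show ?thesis by simp
    qed
    then show thesis by (intro that[of "max T (max 0 R0)"]) simp_all
  qed
  obtain C0 where C0: "0 \<le> C0" "\<And>s u x y. \<bar>s\<bar> \<le> R \<Longrightarrow> \<bar>u\<bar> \<le> R \<Longrightarrow> \<bar>x\<bar> \<le> R \<Longrightarrow> \<bar>y\<bar> \<le> R \<Longrightarrow>
    \<bar>u ^ k * y ^ n - s ^ k * x ^ n - (real k * s ^ (k - 1) * x ^ n + real k * u ^ (k - 1) * y ^ n) / 2 * (u - s)
      - real n * (s ^ k * x ^ (n - 1) + u ^ k * y ^ (n - 1)) / 2 * (y - x)\<bar> \<le> C0 * (\<bar>u - s\<bar> + \<bar>y - x\<bar>) ^ 3"
    using monomial_trapezoid[OF R(2), of k n] by blast
  define c where "c = real (card I)"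
  have c0: "0 \<le> c" by (simp add: c_def)
  \<comment> \<open>\<open>A\<close> dominates both parts of the increment of \<open>x\<close>: the
    left-endpoint part, at most \<open>K * w\<close>, and the remainder from integration by parts,
    at most \<open>c * K * h\<close> because \<open>\<epsilon> <= 1\<close>.\<close>
  define A where "A = 1 + c * K + K"
  have A0: "0 \<le> A" using c0 K0 by (simp add: A_def)
  define P where "P = R ^ k * R ^ (n - 1)"
  have P0: "0 \<le> P" using R by (simp add: P_def)
  \<comment> \<open>The first summand is the cubic error. The second collects two equal errors:
    replacing the increment of \<open>x\<close> by its left-endpoint approximation, and replacing
    \<open>\<phi> u\<close> by \<open>\<phi> s\<close>.\<close>
  define C where "C = C0 * A ^ 3 * (1 + c) * (2 + 2 * c) + 2 * (real n * P * c * K)"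
  have Cnn: "0 \<le> C" unfolding C_def using C0(1) A0 c0 P0 K0 by (intro add_nonneg_nonneg mult_nonneg_nonneg) auto
  show ?thesis
  proof (intro exI[where x=C] conjI allI impI Cnn)
    fix \<epsilon> s u :: real
    assume \<epsilon>: "0 < \<epsilon>" "\<epsilon> \<le> 1" and su: "0 \<le> s" "s \<le> u" "u \<le> T" and h\<epsilon>: "u - s \<le> \<epsilon>"
      and osc: "\<forall>i\<in>I. \<forall>r\<in>{s..u}. \<bar>b i u - b i r\<bar> \<le> \<epsilon>"
    have sT: "s \<in> {0..T}" "u \<in> {0..T}" using su by auto
    define h where "h = u - s"
    define \<delta> where "\<delta> i = b i u - b i s" for i
    define w where "w = (\<Sum>i\<in>I. \<bar>\<delta> i\<bar>)"
    define D where "D = (\<Sum>i\<in>I. (\<delta> i)^2)"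
    define \<beta> where "\<beta> = x u - x s"
    define G1 where "G1 = s ^ k * x s ^ (n - 1)"
    define G2 where "G2 = u ^ k * x u ^ (n - 1)"
    define \<Phi> where "\<Phi> = (\<Sum>i\<in>I. poly (\<phi> i) s * \<delta> i)"
    define \<Psi> where "\<Psi> = (\<Sum>i\<in>I. (poly (\<phi> i) u - poly (\<phi> i) s) * \<delta> i)"
    have h: "0 \<le> h" "h \<le> \<epsilon>" "h \<le> 1" using su h\<epsilon> \<epsilon> by (auto simp: h_def)
    have w0: "0 \<le> w" and D0: "0 \<le> D" by (auto simp: w_def D_def intro: sum_nonneg)
    have \<delta>\<epsilon>: "\<bar>\<delta> i\<bar> \<le> \<epsilon>" if "i \<in> I" for i using osc that su by (auto simp: \<delta>_def)
    have w\<epsilon>: "w \<le> c * \<epsilon>" unfolding w_def c_def using sum_bounded_above[of I "\<lambda>i. \<bar>\<delta> i\<bar>" \<epsilon>] \<delta>\<epsilon> by simp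
    have wD: "w\<^sup>2 \<le> c * D"
      using sum_squared_le_sum_of_squares[of "\<lambda>i. \<bar>\<delta> i\<bar>" I] unfolding w_def c_def D_def by (simp add: mult.commute)
    have \<beta>\<Phi>: "\<bar>\<beta> - \<Phi>\<bar> \<le> c * (K * \<epsilon> * h)"
      unfolding \<beta>_def \<Phi>_def c_def h_def \<delta>_def x_def
    proof (rule pathint_increment[OF cont _ su])
      show "\<bar>poly (pderiv (\<phi> i)) r\<bar> \<le> K" if "i \<in> I" "r \<in> {0..T}" for i r
        using K[OF that(1) that(2) that(2)] by simp
    qed (use osc in blast)+
    have \<Phi>w: "\<bar>\<Phi>\<bar> \<le> K * w"
    proof -
      have "\<bar>\<Phi>\<bar> \<le> (\<Sum>i\<in>I. K * \<bar>\<delta> i\<bar>)"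
        unfolding \<Phi>_def
      proof (rule order_trans[OF sum_abs sum_mono])
        fix i assume i: "i \<in> I"
        show "\<bar>poly (\<phi> i) s * \<delta> i\<bar> \<le> K * \<bar>\<delta> i\<bar>"
          unfolding abs_mult using K[OF i sT(1) sT(1)] by (intro mult_right_mono) simp_all
      qed
      then show ?thesis by (simp add: w_def sum_distrib_left)
    qed
    have \<Psi>h: "\<bar>\<Psi>\<bar> \<le> c * (K * h * \<epsilon>)"
    proof -
      have "\<bar>\<Psi>\<bar> \<le> (\<Sum>i\<in>I. (K * h) * \<epsilon>)"
        unfolding \<Psi>_def
      proof (rule order_trans[OF sum_abs sum_mono])
        fix i assume i: "i \<in> I"
        have "\<bar>poly (\<phi> i) u - poly (\<phi> i) s\<bar> \<le> K * h" using K[OF i sT] su by (simp add: h_def)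
        then show "\<bar>(poly (\<phi> i) u - poly (\<phi> i) s) * \<delta> i\<bar> \<le> (K * h) * \<epsilon>"
          unfolding abs_mult using \<delta>\<epsilon>[OF i] K0 h by (intro mult_mono) auto
      qed
      then show ?thesis by (simp add: c_def)
    qed
    have "c * (K * \<epsilon> * h) \<le> c * (K * 1 * h)"
      using c0 K0 h \<epsilon> by (intro mult_left_mono mult_right_mono) auto
    then have "h + \<bar>\<beta>\<bar> \<le> h + K * w + c * K * h" using \<beta>\<Phi> \<Phi>w by simp
    also have "\<dots> \<le> A * (h + w)"
    proof -
      have "A * (h + w) = h + K * w + c * K * h + (K * h + w + c * K * w)" by (simp add: A_def algebra_simps)
      moreover have "0 \<le> K * h + w + c * K * w" using c0 K0 h w0 by simp
      ultimately show ?thesis by linarith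
    qed
    finally have hb: "h + \<bar>\<beta>\<bar> \<le> A * (h + w)" .
    have "(h + w)\<^sup>2 \<le> 2 * h\<^sup>2 + 2 * w\<^sup>2"
      using zero_le_power2[of "h - w"] by (simp add: power2_eq_square algebra_simps)
    also have "\<dots> \<le> 2 * h + 2 * (c * D)"
    proof -
      have "h\<^sup>2 \<le> h" using h by (simp add: power2_eq_square mult_left_le)
      then show ?thesis using wD by linarith
    qed
    also have "\<dots> \<le> (2 + 2 * c) * (h + D)"
    proof -
      have "(2 + 2 * c) * (h + D) = 2 * h + 2 * (c * D) + (2 * D + 2 * (c * h))" by (simp add: algebra_simps)
      moreover have "0 \<le> 2 * D + 2 * (c * h)" using c0 h D0 by simp
      ultimately show ?thesis by linarith
    qed
    finally have hw2: "(h + w)\<^sup>2 \<le> (2 + 2 * c) * (h + D)" .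
    have hw1: "h + w \<le> (1 + c) * \<epsilon>" using h w\<epsilon> by (simp add: algebra_simps)
    have "(h + \<bar>\<beta>\<bar>) ^ 3 \<le> (A * (h + w)) ^ 3" using hb h by (intro power_mono) auto
    also have "\<dots> = A ^ 3 * ((h + w) * (h + w)\<^sup>2)" by (simp add: power_mult_distrib power3_eq_cube power2_eq_square)
    \<comment> \<open>One factor is at most \<open>(1 + c) * \<epsilon>\<close> by the oscillation
      bound; the remaining square is controlled by \<open>h + D\<close>.\<close>
    also have "\<dots> \<le> A ^ 3 * (((1 + c) * \<epsilon>) * ((2 + 2 * c) * (h + D)))"
      using hw1 hw2 A0 c0 \<epsilon> by (intro mult_left_mono mult_mono) auto
    finally have "C0 * (h + \<bar>\<beta>\<bar>) ^ 3 \<le> C0 * (A ^ 3 * (((1 + c) * \<epsilon>) * ((2 + 2 * c) * (h + D))))"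
      using C0(1) by (rule mult_left_mono)
    also have "\<dots> = C0 * A ^ 3 * (1 + c) * (2 + 2 * c) * \<epsilon> * (h + D)" by (simp only: mult_ac)
    finally have main: "C0 * (h + \<bar>\<beta>\<bar>) ^ 3 \<le> C0 * A ^ 3 * (1 + c) * (2 + 2 * c) * \<epsilon> * (h + D)" .
    have G: "\<bar>G1\<bar> \<le> P" "\<bar>G2\<bar> \<le> P"
      unfolding G1_def G2_def P_def abs_mult power_abs using R sT by (auto intro!: mult_mono power_mono)
    have e2: "\<bar>real n * (G1 + G2) / 2 * (\<beta> - \<Phi>)\<bar> \<le> real n * P * c * K * \<epsilon> * h"
    proof -
      have "\<bar>real n * (G1 + G2) / 2\<bar> \<le> real n * P"
      proof -
        have "\<bar>(G1 + G2) / 2\<bar> \<le> P" using G by auto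
        from mult_left_mono[OF this, of "real n"] show ?thesis by (simp add: abs_mult)
      qed
      then have "\<bar>real n * (G1 + G2) / 2 * (\<beta> - \<Phi>)\<bar> \<le> (real n * P) * (c * (K * \<epsilon> * h))"
        unfolding abs_mult[of "real n * (G1 + G2) / 2"] using \<beta>\<Phi> P0 by (intro mult_mono) auto
      then show ?thesis by (simp add: mult.assoc)
    qed
    have e3: "\<bar>real n * G2 / 2 * \<Psi>\<bar> \<le> real n * P * c * K * \<epsilon> * h"
    proof -
      have "\<bar>real n * G2 / 2\<bar> \<le> real n * P"
      proof -
        have "\<bar>G2 / 2\<bar> \<le> P" using G P0 by auto
        from mult_left_mono[OF this, of "real n"] show ?thesis by (simp add: abs_mult)
      qed
      then have "\<bar>real n * G2 / 2 * \<Psi>\<bar> \<le> (real n * P) * (c * (K * h * \<epsilon>))"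
        unfolding abs_mult[of "real n * G2 / 2"] using \<Psi>h P0 by (intro mult_mono) auto
      then show ?thesis by (simp only: mult_ac)
    qed
    let ?E = "u ^ k * x u ^ n - s ^ k * x s ^ n - (real k * s ^ (k - 1) * x s ^ n + real k * u ^ (k - 1) * x u ^ n) / 2 * (u - s)"
    have e1: "\<bar>?E - real n * (G1 + G2) / 2 * \<beta>\<bar> \<le> C0 * (h + \<bar>\<beta>\<bar>) ^ 3"
    proof -
      have "\<bar>s\<bar> \<le> R" "\<bar>u\<bar> \<le> R" using sT R(1) by auto
      from C0(2)[OF this R(3)[OF sT(1)] R(3)[OF sT(2)]] show ?thesis
        using su unfolding G1_def G2_def \<beta>_def h_def by simp
    qed
    have "(\<Sum>i\<in>I. (real n * poly (\<phi> i) s * G1 + real n * poly (\<phi> i) u * G2) / 2 * \<delta> i)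
        = (\<Sum>i\<in>I. real n * (G1 + G2) / 2 * (poly (\<phi> i) s * \<delta> i) + real n * G2 / 2 * ((poly (\<phi> i) u - poly (\<phi> i) s) * \<delta> i))"
      by (intro sum.cong refl) (simp add: field_simps)
    also have "\<dots> = real n * (G1 + G2) / 2 * \<Phi> + real n * G2 / 2 * \<Psi>"
      by (simp only: sum.distrib sum_distrib_left[symmetric] \<Phi>_def \<Psi>_def)
    finally have eq: "?E - (\<Sum>i\<in>I. (real n * poly (\<phi> i) s * G1 + real n * poly (\<phi> i) u * G2) / 2 * \<delta> i)
        = (?E - real n * (G1 + G2) / 2 * \<beta>) + real n * (G1 + G2) / 2 * (\<beta> - \<Phi>) - real n * G2 / 2 * \<Psi>"
      by (simp only: right_diff_distrib)
    have tri: "\<bar>p + q - r\<bar> \<le> \<bar>p\<bar> + \<bar>q\<bar> + \<bar>r\<bar>" for p q r :: real by linarith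
    have "\<bar>?E - (\<Sum>i\<in>I. (real n * poly (\<phi> i) s * G1 + real n * poly (\<phi> i) u * G2) / 2 * \<delta> i)\<bar>
        \<le> C0 * A ^ 3 * (1 + c) * (2 + 2 * c) * \<epsilon> * (h + D) + real n * P * c * K * \<epsilon> * h + real n * P * c * K * \<epsilon> * h"
      unfolding eq by (rule order_trans[OF tri]) (intro add_mono order_trans[OF e1 main] e2 e3)
    also have "\<dots> \<le> C0 * A ^ 3 * (1 + c) * (2 + 2 * c) * \<epsilon> * (h + D) + real n * P * c * K * \<epsilon> * (h + D) + real n * P * c * K * \<epsilon> * (h + D)"
    proof (intro add_mono order_refl)
      have "0 \<le> real n * P * c * K * \<epsilon>" using P0 c0 K0 \<epsilon> by (intro mult_nonneg_nonneg) simp_all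
      then show "real n * P * c * K * \<epsilon> * h \<le> real n * P * c * K * \<epsilon> * (h + D)"
        using D0 by (intro mult_left_mono) simp_all
      then show "real n * P * c * K * \<epsilon> * h \<le> real n * P * c * K * \<epsilon> * (h + D)" .
    qed
    also have "\<dots> = C * \<epsilon> * (h + D)"
    proof -
      have "a * z * y + p * z * y + p * z * y = (a + 2 * p) * z * y" for a p z y :: real by (simp add: algebra_simps)
      then show ?thesis unfolding C_def .
    qed
    finally show "\<bar>u ^ k * x u ^ n - s ^ k * x s ^ n - (real k * s ^ (k - 1) * x s ^ n + real k * u ^ (k - 1) * x u ^ n) / 2 * (u - s)
      - (\<Sum>i\<in>I. (real n * poly (\<phi> i) s * (s ^ k * x s ^ (n - 1)) + real n * poly (\<phi> i) u * (u ^ k * x u ^ (n - 1))) / 2 * (b i u - b i s))\<bar>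
      \<le> C * \<epsilon> * ((u - s) + (\<Sum>i\<in>I. (b i u - b i s)^2))"
      by (simp only: G1_def G2_def \<delta>_def h_def D_def)
  qed
qed

section \<open>Polynomials in Wiener integrals are linear in the signature\<close>

context prob_space
begin

lemma pdist_cmult_tendsto:
  assumes "\<And>n. X n \<in> borel_measurable M" "Y \<in> borel_measurable M" "(\<lambda>n. pdist M (X n) Y) \<longlonglongrightarrow> 0"
  shows "(\<lambda>n. pdist M (\<lambda>\<omega>. c * X n \<omega>) (\<lambda>\<omega>. c * Y \<omega>)) \<longlonglongrightarrow> 0"
proof (rule tendsto_sandwich[OF _ _ tendsto_const])
  have pw: "min 1 \<bar>c * x - c * y\<bar> \<le> max 1 \<bar>c\<bar> * min 1 \<bar>x - y\<bar>" for x y :: real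
  proof (cases "\<bar>x - y\<bar> \<le> 1")
    case True
    have "\<bar>c * x - c * y\<bar> = \<bar>c\<bar> * \<bar>x - y\<bar>" by (simp add: right_diff_distrib[symmetric] abs_mult)
    also have "\<dots> \<le> max 1 \<bar>c\<bar> * \<bar>x - y\<bar>" by (intro mult_right_mono) auto
    finally show ?thesis using True by (simp add: min_absorb2 min_le_iff_disj)
  qed simp
  have "pdist M (\<lambda>\<omega>. c * X n \<omega>) (\<lambda>\<omega>. c * Y \<omega>) \<le> max 1 \<bar>c\<bar> * pdist M (X n) Y" for n
  proof -
    have "pdist M (\<lambda>\<omega>. c * X n \<omega>) (\<lambda>\<omega>. c * Y \<omega>) \<le> expectation (\<lambda>\<omega>. max 1 \<bar>c\<bar> * min 1 \<bar>X n \<omega> - Y \<omega>\<bar>)"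
      unfolding pdist_def using assms pw by (intro integral_mono integrable_mult_right pdist_integrable) auto
    then show ?thesis by (simp add: pdist_def)
  qed
  then show "\<forall>\<^sub>F n in sequentially. pdist M (\<lambda>\<omega>. c * X n \<omega>) (\<lambda>\<omega>. c * Y \<omega>) \<le> max 1 \<bar>c\<bar> * pdist M (X n) Y"
    by simp
  show "(\<lambda>n. max 1 \<bar>c\<bar> * pdist M (X n) Y) \<longlonglongrightarrow> 0" using tendsto_mult_right_zero[OF assms(3)] .
qed (simp add: pdist_nonneg)

lemma pdist_sum_tendsto:
  assumes "\<And>i n. i \<in> A \<Longrightarrow> X i n \<in> borel_measurable M" "\<And>i. i \<in> A \<Longrightarrow> Y i \<in> borel_measurable M"
    "\<And>i. i \<in> A \<Longrightarrow> (\<lambda>n. pdist M (X i n) (Y i)) \<longlonglongrightarrow> 0"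
  shows "(\<lambda>n. pdist M (\<lambda>\<omega>. \<Sum>i\<in>A. X i n \<omega>) (\<lambda>\<omega>. \<Sum>i\<in>A. Y i \<omega>)) \<longlonglongrightarrow> 0"
  using assms
proof (induction A rule: infinite_finite_induct)
  case (insert j A)
  show ?case
  proof (rule tendsto_sandwich[OF _ _ tendsto_const])
    show "\<forall>\<^sub>F n in sequentially. pdist M (\<lambda>\<omega>. \<Sum>i\<in>insert j A. X i n \<omega>) (\<lambda>\<omega>. \<Sum>i\<in>insert j A. Y i \<omega>)
        \<le> pdist M (X j n) (Y j) + pdist M (\<lambda>\<omega>. \<Sum>i\<in>A. X i n \<omega>) (\<lambda>\<omega>. \<Sum>i\<in>A. Y i \<omega>)"
      using insert.prems insert.hyps by (intro always_eventually allI) (simp add: pdist_add borel_measurable_sum)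
    have "(\<lambda>n. pdist M (\<lambda>\<omega>. \<Sum>i\<in>A. X i n \<omega>) (\<lambda>\<omega>. \<Sum>i\<in>A. Y i \<omega>)) \<longlonglongrightarrow> 0"
      using insert by auto
    from tendsto_add[OF insert.prems(3)[of j] this]
    show "(\<lambda>n. pdist M (X j n) (Y j) + pdist M (\<lambda>\<omega>. \<Sum>i\<in>A. X i n \<omega>) (\<lambda>\<omega>. \<Sum>i\<in>A. Y i \<omega>)) \<longlonglongrightarrow> 0"
      by simp
  qed (simp add: pdist_nonneg)
qed (simp_all add: pdist_def)

lemma pdist_tendsto_unique:
  assumes "\<And>n. X n \<in> borel_measurable M" "Y \<in> borel_measurable M" "Z \<in> borel_measurable M"
    "(\<lambda>n. pdist M (X n) Y) \<longlonglongrightarrow> 0" "(\<lambda>n. pdist M (X n) Z) \<longlonglongrightarrow> 0"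
  shows "AE \<omega> in M. Y \<omega> = Z \<omega>"
proof (rule pdist_eq_0_AE[OF assms(2,3)])
  have "pdist M Y Z \<le> pdist M (X n) Y + pdist M (X n) Z" for n
    using pdist_triangle[OF assms(2) assms(1)[of n] assms(3)] by (simp add: pdist_commute)
  moreover have "(\<lambda>n. pdist M (X n) Y + pdist M (X n) Z) \<longlonglongrightarrow> 0"
    using tendsto_add[OF assms(4,5)] by simp
  ultimately have "pdist M Y Z \<le> 0" using LIMSEQ_le_const by blast
  then show "pdist M Y Z = 0" using pdist_nonneg[of Y Z] by linarith
qed

end

text \<open>Left-endpoint sums are finite combinations of values of a path and hence measurable in
  it; integrals of Brownian paths are obtained as their limits.\<close>

definition rsum :: "(real \<Rightarrow> real) \<Rightarrow> real \<Rightarrow> nat \<Rightarrow> real" where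
  "rsum f t n = (\<Sum>k<n. f (t * real k / real n) * (t / real n))"

lemma rsum_tendsto:
  assumes "continuous_on {0..t} f" "0 \<le> t"
  shows "rsum f t \<longlonglongrightarrow> integral {0..t} f"
proof -
  have "t * real k / real n \<le> t * real (Suc k) / real n" for k n
    using assms(2) by (intro divide_right_mono mult_left_mono) auto
  then show ?thesis unfolding rsum_def[abs_def] by (intro riemann_sum_tendsto assms) auto
qed

section \<open>Processes that are linear in the signature\<close>

context brownian_signature
begin

text \<open>Words and coefficients are the same for all times, while the exceptional null set may
  vary with the time. The former permits integration of the combination; the latter is harmless
  because partition sums involve finitely many times.\<close>

definition insig :: "(real \<Rightarrow> 'a \<Rightarrow> real) \<Rightarrow> bool" where
  "insig Y \<longleftrightarrow> (\<exists>W c. finite W \<and> W \<subseteq> words d \<and>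
     (\<forall>t\<in>{0..T}. AE \<omega> in M. Y t \<omega> = (\<Sum>w\<in>W. c w * S w t \<omega>)))"

lemma insig_S: "w \<in> words d \<Longrightarrow> insig (S w)"
  unfolding insig_def by (intro exI[where x="{w}"] exI[where x="\<lambda>_. 1"]) auto

lemma insig_cong:
  assumes "insig Y" "\<And>t. t \<in> {0..T} \<Longrightarrow> AE \<omega> in M. Z t \<omega> = Y t \<omega>"
  shows "insig Z"
proof -
  obtain W c where W: "finite W" "W \<subseteq> words d" "\<And>t. t \<in> {0..T} \<Longrightarrow> AE \<omega> in M. Y t \<omega> = (\<Sum>w\<in>W. c w * S w t \<omega>)"
    using assms(1) unfolding insig_def by blast
  have "AE \<omega> in M. Z t \<omega> = (\<Sum>w\<in>W. c w * S w t \<omega>)" if "t \<in> {0..T}" for t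
    using assms(2)[OF that] W(3)[OF that] by eventually_elim simp
  then show ?thesis unfolding insig_def using W by blast
qed

lemma insig_zero: "insig (\<lambda>_ _. 0)"
  unfolding insig_def by (intro exI[where x="{}"]) auto

lemma insig_cmult:
  assumes "insig Y"
  shows "insig (\<lambda>t \<omega>. a * Y t \<omega>)"
proof -
  obtain W c where W: "finite W" "W \<subseteq> words d" "\<And>t. t \<in> {0..T} \<Longrightarrow> AE \<omega> in M. Y t \<omega> = (\<Sum>w\<in>W. c w * S w t \<omega>)"
    using assms(1) unfolding insig_def by blast
  have "AE \<omega> in M. a * Y t \<omega> = (\<Sum>w\<in>W. (a * c w) * S w t \<omega>)" if "t \<in> {0..T}" for t
    using W(3)[OF that] by eventually_elim (simp add: sum_distrib_left mult.assoc)
  then show ?thesis unfolding insig_def using W by (intro exI[where x=W] exI[where x="\<lambda>w. a * c w"]) blast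
qed

lemma insig_add:
  assumes "insig Y" "insig Z"
  shows "insig (\<lambda>t \<omega>. Y t \<omega> + Z t \<omega>)"
proof -
  obtain W c where W: "finite W" "W \<subseteq> words d" "\<And>t. t \<in> {0..T} \<Longrightarrow> AE \<omega> in M. Y t \<omega> = (\<Sum>w\<in>W. c w * S w t \<omega>)"
    using assms(1) unfolding insig_def by blast
  obtain W' c' where W': "finite W'" "W' \<subseteq> words d" "\<And>t. t \<in> {0..T} \<Longrightarrow> AE \<omega> in M. Z t \<omega> = (\<Sum>w\<in>W'. c' w * S w t \<omega>)"
    using assms(2) unfolding insig_def by blast
  let ?c = "\<lambda>w. (if w \<in> W then c w else 0) + (if w \<in> W' then c' w else 0)"
  have "AE \<omega> in M. Y t \<omega> + Z t \<omega> = (\<Sum>w\<in>W \<union> W'. ?c w * S w t \<omega>)" if "t \<in> {0..T}" for t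
    using W(3)[OF that] W'(3)[OF that]
  proof eventually_elim
    case (elim \<omega>)
    have "(\<Sum>w\<in>W. c w * S w t \<omega>) = (\<Sum>w\<in>W \<union> W'. (if w \<in> W then c w else 0) * S w t \<omega>)"
      using W W' by (intro sum.mono_neutral_cong_left) auto
    moreover have "(\<Sum>w\<in>W'. c' w * S w t \<omega>) = (\<Sum>w\<in>W \<union> W'. (if w \<in> W' then c' w else 0) * S w t \<omega>)"
      using W W' by (intro sum.mono_neutral_cong_left) auto
    ultimately show ?case using elim by (simp only: sum.distrib[symmetric] distrib_right)
  qed
  then show ?thesis unfolding insig_def using W W' by (intro exI[where x="W \<union> W'"] exI[where x="?c"]) blast
qed

lemma insig_sum: "(\<And>x. x \<in> A \<Longrightarrow> insig (f x)) \<Longrightarrow> insig (\<lambda>t \<omega>. \<Sum>x\<in>A. f x t \<omega>)"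
  by (induction A rule: infinite_finite_induct) (auto intro: insig_zero insig_add)

lemma tsum_cmult_sum: "tsum (\<lambda>t \<omega>. \<Sum>w\<in>W. c w * S w t \<omega>) X t n \<omega> = (\<Sum>w\<in>W. c w * tsum (S w) X t n \<omega>)"
proof -
  have "tsum (\<lambda>t \<omega>. \<Sum>w\<in>W. c w * S w t \<omega>) X t n \<omega> = (\<Sum>k<n. \<Sum>w\<in>W. c w *
      ((S w (t * real k / real n) \<omega> + S w (t * real (Suc k) / real n) \<omega>) / 2 * (X (t * real (Suc k) / real n) \<omega> - X (t * real k / real n) \<omega>)))"
    unfolding tsum_def stratonovich_sum_def
    by (intro sum.cong refl, simp only: sum.distrib[symmetric] sum_divide_distrib sum_distrib_right,
        intro sum.cong refl) (simp add: algebra_simps add_divide_distrib)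
  also have "\<dots> = (\<Sum>w\<in>W. c w * tsum (S w) X t n \<omega>)"
    unfolding tsum_def stratonovich_sum_def by (subst sum.swap) (simp add: sum_distrib_left)
  finally show ?thesis .
qed

text \<open>The combination representing \<open>Z\<close> is obtained by appending \<open>\<alpha>\<close> to the words of \<open>Y \<alpha>\<close>.\<close>

lemma insig_integral:
  assumes Y: "\<And>\<alpha>. \<alpha> \<le> d \<Longrightarrow> insig (Y \<alpha>)" "\<And>\<alpha> t. \<alpha> \<le> d \<Longrightarrow> t \<in> {0..T} \<Longrightarrow> Y \<alpha> t \<in> borel_measurable M"
    and Z: "\<And>t. t \<in> {0..T} \<Longrightarrow> Z t \<in> borel_measurable M"
    and lim: "\<And>t. t \<in> {0..T} \<Longrightarrow> (\<lambda>n. pdist M (\<lambda>\<omega>. \<Sum>\<alpha>\<le>d. tsum (Y \<alpha>) (Bt \<alpha>) t n \<omega>) (Z t)) \<longlonglongrightarrow> 0"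
  shows "insig Z"
proof -
  have "\<forall>\<alpha>. \<exists>W c. \<alpha> \<le> d \<longrightarrow> finite W \<and> W \<subseteq> words d \<and>
     (\<forall>t\<in>{0..T}. AE \<omega> in M. Y \<alpha> t \<omega> = (\<Sum>w\<in>W. c w * S w t \<omega>))"
    (is "\<forall>\<alpha>. \<exists>W c. ?P \<alpha> W c")
  proof
    fix \<alpha> show "\<exists>W c. ?P \<alpha> W c"
      using Y(1)[of \<alpha>] unfolding insig_def by (cases "\<alpha> \<le> d") simp_all
  qed
  from choice[OF this] obtain W where "\<forall>\<alpha>. \<exists>c. ?P \<alpha> (W \<alpha>) c" ..
  from choice[OF this] obtain c where Wc: "\<forall>\<alpha>. ?P \<alpha> (W \<alpha>) (c \<alpha>)" ..
  have W: "finite (W \<alpha>)" "W \<alpha> \<subseteq> words d"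
    "t \<in> {0..T} \<Longrightarrow> AE \<omega> in M. Y \<alpha> t \<omega> = (\<Sum>w\<in>W \<alpha>. c \<alpha> w * S w t \<omega>)" if "\<alpha> \<le> d" for \<alpha> t
    using Wc[rule_format, OF that] by simp_all
  define Z' where "Z' t \<omega> = (\<Sum>\<alpha>\<le>d. \<Sum>w\<in>W \<alpha>. c \<alpha> w * S (w @ [\<alpha>]) t \<omega>)" for t \<omega>
  have wS: "w @ [\<alpha>] \<in> words d" if "\<alpha> \<le> d" "w \<in> W \<alpha>" for \<alpha> w
    using W(2)[OF that(1)] that by (auto simp: words_snoc)
  have "insig Z'"
    unfolding Z'_def[abs_def] using wS by (intro insig_sum insig_cmult insig_S) auto
  moreover have "AE \<omega> in M. Z t \<omega> = Z' t \<omega>" if t: "t \<in> {0..T}" for t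
  proof (rule pdist_tendsto_unique[where X="\<lambda>n \<omega>. \<Sum>\<alpha>\<le>d. tsum (Y \<alpha>) (Bt \<alpha>) t n \<omega>", OF _ Z[OF t] _ lim[OF t]])
    show tm: "(\<lambda>\<omega>. \<Sum>\<alpha>\<le>d. tsum (Y \<alpha>) (Bt \<alpha>) t n \<omega>) \<in> borel_measurable M" for n
      using Y(2) t by (intro borel_measurable_sum tsum_measurable) auto
    show Z'm: "Z' t \<in> borel_measurable M"
      unfolding Z'_def[abs_def] using wS t
      by (intro borel_measurable_sum borel_measurable_times borel_measurable_const S_measurable) auto
    have tS: "tsum (S w) (Bt \<alpha>) t n \<in> borel_measurable M" if "\<alpha> \<le> d" "w \<in> W \<alpha>" for \<alpha> w n
      using W(2)[OF that(1)] that t by (intro tsum_measurable S_measurable) auto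
    have "(\<lambda>n. pdist M (\<lambda>\<omega>. \<Sum>\<alpha>\<le>d. \<Sum>w\<in>W \<alpha>. c \<alpha> w * tsum (S w) (Bt \<alpha>) t n \<omega>) (Z' t)) \<longlonglongrightarrow> 0"
      unfolding Z'_def[abs_def]
    proof (rule pdist_sum_tendsto)
      fix \<alpha> assume "\<alpha> \<in> {..d}"
      then have \<alpha>: "\<alpha> \<le> d" by simp
      note m = tS[OF \<alpha>] S_measurable[OF wS[OF \<alpha>] t]
      show "(\<lambda>\<omega>. \<Sum>w\<in>W \<alpha>. c \<alpha> w * tsum (S w) (Bt \<alpha>) t n \<omega>) \<in> borel_measurable M" for n
        by (intro borel_measurable_sum borel_measurable_times borel_measurable_const m)
      show "(\<lambda>\<omega>. \<Sum>w\<in>W \<alpha>. c \<alpha> w * S (w @ [\<alpha>]) t \<omega>) \<in> borel_measurable M"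
        by (intro borel_measurable_sum borel_measurable_times borel_measurable_const m)
      show "(\<lambda>n. pdist M (\<lambda>\<omega>. \<Sum>w\<in>W \<alpha>. c \<alpha> w * tsum (S w) (Bt \<alpha>) t n \<omega>) (\<lambda>\<omega>. \<Sum>w\<in>W \<alpha>. c \<alpha> w * S (w @ [\<alpha>]) t \<omega>)) \<longlonglongrightarrow> 0"
      proof (rule pdist_sum_tendsto)
        fix w assume w: "w \<in> W \<alpha>"
        show "(\<lambda>\<omega>. c \<alpha> w * tsum (S w) (Bt \<alpha>) t n \<omega>) \<in> borel_measurable M" for n
          by (intro borel_measurable_times borel_measurable_const m w)
        show "(\<lambda>\<omega>. c \<alpha> w * S (w @ [\<alpha>]) t \<omega>) \<in> borel_measurable M"
          by (intro borel_measurable_times borel_measurable_const m w)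
        show "(\<lambda>n. pdist M (\<lambda>\<omega>. c \<alpha> w * tsum (S w) (Bt \<alpha>) t n \<omega>) (\<lambda>\<omega>. c \<alpha> w * S (w @ [\<alpha>]) t \<omega>)) \<longlonglongrightarrow> 0"
          by (intro pdist_cmult_tendsto m w tsum_tendsto \<alpha> t) (use W(2)[OF \<alpha>] w in auto)
      qed
    qed
    moreover have "pdist M (\<lambda>\<omega>. \<Sum>\<alpha>\<le>d. \<Sum>w\<in>W \<alpha>. c \<alpha> w * tsum (S w) (Bt \<alpha>) t n \<omega>) (Z' t)
        = pdist M (\<lambda>\<omega>. \<Sum>\<alpha>\<le>d. tsum (Y \<alpha>) (Bt \<alpha>) t n \<omega>) (Z' t)" for n
    proof (rule pdist_cong_AE[OF _ Z'm tm Z'm])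
      show "(\<lambda>\<omega>. \<Sum>\<alpha>\<le>d. \<Sum>w\<in>W \<alpha>. c \<alpha> w * tsum (S w) (Bt \<alpha>) t n \<omega>) \<in> borel_measurable M"
        using tS by (intro borel_measurable_sum borel_measurable_times borel_measurable_const) auto
      \<comment> \<open>Only finitely many letters and nodes occur, so the exceptional sets unite to
        a null set.\<close>
      have "AE \<omega> in M. \<forall>\<alpha>\<in>{..d}. \<forall>k\<in>{..n}. Y \<alpha> (t * real k / real n) \<omega> = (\<Sum>w\<in>W \<alpha>. c \<alpha> w * S w (t * real k / real n) \<omega>)"
        using W(3) partition_mem[OF t] by (intro AE_finite_allI) auto
      then show "AE \<omega> in M. (\<Sum>\<alpha>\<le>d. \<Sum>w\<in>W \<alpha>. c \<alpha> w * tsum (S w) (Bt \<alpha>) t n \<omega>) = (\<Sum>\<alpha>\<le>d. tsum (Y \<alpha>) (Bt \<alpha>) t n \<omega>)"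
      proof eventually_elim
        case (elim \<omega>)
        have "tsum (\<lambda>t \<omega>. \<Sum>w\<in>W \<alpha>. c \<alpha> w * S w t \<omega>) (Bt \<alpha>) t n \<omega> = tsum (Y \<alpha>) (Bt \<alpha>) t n \<omega>" if "\<alpha> \<le> d" for \<alpha>
          unfolding tsum_def stratonovich_sum_def
        proof (rule sum.cong[OF refl])
          fix k assume "k \<in> {..<n}"
          then have k: "k \<in> {..n}" "Suc k \<in> {..n}" by auto
          have \<alpha>: "\<alpha> \<in> {..d}" using that by simp
          note e = elim[rule_format, OF \<alpha> k(1)] elim[rule_format, OF \<alpha> k(2)]
          show "((\<Sum>w\<in>W \<alpha>. c \<alpha> w * S w (t * real k / real n) \<omega>) + (\<Sum>w\<in>W \<alpha>. c \<alpha> w * S w (t * real (Suc k) / real n) \<omega>)) / 2 *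
              (Bt \<alpha> (t * real (Suc k) / real n) \<omega> - Bt \<alpha> (t * real k / real n) \<omega>) =
            (Y \<alpha> (t * real k / real n) \<omega> + Y \<alpha> (t * real (Suc k) / real n) \<omega>) / 2 *
              (Bt \<alpha> (t * real (Suc k) / real n) \<omega> - Bt \<alpha> (t * real k / real n) \<omega>)"
            by (simp only: e)
        qed
        then show ?case unfolding tsum_cmult_sum[symmetric] by (intro sum.cong) auto
      qed
    qed simp
    ultimately show "(\<lambda>n. pdist M (\<lambda>\<omega>. \<Sum>\<alpha>\<le>d. tsum (Y \<alpha>) (Bt \<alpha>) t n \<omega>) (Z' t)) \<longlonglongrightarrow> 0"
      by (simp only:)
  qed
  ultimately show ?thesis by (rule insig_cong)
qed

text \<open>A measurable version of \<open>pathint\<close> along Brownian paths; \<open>lim\<close> is junk off the continuous paths.\<close>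

definition Xproc :: "(nat \<Rightarrow> real poly) \<Rightarrow> real \<Rightarrow> 'a \<Rightarrow> real" where
  "Xproc \<phi> t \<omega> = (\<Sum>i\<in>{1..d}. poly (\<phi> i) t * B i t \<omega>
     - lim (rsum (\<lambda>r. poly (pderiv (\<phi> i)) r * B i r \<omega>) t))"

lemma Xproc_measurable:
  assumes t: "t \<in> {0..T}"
  shows "Xproc \<phi> t \<in> borel_measurable M"
proof -
  have "(\<lambda>\<omega>. rsum (\<lambda>r. poly (pderiv (\<phi> i)) r * B i r \<omega>) t n) \<in> borel_measurable M" if "i \<in> {1..d}" for i n
    unfolding rsum_def using that partition_mem[OF t]
    by (intro borel_measurable_sum borel_measurable_times borel_measurable_const B_measurable) auto
  then have "(\<lambda>\<omega>. lim (\<lambda>n. rsum (\<lambda>r. poly (pderiv (\<phi> i)) r * B i r \<omega>) t n)) \<in> borel_measurable M" if "i \<in> {1..d}" for i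
    using that by (intro borel_measurable_lim_metric) auto
  then show ?thesis unfolding Xproc_def[abs_def] using t
    by (intro borel_measurable_sum borel_measurable_diff borel_measurable_times borel_measurable_const B_measurable) auto
qed

definition goodpath :: "'a \<Rightarrow> bool" where
  "goodpath \<omega> \<longleftrightarrow> (\<forall>i\<in>{1..d}. continuous_on {0..T} (\<lambda>t. B i t \<omega>) \<and> B i 0 \<omega> = 0)"

lemma AE_goodpath: "AE \<omega> in M. goodpath \<omega>"
  unfolding goodpath_def using brownian
  by (intro AE_finite_allI) (auto simp: standard_brownian_motion_def)

lemma Xproc_eq_pathint:
  assumes "goodpath \<omega>" "t \<in> {0..T}"
  shows "Xproc \<phi> t \<omega> = pathint {1..d} \<phi> (\<lambda>i t. B i t \<omega>) t"
  unfolding Xproc_def pathint_def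
proof (rule sum.cong[OF refl])
  fix i assume i: "i \<in> {1..d}"
  have c: "continuous_on {0..t} (\<lambda>t. B i t \<omega>)"
    by (rule continuous_on_subset[of "{0..T}"]) (use assms i in \<open>auto simp: goodpath_def\<close>)
  have "rsum (\<lambda>r. poly (pderiv (\<phi> i)) r * B i r \<omega>) t \<longlonglongrightarrow> integral {0..t} (\<lambda>r. poly (pderiv (\<phi> i)) r * B i r \<omega>)"
    using assms by (intro rsum_tendsto continuous_on_mult c continuous_on_poly continuous_on_id) auto
  then show "poly (\<phi> i) t * B i t \<omega> - lim (rsum (\<lambda>r. poly (pderiv (\<phi> i)) r * B i r \<omega>) t)
      = poly (\<phi> i) t * B i t \<omega> - integral {0..t} (\<lambda>r. poly (pderiv (\<phi> i)) r * B i r \<omega>)"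
    by (simp add: limI)
qed

end

lemma uniform_modulus_finite:
  fixes b :: "'i \<Rightarrow> real \<Rightarrow> real"
  assumes "finite I" "\<And>i. i \<in> I \<Longrightarrow> continuous_on {0..T} (b i)" "0 < \<epsilon>"
  shows "\<exists>\<delta>>0. \<forall>i\<in>I. \<forall>x\<in>{0..T}. \<forall>y\<in>{0..T}. \<bar>x - y\<bar> < \<delta> \<longrightarrow> \<bar>b i x - b i y\<bar> \<le> \<epsilon>"
  using assms(1,2)
proof (induction I rule: finite_induct)
  case (insert j I)
  have "uniformly_continuous_on {0..T} (b j)" by (rule compact_uniformly_continuous) (use insert in auto)
  then obtain \<delta>1 where \<delta>1: "0 < \<delta>1" "\<And>x y. x \<in> {0..T} \<Longrightarrow> y \<in> {0..T} \<Longrightarrow> dist y x < \<delta>1 \<Longrightarrow> dist (b j y) (b j x) < \<epsilon>"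
    using assms(3) unfolding uniformly_continuous_on_def by metis
  obtain \<delta>2 where \<delta>2: "0 < \<delta>2" "\<forall>i\<in>I. \<forall>x\<in>{0..T}. \<forall>y\<in>{0..T}. \<bar>x - y\<bar> < \<delta>2 \<longrightarrow> \<bar>b i x - b i y\<bar> \<le> \<epsilon>"
    using insert.IH insert.prems by auto
  show ?case
  proof (intro exI[where x="min \<delta>1 \<delta>2"] conjI ballI impI)
    fix i x y assume i: "i \<in> insert j I" and xy: "x \<in> {0..T}" "y \<in> {0..T}" "\<bar>x - y\<bar> < min \<delta>1 \<delta>2"
    show "\<bar>b i x - b i y\<bar> \<le> \<epsilon>"
    proof (cases "i = j")
      case True
      then show ?thesis using \<delta>1(2)[OF xy(2,1)] xy(3) by (simp add: dist_real_def)
    next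
      case False
      then have "i \<in> I" using i by simp
      from \<delta>2(2)[rule_format, OF this xy(1,2)] xy(3) show ?thesis by simp
    qed
  qed (use \<delta>1 \<delta>2 in simp)
qed (auto intro: exI[where x=1])

section \<open>The chain rule in probability along Brownian paths\<close>

context brownian_signature
begin

lemma B_increment_second_moment:
  assumes "i \<in> {1..d}" "0 \<le> s" "s \<le> u" "u \<le> T"
  shows "integrable M (\<lambda>\<omega>. (B i u \<omega> - B i s \<omega>)^2)" "expectation (\<lambda>\<omega>. (B i u \<omega> - B i s \<omega>)^2) = u - s"
proof -
  have "integrable M (\<lambda>\<omega>. (B i u \<omega> - B i s \<omega>)^2) \<and> expectation (\<lambda>\<omega>. (B i u \<omega> - B i s \<omega>)^2) = u - s"
  proof (cases "s = u")
    case False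
    with assms have "s < u" by simp
    then show ?thesis using normal_moments(1,2)[OF B_increment_normal[OF assms(1,2) \<open>s < u\<close> assms(4)]] by simp
  qed simp
  then show "integrable M (\<lambda>\<omega>. (B i u \<omega> - B i s \<omega>)^2)" "expectation (\<lambda>\<omega>. (B i u \<omega> - B i s \<omega>)^2) = u - s"
    by auto
qed

text \<open>The random factor in the error of the chain rule. A bound on its mean that is uniform in
  \<open>n\<close> is enough; its convergence is not at issue.\<close>

definition qsum :: "real \<Rightarrow> nat \<Rightarrow> 'a \<Rightarrow> real" where
  "qsum t n \<omega> = (\<Sum>l<n. \<Sum>i\<in>{1..d}. (B i (t * real (Suc l) / real n) \<omega> - B i (t * real l / real n) \<omega>)^2)"

lemma qsum_nonneg: "0 \<le> qsum t n \<omega>"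
  unfolding qsum_def by (intro sum_nonneg) simp

lemma qsum_expectation:
  assumes t: "t \<in> {0..T}"
  shows "integrable M (qsum t n)" "expectation (qsum t n) \<le> real d * T"
proof -
  have le: "t * real l / real n \<le> t * real (Suc l) / real n" for l
    using t by (intro divide_right_mono mult_left_mono) auto
  have m: "integrable M (\<lambda>\<omega>. (B i (t * real (Suc l) / real n) \<omega> - B i (t * real l / real n) \<omega>)^2)"
    "expectation (\<lambda>\<omega>. (B i (t * real (Suc l) / real n) \<omega> - B i (t * real l / real n) \<omega>)^2) = t / real n"
    if "i \<in> {1..d}" "l < n" for i l
  proof -
    have "0 \<le> t * real l / real n" "t * real (Suc l) / real n \<le> T"
      using partition_mem[OF t, of l n] partition_mem[OF t, of "Suc l" n] that by auto
    from B_increment_second_moment[OF that(1) this(1) le this(2)]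
    show "integrable M (\<lambda>\<omega>. (B i (t * real (Suc l) / real n) \<omega> - B i (t * real l / real n) \<omega>)^2)"
      "expectation (\<lambda>\<omega>. (B i (t * real (Suc l) / real n) \<omega> - B i (t * real l / real n) \<omega>)^2) = t / real n"
      by (simp_all add: algebra_simps add_divide_distrib)
  qed
  show "integrable M (qsum t n)"
    unfolding qsum_def[abs_def] using m(1) by (intro Bochner_Integration.integrable_sum) auto
  have "expectation (qsum t n) = (\<Sum>l<n. \<Sum>i\<in>{1..d}. t / real n)"
    unfolding qsum_def[abs_def] using m
    by (subst Bochner_Integration.integral_sum, force intro!: Bochner_Integration.integrable_sum,
        intro sum.cong refl, subst Bochner_Integration.integral_sum) auto
  also have "\<dots> \<le> real d * T" using t by (cases "n = 0") (auto simp: T_pos intro: mult_left_mono)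
  finally show "expectation (qsum t n) \<le> real d * T" .
qed

text \<open>The integrand belonging to the letter \<open>\<alpha>\<close> in the differential of
  \<open>t^k X^n\<close>. Where \<open>k - 1\<close> or \<open>n - 1\<close> is truncated, the
  leading factor is 0.\<close>

definition chain_integrand :: "(nat \<Rightarrow> real poly) \<Rightarrow> nat \<Rightarrow> nat \<Rightarrow> nat \<Rightarrow> real \<Rightarrow> 'a \<Rightarrow> real" where
  "chain_integrand \<phi> k n \<alpha> t \<omega> = (if \<alpha> = 0 then real k * t ^ (k - 1) * Xproc \<phi> t \<omega> ^ n
     else real n * poly (\<phi> \<alpha>) t * (t ^ k * Xproc \<phi> t \<omega> ^ (n - 1)))"

lemma chain_integrand_measurable: "t \<in> {0..T} \<Longrightarrow> chain_integrand \<phi> k n \<alpha> t \<in> borel_measurable M"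
  unfolding chain_integrand_def[abs_def] using Xproc_measurable by (cases "\<alpha> = 0") auto

text \<open>Summing the local errors bounds the total one by \<open>C * \<epsilon>\<close> times
  \<open>t + qsum t m \<omega>\<close>; division by \<open>1 + qsum t m \<omega>\<close> makes it
  vanish for each good path. The pair \<open>(0, 0)\<close> is excluded since the telescoping sum
  needs the value 0 at time 0.\<close>

lemma chain_rule_limit:
  assumes kn: "(k, n) \<noteq> (0, 0)" and t: "t \<in> {0..T}" and \<omega>: "goodpath \<omega>"
  shows "(\<lambda>m. ((\<Sum>\<alpha>\<le>d. tsum (chain_integrand \<phi> k n \<alpha>) (Bt \<alpha>) t m \<omega>) - t ^ k * Xproc \<phi> t \<omega> ^ n) / (1 + qsum t m \<omega>)) \<longlonglongrightarrow> 0"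
proof (rule LIMSEQ_I)
  fix e :: real assume e: "0 < e"
  define b where "b i s = B i s \<omega>" for i s
  define x where "x = pathint {1..d} \<phi> b"
  have X: "Xproc \<phi> s \<omega> = x s" if "s \<in> {0..T}" for s
    using Xproc_eq_pathint[OF \<omega> that] by (simp add: x_def b_def[abs_def])
  have cont: "continuous_on {0..T} (b i)" "b i 0 = 0" if "i \<in> {1..d}" for i
    using \<omega> that by (auto simp: goodpath_def b_def[abs_def])
  obtain C where C0: "0 \<le> C" and C: "\<And>\<epsilon> s u. 0 < \<epsilon> \<Longrightarrow> \<epsilon> \<le> 1 \<Longrightarrow> 0 \<le> s \<Longrightarrow> s \<le> u \<Longrightarrow> u \<le> T \<Longrightarrow> u - s \<le> \<epsilon> \<Longrightarrow>
    (\<forall>i\<in>{1..d}. \<forall>r\<in>{s..u}. \<bar>b i u - b i r\<bar> \<le> \<epsilon>) \<Longrightarrow>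
    \<bar>u ^ k * x u ^ n - s ^ k * x s ^ n - (real k * s ^ (k - 1) * x s ^ n + real k * u ^ (k - 1) * x u ^ n) / 2 * (u - s)
      - (\<Sum>i\<in>{1..d}. (real n * poly (\<phi> i) s * (s ^ k * x s ^ (n - 1)) + real n * poly (\<phi> i) u * (u ^ k * x u ^ (n - 1))) / 2 * (b i u - b i s))\<bar>
    \<le> C * \<epsilon> * ((u - s) + (\<Sum>i\<in>{1..d}. (b i u - b i s)^2))"
    using chain_rule_path[OF finite_atLeastAtMost less_imp_le[OF T_pos] cont(1), of 1 d "\<lambda>i. i" k \<phi> n] unfolding x_def by blast
  \<comment> \<open>Chosen for the estimate \<open>C * \<epsilon> * (t + Q) <= \<epsilon> * (C + 1)
    * (T + 1) * (1 + Q)\<close> of the total error; the added ones keep the denominator positive and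
    absorb \<open>t\<close>.\<close>
  define \<epsilon> where "\<epsilon> = min 1 (e / (2 * ((C + 1) * (T + 1))))"
  have p: "0 < (C + 1) * (T + 1)" using C0 T_pos by simp
  have \<epsilon>: "0 < \<epsilon>" "\<epsilon> \<le> 1" using e p by (auto simp: \<epsilon>_def)
  have "\<epsilon> * ((C + 1) * (T + 1)) \<le> e / (2 * ((C + 1) * (T + 1))) * ((C + 1) * (T + 1))"
    using p by (intro mult_right_mono) (auto simp: \<epsilon>_def)
  also have "\<dots> = e / 2"
  proof -
    have "e / (2 * z) * z = e / 2" if "0 < z" for z using that by simp
    from this[OF p] show ?thesis .
  qed
  finally have \<epsilon>e: "\<epsilon> * ((C + 1) * (T + 1)) < e" using e by simp
  have "\<exists>\<delta>>0. \<forall>i\<in>{1..d}. \<forall>x\<in>{0..T}. \<forall>y\<in>{0..T}. \<bar>x - y\<bar> < \<delta> \<longrightarrow> \<bar>b i x - b i y\<bar> \<le> \<epsilon>"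
    by (rule uniform_modulus_finite) (use cont \<epsilon> in auto)
  then obtain \<delta>0 where \<delta>0: "0 < \<delta>0" "\<forall>i\<in>{1..d}. \<forall>x\<in>{0..T}. \<forall>y\<in>{0..T}. \<bar>x - y\<bar> < \<delta>0 \<longrightarrow> \<bar>b i x - b i y\<bar> \<le> \<epsilon>"
    by (elim exE conjE)
  define \<delta> where "\<delta> = min \<delta>0 \<epsilon>"
  have \<delta>: "0 < \<delta>" using \<delta>0 \<epsilon> by (simp add: \<delta>_def)
  obtain N where N: "t / \<delta> < real N" using reals_Archimedean2 by blast
  have "norm (((\<Sum>\<alpha>\<le>d. tsum (chain_integrand \<phi> k n \<alpha>) (Bt \<alpha>) t m \<omega>) - t ^ k * Xproc \<phi> t \<omega> ^ n) / (1 + qsum t m \<omega>) - 0) < e"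
    if m: "m \<ge> Suc N" for m
  proof -
    have m0: "0 < real m" using m by simp
    have "t < \<delta> * real N" using N \<delta> by (simp add: field_simps)
    also have "\<dots> \<le> \<delta> * real m" using m \<delta> by (intro mult_left_mono) auto
    finally have h: "t / real m < \<delta>" using m0 by (simp add: field_simps)
    define q where "q l = t * real l / real m" for l
    have qd: "q (Suc l) - q l = t / real m" for l by (simp add: q_def algebra_simps add_divide_distrib)
    have qle: "q l \<le> q (Suc l)" for l
    proof -
      have "0 \<le> t / real m" using t m0 by simp
      then show ?thesis using qd[of l] by linarith
    qed
    have qT: "q l \<in> {0..T}" if "l \<le> m" for l unfolding q_def by (rule partition_mem[OF t that])
    define Z where "Z s = s ^ k * x s ^ n" for s
    define I where "I l = (real k * q l ^ (k - 1) * x (q l) ^ n + real k * q (Suc l) ^ (k - 1) * x (q (Suc l)) ^ n) / 2 * (q (Suc l) - q l)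
      + (\<Sum>i\<in>{1..d}. (real n * poly (\<phi> i) (q l) * (q l ^ k * x (q l) ^ (n - 1)) +
          real n * poly (\<phi> i) (q (Suc l)) * (q (Suc l) ^ k * x (q (Suc l)) ^ (n - 1))) / 2 * (b i (q (Suc l)) - b i (q l)))" for l
    have step: "\<bar>Z (q (Suc l)) - Z (q l) - I l\<bar> \<le> C * \<epsilon> * (t / real m + (\<Sum>i\<in>{1..d}. (b i (q (Suc l)) - b i (q l))^2))"
      if l: "l < m" for l
    proof -
      have lT: "q l \<in> {0..T}" "q (Suc l) \<in> {0..T}" using qT l by auto
      have "\<forall>i\<in>{1..d}. \<forall>r\<in>{q l..q (Suc l)}. \<bar>b i (q (Suc l)) - b i r\<bar> \<le> \<epsilon>"
      proof (intro ballI)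
        fix i r assume i: "i \<in> {1..d}" and r: "r \<in> {q l..q (Suc l)}"
        have "r \<in> {0..T}" using r lT by auto
        moreover have "\<bar>q (Suc l) - r\<bar> < \<delta>0" using r qd[of l] h by (auto simp: \<delta>_def)
        ultimately show "\<bar>b i (q (Suc l)) - b i r\<bar> \<le> \<epsilon>" using \<delta>0(2) i lT by blast
      qed
      moreover have "q (Suc l) - q l \<le> \<epsilon>" using qd[of l] h by (simp add: \<delta>_def)
      ultimately have "\<bar>q (Suc l) ^ k * x (q (Suc l)) ^ n - q l ^ k * x (q l) ^ n
          - (real k * q l ^ (k - 1) * x (q l) ^ n + real k * q (Suc l) ^ (k - 1) * x (q (Suc l)) ^ n) / 2 * (q (Suc l) - q l)
          - (\<Sum>i\<in>{1..d}. (real n * poly (\<phi> i) (q l) * (q l ^ k * x (q l) ^ (n - 1)) +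
          real n * poly (\<phi> i) (q (Suc l)) * (q (Suc l) ^ k * x (q (Suc l)) ^ (n - 1))) / 2 * (b i (q (Suc l)) - b i (q l)))\<bar>
        \<le> C * \<epsilon> * ((q (Suc l) - q l) + (\<Sum>i\<in>{1..d}. (b i (q (Suc l)) - b i (q l))^2))"
        using lT qle[of l] \<epsilon> by (intro C) auto
      then show ?thesis unfolding Z_def I_def qd by (simp only: diff_diff_eq add.assoc)
    qed
    have sumI: "(\<Sum>\<alpha>\<le>d. tsum (chain_integrand \<phi> k n \<alpha>) (Bt \<alpha>) t m \<omega>) = (\<Sum>l<m. I l)"
    proof -
      have "{..d} = insert 0 {1..d}" by auto
      then have "(\<Sum>\<alpha>\<le>d. tsum (chain_integrand \<phi> k n \<alpha>) (Bt \<alpha>) t m \<omega>) =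
          tsum (chain_integrand \<phi> k n 0) (Bt 0) t m \<omega> + (\<Sum>i\<in>{1..d}. tsum (chain_integrand \<phi> k n i) (Bt i) t m \<omega>)"
        by simp
      also have "(\<Sum>i\<in>{1..d}. tsum (chain_integrand \<phi> k n i) (Bt i) t m \<omega>) = (\<Sum>l<m. \<Sum>i\<in>{1..d}.
          (real n * poly (\<phi> i) (q l) * (q l ^ k * x (q l) ^ (n - 1)) +
          real n * poly (\<phi> i) (q (Suc l)) * (q (Suc l) ^ k * x (q (Suc l)) ^ (n - 1))) / 2 * (b i (q (Suc l)) - b i (q l)))"
      proof (subst sum.swap, rule sum.cong[OF refl])
        fix i assume "i \<in> {1..d}"
        then have "i \<noteq> 0" by auto
        then show "tsum (chain_integrand \<phi> k n i) (Bt i) t m \<omega> = (\<Sum>l<m. (real n * poly (\<phi> i) (q l) * (q l ^ k * x (q l) ^ (n - 1)) +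
          real n * poly (\<phi> i) (q (Suc l)) * (q (Suc l) ^ k * x (q (Suc l)) ^ (n - 1))) / 2 * (b i (q (Suc l)) - b i (q l)))"
          unfolding tsum_def stratonovich_sum_def q_def[symmetric] chain_integrand_def Bt_def b_def
          by (intro sum.cong refl) (use X qT in simp)
      qed
      also have "tsum (chain_integrand \<phi> k n 0) (Bt 0) t m \<omega> =
          (\<Sum>l<m. (real k * q l ^ (k - 1) * x (q l) ^ n + real k * q (Suc l) ^ (k - 1) * x (q (Suc l)) ^ n) / 2 * (q (Suc l) - q l))"
        unfolding tsum_def stratonovich_sum_def q_def[symmetric] chain_integrand_def Bt_def
        by (intro sum.cong refl) (use X qT in simp)
      finally show ?thesis unfolding I_def by (simp only: sum.distrib)
    qed
    have "x 0 = 0" unfolding x_def pathint_def using cont(2) by simp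
    then have Z0: "Z 0 = 0" using kn by (auto simp: Z_def)
    have "(\<Sum>l<m. Z (q (Suc l)) - Z (q l)) = Z (q m) - Z (q 0)" by (rule sum_lessThan_telescope)
    then have Zt: "(\<Sum>l<m. Z (q (Suc l)) - Z (q l)) = t ^ k * Xproc \<phi> t \<omega> ^ n"
      using Z0 m0 X[OF t] by (simp add: q_def Z_def)
    have Qm: "qsum t m \<omega> = (\<Sum>l<m. \<Sum>i\<in>{1..d}. (b i (q (Suc l)) - b i (q l))^2)"
      unfolding qsum_def b_def q_def ..
    have "\<bar>(\<Sum>\<alpha>\<le>d. tsum (chain_integrand \<phi> k n \<alpha>) (Bt \<alpha>) t m \<omega>) - t ^ k * Xproc \<phi> t \<omega> ^ n\<bar>
        = \<bar>\<Sum>l<m. Z (q (Suc l)) - Z (q l) - I l\<bar>"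
      unfolding sumI Zt[symmetric] by (simp only: sum_subtractf abs_minus_commute)
    also have "\<dots> \<le> (\<Sum>l<m. C * \<epsilon> * (t / real m + (\<Sum>i\<in>{1..d}. (b i (q (Suc l)) - b i (q l))^2)))"
      by (rule order_trans[OF sum_abs sum_mono]) (use step in auto)
    also have "\<dots> = C * \<epsilon> * (t + qsum t m \<omega>)"
      unfolding Qm using m0 by (simp only: sum_distrib_left[symmetric] sum.distrib) simp
    also have "\<dots> \<le> (\<epsilon> * ((C + 1) * (T + 1))) * (1 + qsum t m \<omega>)"
    proof -
      have "t + qsum t m \<omega> \<le> (T + 1) * (1 + qsum t m \<omega>)"
      proof -
        have "(T + 1) * (1 + qsum t m \<omega>) = T + qsum t m \<omega> + (1 + T * qsum t m \<omega>)" by (simp add: algebra_simps)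
        moreover have "0 \<le> 1 + T * qsum t m \<omega>" using T_pos qsum_nonneg[of t m \<omega>] by simp
        ultimately show ?thesis using t by simp
      qed
      then have "C * \<epsilon> * (t + qsum t m \<omega>) \<le> ((C + 1) * \<epsilon>) * ((T + 1) * (1 + qsum t m \<omega>))"
        using C0 \<epsilon> t qsum_nonneg[of t m \<omega>] by (intro mult_mono) auto
      then show ?thesis by (simp only: mult_ac)
    qed
    also have "\<dots> < e * (1 + qsum t m \<omega>)"
      using \<epsilon>e qsum_nonneg[of t m \<omega>] by (intro mult_strict_right_mono) auto
    finally have fin: "\<bar>(\<Sum>\<alpha>\<le>d. tsum (chain_integrand \<phi> k n \<alpha>) (Bt \<alpha>) t m \<omega>) - t ^ k * Xproc \<phi> t \<omega> ^ n\<bar> < e * (1 + qsum t m \<omega>)" .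
    have pos: "0 < 1 + qsum t m \<omega>" using qsum_nonneg[of t m \<omega>] by simp
    show ?thesis unfolding real_norm_def diff_zero abs_divide abs_of_pos[OF pos] pos_divide_less_eq[OF pos] by (rule fin)
  qed
  then show "\<exists>m0. \<forall>m\<ge>m0. norm (((\<Sum>\<alpha>\<le>d. tsum (chain_integrand \<phi> k n \<alpha>) (Bt \<alpha>) t m \<omega>) - t ^ k * Xproc \<phi> t \<omega> ^ n) / (1 + qsum t m \<omega>) - 0) < e"
    by blast
qed

text \<open>If the integrands of all letters are linear in the signature, so is the monomial: the
  pathwise limit becomes one in probability by the uniform L1 bound on \<open>qsum\<close>, and
  \<open>insig_integral\<close> applies.\<close>

lemma insig_chain:
  assumes kn: "(k, n) \<noteq> (0, 0)" and Y: "\<And>\<alpha>. \<alpha> \<le> d \<Longrightarrow> insig (chain_integrand \<phi> k n \<alpha>)"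
  shows "insig (\<lambda>t \<omega>. t ^ k * Xproc \<phi> t \<omega> ^ n)"
proof (rule insig_integral[OF Y])
  show "chain_integrand \<phi> k n \<alpha> t \<in> borel_measurable M" if "t \<in> {0..T}" for \<alpha> t
    by (rule chain_integrand_measurable[OF that])
  show Zm: "(\<lambda>\<omega>. t ^ k * Xproc \<phi> t \<omega> ^ n) \<in> borel_measurable M" if "t \<in> {0..T}" for t
    using Xproc_measurable[OF that] by simp
  fix t assume t: "t \<in> {0..T}"
  let ?U = "\<lambda>m \<omega>. \<Sum>\<alpha>\<le>d. tsum (chain_integrand \<phi> k n \<alpha>) (Bt \<alpha>) t m \<omega>"
  have Um: "?U m \<in> borel_measurable M" for m
    using t chain_integrand_measurable by (intro borel_measurable_sum tsum_measurable) auto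
  have "(\<lambda>m. pdist M (\<lambda>\<omega>. ?U m \<omega> - t ^ k * Xproc \<phi> t \<omega> ^ n) (\<lambda>_. 0)) \<longlonglongrightarrow> 0"
  proof (rule pdist_tendsto_0_mult_L1_bounded[where Q="qsum t" and c="real d * T"])
    show "AE \<omega> in M. (\<lambda>m. (?U m \<omega> - t ^ k * Xproc \<phi> t \<omega> ^ n) / (1 + qsum t m \<omega>)) \<longlonglongrightarrow> 0"
      using AE_goodpath by eventually_elim (rule chain_rule_limit[OF kn t])
  qed (use Um Zm[OF t] qsum_expectation[OF t] qsum_nonneg in auto)
  then show "(\<lambda>m. pdist M (?U m) (\<lambda>\<omega>. t ^ k * Xproc \<phi> t \<omega> ^ n)) \<longlonglongrightarrow> 0"
    by (simp add: pdist_def)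
qed

text \<open>The Brownian letters lower \<open>n\<close>, but their polynomial coefficients raise the
  power of time, so the hypothesis on \<open>n\<close> must hold for every \<open>k\<close>. The
  time letter keeps \<open>n\<close> and lowers \<open>k\<close>, which forces the inner
  induction.\<close>

lemma insig_monomial: "insig (\<lambda>t \<omega>. t ^ k * Xproc \<phi> t \<omega> ^ n)"
proof (induction n arbitrary: k)
  case 0
  show ?case
  proof (induction k)
    case 0
    show ?case
    proof (rule insig_cong)
      show "insig (S [])" by (rule insig_S) (simp add: words_def)
      show "AE \<omega> in M. t ^ 0 * Xproc \<phi> t \<omega> ^ 0 = S [] t \<omega>" if "t \<in> {0..T}" for t
        using signature that by (intro AE_I2) (simp add: is_stratonovich_signature_def)
    qed
  next
    case (Suc k)
    show ?case
    proof (rule insig_chain)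
      fix \<alpha> show "insig (chain_integrand \<phi> (Suc k) 0 \<alpha>)"
        using insig_cmult[OF Suc, of "real (Suc k)"] insig_zero
        by (cases "\<alpha> = 0") (simp_all add: chain_integrand_def[abs_def] mult.assoc)
    qed simp
  qed
next
  case (Suc n)
  have Yi: "insig (chain_integrand \<phi> k (Suc n) \<alpha>)" if "\<alpha> \<noteq> 0" for k \<alpha>
  proof (rule insig_cong)
    show "insig (\<lambda>t \<omega>. \<Sum>a\<le>degree (\<phi> \<alpha>). (real (Suc n) * coeff (\<phi> \<alpha>) a) * (t ^ (a + k) * Xproc \<phi> t \<omega> ^ n))"
      by (intro insig_sum insig_cmult Suc)
    show "AE \<omega> in M. chain_integrand \<phi> k (Suc n) \<alpha> t \<omega> =
        (\<Sum>a\<le>degree (\<phi> \<alpha>). (real (Suc n) * coeff (\<phi> \<alpha>) a) * (t ^ (a + k) * Xproc \<phi> t \<omega> ^ n))" for t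
      using that by (intro AE_I2) (simp add: chain_integrand_def poly_altdef sum_distrib_left sum_distrib_right power_add mult_ac)
  qed
  show ?case
  proof (induction k)
    case 0
    show ?case
    proof (rule insig_chain)
      fix \<alpha> show "insig (chain_integrand \<phi> 0 (Suc n) \<alpha>)"
        using Yi[of \<alpha> 0] insig_zero by (cases "\<alpha> = 0") (simp_all add: chain_integrand_def[abs_def])
    qed simp
  next
    case (Suc k)
    show ?case
    proof (rule insig_chain)
      fix \<alpha> show "insig (chain_integrand \<phi> (Suc k) (Suc n) \<alpha>)"
      proof (cases "\<alpha> = 0")
        case True
        have "chain_integrand \<phi> (Suc k) (Suc n) \<alpha> = (\<lambda>t \<omega>. real (Suc k) * (t ^ k * Xproc \<phi> t \<omega> ^ Suc n))"
          using True by (simp add: chain_integrand_def[abs_def] mult.assoc)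
        then show ?thesis using insig_cmult[OF Suc, of "real (Suc k)"] by simp
      qed (rule Yi)
    qed simp
  qed
qed

lemma Xproc_power_linear:
  "\<exists>g\<in>signature_linear_functions d T S. AE \<omega> in M. Xproc \<phi> T \<omega> ^ n = g \<omega>"
proof -
  obtain W c where W: "finite W" "W \<subseteq> words d" "\<forall>t\<in>{0..T}. AE \<omega> in M. t ^ 0 * Xproc \<phi> t \<omega> ^ n = (\<Sum>w\<in>W. c w * S w t \<omega>)"
    using insig_monomial[of 0 \<phi> n] unfolding insig_def by (elim exE conjE)
  have "AE \<omega> in M. Xproc \<phi> T \<omega> ^ n = (\<Sum>w\<in>W. c w * S w T \<omega>)"
    using W(3)[rule_format, of T] T_pos by simp
  moreover have "(\<lambda>\<omega>. \<Sum>w\<in>W. c w * S w T \<omega>) \<in> signature_linear_functions d T S"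
    unfolding signature_linear_functions_def using W by blast
  ultimately show ?thesis by (intro bexI[where x="\<lambda>\<omega>. \<Sum>w\<in>W. c w * S w T \<omega>"])
qed

end

section \<open>Density\<close>

context prob_space
begin

text \<open>Completing the square turns the exponentially weighted density into a multiple of the
  normal density shifted by \<open>a * \<sigma>^2\<close>.\<close>

lemma normal_exp_moment:
  assumes D: "distributed M lborel X (normal_density 0 \<sigma>)" and \<sigma>: "0 < \<sigma>"
  shows "integrable M (\<lambda>\<omega>. exp (a * X \<omega>))" "expectation (\<lambda>\<omega>. exp (a * X \<omega>)) = exp (a\<^sup>2 * \<sigma>\<^sup>2 / 2)"
proof -
  have dens: "normal_density 0 \<sigma> x * exp (a * x) = exp (a\<^sup>2 * \<sigma>\<^sup>2 / 2) * normal_density (a * \<sigma>\<^sup>2) \<sigma> x" for x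
  proof -
    have "- (x - 0)\<^sup>2 / (2 * \<sigma>\<^sup>2) + a * x = a\<^sup>2 * \<sigma>\<^sup>2 / 2 + - (x - a * \<sigma>\<^sup>2)\<^sup>2 / (2 * \<sigma>\<^sup>2)"
      using \<sigma> by (simp add: field_simps power2_eq_square)
    then have "exp (- (x - 0)\<^sup>2 / (2 * \<sigma>\<^sup>2)) * exp (a * x) = exp (a\<^sup>2 * \<sigma>\<^sup>2 / 2) * exp (- (x - a * \<sigma>\<^sup>2)\<^sup>2 / (2 * \<sigma>\<^sup>2))"
      by (simp only: exp_add[symmetric])
    then show ?thesis unfolding normal_density_def by (simp only: mult.assoc mult.left_commute)
  qed
  have i: "integrable lborel (\<lambda>x. normal_density 0 \<sigma> x * exp (a * x))"
    unfolding dens using integrable_normal_density[OF \<sigma>] by simp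
  show "integrable M (\<lambda>\<omega>. exp (a * X \<omega>))"
    using i distributed_integrable[OF D, of "\<lambda>x. exp (a * x)"] by (simp add: normal_density_nonneg)
  have "expectation (\<lambda>\<omega>. exp (a * X \<omega>)) = (\<integral>x. normal_density 0 \<sigma> x * exp (a * x) \<partial>lborel)"
    using distributed_integral[OF D, of "\<lambda>x. exp (a * x)"] by (simp add: normal_density_nonneg)
  then show "expectation (\<lambda>\<omega>. exp (a * X \<omega>)) = exp (a\<^sup>2 * \<sigma>\<^sup>2 / 2)"
    unfolding dens using integral_normal_density[OF \<sigma>] by simp
qed

end

text \<open>A dominating function for all Taylor polynomials at once; its square is integrable once
  exponential moments exist.\<close>

lemma cos_sin_partial_sums_bound:
  fixes x :: real
  shows "\<bar>\<Sum>k<n. cos_coeff k * x ^ k\<bar> \<le> exp \<bar>x\<bar>" "\<bar>\<Sum>k<n. sin_coeff k * x ^ k\<bar> \<le> exp \<bar>x\<bar>"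
proof -
  have e: "(\<Sum>k<n. \<bar>x\<bar> ^ k / fact k) \<le> exp \<bar>x\<bar>"
  proof -
    have "(\<lambda>k. \<bar>x\<bar> ^ k / fact k) sums exp \<bar>x\<bar>" using exp_converges[of "\<bar>x\<bar>"] by (simp add: divide_inverse mult.commute)
    then show ?thesis using sum_le_suminf[of "\<lambda>k. \<bar>x\<bar> ^ k / fact k" "{..<n}"] by (simp add: sums_iff)
  qed
  have "\<bar>\<Sum>k<n. c k * x ^ k\<bar> \<le> (\<Sum>k<n. \<bar>x\<bar> ^ k / fact k)" if c: "\<And>k. \<bar>c k\<bar> \<le> 1 / fact k" for c :: "nat \<Rightarrow> real"
  proof (rule order_trans[OF sum_abs sum_mono])
    fix k
    have "\<bar>c k\<bar> * \<bar>x\<bar> ^ k \<le> 1 / fact k * \<bar>x\<bar> ^ k" using c by (intro mult_right_mono) auto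
    then show "\<bar>c k * x ^ k\<bar> \<le> \<bar>x\<bar> ^ k / fact k" by (simp add: abs_mult power_abs)
  qed
  moreover have "\<bar>cos_coeff k\<bar> \<le> 1 / fact k" "\<bar>sin_coeff k\<bar> \<le> 1 / fact k" for k
    by (auto simp: cos_coeff_def sin_coeff_def abs_mult power_abs)
  ultimately show "\<bar>\<Sum>k<n. cos_coeff k * x ^ k\<bar> \<le> exp \<bar>x\<bar>" "\<bar>\<Sum>k<n. sin_coeff k * x ^ k\<bar> \<le> exp \<bar>x\<bar>"
    using e by (meson order_trans)+
qed

section \<open>The L2 closure of the linear functions of the signature\<close>

context brownian_signature
begin

abbreviation linfun :: "('a \<Rightarrow> real) set" where
  "linfun \<equiv> signature_linear_functions d T S"

lemma linfun_L2:
  assumes "g \<in> linfun"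
  shows "g \<in> borel_measurable M" "integrable M (\<lambda>\<omega>. (g \<omega>)^2)"
  using signature_linear_functions_L2 assms by (auto simp: L2_space_def)

text \<open>The two sets of words have to be merged, which \<open>insig_add\<close> has already
  done; equality is therefore almost sure only.\<close>

lemma linfun_combination:
  assumes "g \<in> linfun" "h \<in> linfun"
  shows "\<exists>f\<in>linfun. AE \<omega> in M. a * g \<omega> + b * h \<omega> = f \<omega>"
proof -
  obtain W c where g: "g = (\<lambda>\<omega>. \<Sum>w\<in>W. c w * S w T \<omega>)" "finite W" "W \<subseteq> words d"
    using assms(1) unfolding signature_linear_functions_def mem_Collect_eq by (elim exE conjE)
  obtain W' c' where h: "h = (\<lambda>\<omega>. \<Sum>w\<in>W'. c' w * S w T \<omega>)" "finite W'" "W' \<subseteq> words d"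
    using assms(2) unfolding signature_linear_functions_def mem_Collect_eq by (elim exE conjE)
  have 1: "insig (\<lambda>t \<omega>. \<Sum>w\<in>W. c w * S w t \<omega>)"
    by (rule insig_sum, rule insig_cmult, rule insig_S) (use g(3) in blast)
  have 2: "insig (\<lambda>t \<omega>. \<Sum>w\<in>W'. c' w * S w t \<omega>)"
    by (rule insig_sum, rule insig_cmult, rule insig_S) (use h(3) in blast)
  obtain V k where V: "finite V" "V \<subseteq> words d" "\<forall>t\<in>{0..T}. AE \<omega> in M.
      a * (\<Sum>w\<in>W. c w * S w t \<omega>) + b * (\<Sum>w\<in>W'. c' w * S w t \<omega>) = (\<Sum>w\<in>V. k w * S w t \<omega>)"
    using insig_add[OF insig_cmult[OF 1, of a] insig_cmult[OF 2, of b]] unfolding insig_def by (elim exE conjE)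
  have "T \<in> {0..T}" using T_pos by simp
  from V(3)[rule_format, OF this] have "AE \<omega> in M. a * g \<omega> + b * h \<omega> = (\<Sum>w\<in>V. k w * S w T \<omega>)"
    unfolding g(1) h(1) .
  moreover have "(\<lambda>\<omega>. \<Sum>w\<in>V. k w * S w T \<omega>) \<in> linfun"
    unfolding signature_linear_functions_def mem_Collect_eq using V(1,2) by (intro exI[where x=V] exI[where x=k] conjI refl)
  ultimately show ?thesis by (intro bexI[where x="\<lambda>\<omega>. \<Sum>w\<in>V. k w * S w T \<omega>"])
qed

text \<open>Membership in the closed span. Squared distances avoid the square root of
  \<open>L2_norm\<close>.\<close>

definition inH :: "('a \<Rightarrow> real) \<Rightarrow> bool" where
  "inH f \<longleftrightarrow> f \<in> borel_measurable M \<and> integrable M (\<lambda>\<omega>. (f \<omega>)^2) \<and>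
     (\<forall>\<epsilon>>0. \<exists>g\<in>linfun. expectation (\<lambda>\<omega>. (f \<omega> - g \<omega>)^2) < \<epsilon>)"

lemma integrable_square_diff:
  assumes "f \<in> borel_measurable M" "integrable M (\<lambda>\<omega>. (f \<omega>)^2)"
    "g \<in> borel_measurable M" "integrable M (\<lambda>\<omega>. (g \<omega>)^2)"
  shows "integrable M (\<lambda>\<omega>. (f \<omega> - g \<omega> :: real)^2)"
proof -
  have "(x - y)^2 \<le> 2 * x^2 + 2 * y^2" for x y :: real
    using zero_le_power2[of "x + y"] by (simp add: power2_eq_square algebra_simps)
  note b = this
  show ?thesis
    by (rule Bochner_Integration.integrable_bound[where f="\<lambda>\<omega>. 2 * (f \<omega>)^2 + 2 * (g \<omega>)^2"])
      (use assms b in auto)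
qed

lemma expectation_square_triangle:
  assumes "f \<in> borel_measurable M" "integrable M (\<lambda>\<omega>. (f \<omega>)^2)"
    "g \<in> borel_measurable M" "integrable M (\<lambda>\<omega>. (g \<omega>)^2)"
    "h \<in> borel_measurable M" "integrable M (\<lambda>\<omega>. (h \<omega>)^2)"
  shows "expectation (\<lambda>\<omega>. (f \<omega> - h \<omega> :: real)^2) \<le> 2 * expectation (\<lambda>\<omega>. (f \<omega> - g \<omega>)^2) + 2 * expectation (\<lambda>\<omega>. (g \<omega> - h \<omega>)^2)"
proof -
  have p: "(x - z)^2 \<le> 2 * (x - y)^2 + 2 * (y - z)^2" for x y z :: real
    using zero_le_power2[of "x + z - 2 * y"] by (simp add: power2_eq_square algebra_simps)
  note i = integrable_square_diff[OF assms(1,2,3,4)] integrable_square_diff[OF assms(3,4,5,6)] integrable_square_diff[OF assms(1,2,5,6)]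
  have "expectation (\<lambda>\<omega>. (f \<omega> - h \<omega>)^2) \<le> expectation (\<lambda>\<omega>. 2 * (f \<omega> - g \<omega>)^2 + 2 * (g \<omega> - h \<omega>)^2)"
    using i p by (intro integral_mono) auto
  also have "\<dots> = 2 * expectation (\<lambda>\<omega>. (f \<omega> - g \<omega>)^2) + 2 * expectation (\<lambda>\<omega>. (g \<omega> - h \<omega>)^2)"
    using i by simp
  finally show ?thesis .
qed

lemma inH_closed:
  assumes "f \<in> borel_measurable M" "integrable M (\<lambda>\<omega>. (f \<omega>)^2)"
    and approx: "\<And>\<epsilon>. 0 < \<epsilon> \<Longrightarrow> \<exists>h. inH h \<and> expectation (\<lambda>\<omega>. (f \<omega> - h \<omega>)^2) < \<epsilon>"
  shows "inH f"
  unfolding inH_def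
proof (intro conjI allI impI)
  fix \<epsilon> :: real assume \<epsilon>: "0 < \<epsilon>"
  obtain h where h: "inH h" "expectation (\<lambda>\<omega>. (f \<omega> - h \<omega>)^2) < \<epsilon> / 4" using approx[of "\<epsilon> / 4"] \<epsilon> by auto
  have "0 < \<epsilon> / 4" using \<epsilon> by simp
  then obtain g where g: "g \<in> linfun" "expectation (\<lambda>\<omega>. (h \<omega> - g \<omega>)^2) < \<epsilon> / 4" using h(1) unfolding inH_def by blast
  have "expectation (\<lambda>\<omega>. (f \<omega> - g \<omega>)^2) \<le> 2 * expectation (\<lambda>\<omega>. (f \<omega> - h \<omega>)^2) + 2 * expectation (\<lambda>\<omega>. (h \<omega> - g \<omega>)^2)"
    using assms(1,2) h(1) linfun_L2[OF g(1)] unfolding inH_def by (intro expectation_square_triangle) auto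
  with g h show "\<exists>g\<in>linfun. expectation (\<lambda>\<omega>. (f \<omega> - g \<omega>)^2) < \<epsilon>" by (intro bexI[where x=g]) auto
qed (use assms in auto)

lemma inH_cong_AE:
  assumes "inH f" "f' \<in> borel_measurable M" "AE \<omega> in M. f \<omega> = f' \<omega>"
  shows "inH f'"
proof (rule inH_closed[OF assms(2)])
  have m: "f \<in> borel_measurable M" "integrable M (\<lambda>\<omega>. (f \<omega>)^2)" using assms(1) by (auto simp: inH_def)
  show "integrable M (\<lambda>\<omega>. (f' \<omega>)^2)"
    by (rule Bochner_Integration.integrable_cong_AE_imp[OF m(2)]) (use assms(2,3) in auto)
  have "expectation (\<lambda>\<omega>. (f' \<omega> - f \<omega>)^2) = expectation (\<lambda>\<omega>. 0)"
    by (rule integral_cong_AE) (use assms m in auto)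
  then show "\<exists>h. inH h \<and> expectation (\<lambda>\<omega>. (f' \<omega> - h \<omega>)^2) < \<epsilon>" if "0 < \<epsilon>" for \<epsilon>
    using assms(1) that by (intro exI[where x=f]) auto
qed

lemma inH_linfun: "g \<in> linfun \<Longrightarrow> inH g"
  unfolding inH_def using linfun_L2[of g] by (auto intro!: bexI[where x=g])

lemma inH_combination:
  assumes "inH f" "inH f'"
  shows "inH (\<lambda>\<omega>. a * f \<omega> + b * f' \<omega>)"
proof (rule inH_closed)
  have m: "f \<in> borel_measurable M" "integrable M (\<lambda>\<omega>. (f \<omega>)^2)" "f' \<in> borel_measurable M" "integrable M (\<lambda>\<omega>. (f' \<omega>)^2)"
    using assms by (auto simp: inH_def)
  show "(\<lambda>\<omega>. a * f \<omega> + b * f' \<omega>) \<in> borel_measurable M" using m by auto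
  have "integrable M (\<lambda>\<omega>. (a * f \<omega> - (- b) * f' \<omega>)^2)"
    using m by (intro integrable_square_diff) (auto simp: power_mult_distrib)
  then show "integrable M (\<lambda>\<omega>. (a * f \<omega> + b * f' \<omega>)^2)" by simp
  fix \<epsilon> :: real assume \<epsilon>: "0 < \<epsilon>"
  \<comment> \<open>The summand 1 keeps \<open>c\<close> positive and leaves the room
    \<open>\<epsilon> / c\<close> that makes the final inequality strict.\<close>
  define c where "c = 2 * a\<^sup>2 + 2 * b\<^sup>2 + 1"
  have c: "0 < c" unfolding c_def using zero_le_power2[of a] zero_le_power2[of b] by linarith
  have "0 < \<epsilon> / c" using \<epsilon> c by simp
  then obtain g g' where g: "g \<in> linfun" "expectation (\<lambda>\<omega>. (f \<omega> - g \<omega>)^2) < \<epsilon> / c"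
    and g': "g' \<in> linfun" "expectation (\<lambda>\<omega>. (f' \<omega> - g' \<omega>)^2) < \<epsilon> / c"
    using assms unfolding inH_def by blast
  obtain h where h: "h \<in> linfun" "AE \<omega> in M. a * g \<omega> + b * g' \<omega> = h \<omega>"
    using linfun_combination[OF g(1) g'(1)] by blast
  note i = integrable_square_diff[OF m(1,2) linfun_L2[OF g(1)]] integrable_square_diff[OF m(3,4) linfun_L2[OF g'(1)]]
  note mm = m linfun_L2(1)[OF g(1)] linfun_L2(1)[OF g'(1)] linfun_L2(1)[OF h(1)]
  have p: "(a * x + b * y)^2 \<le> 2 * a\<^sup>2 * x^2 + 2 * b\<^sup>2 * y^2" for x y :: real
    using zero_le_power2[of "a * x - b * y"] by (simp add: power2_eq_square algebra_simps)
  have "expectation (\<lambda>\<omega>. (a * f \<omega> + b * f' \<omega> - h \<omega>)^2) = expectation (\<lambda>\<omega>. (a * (f \<omega> - g \<omega>) + b * (f' \<omega> - g' \<omega>))^2)"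
  proof (rule integral_cong_AE)
    show "AE \<omega> in M. (a * f \<omega> + b * f' \<omega> - h \<omega>)^2 = (a * (f \<omega> - g \<omega>) + b * (f' \<omega> - g' \<omega>))^2"
      using h(2)
    proof eventually_elim
      case (elim \<omega>)
      then have "a * f \<omega> + b * f' \<omega> - h \<omega> = a * (f \<omega> - g \<omega>) + b * (f' \<omega> - g' \<omega>)" by (simp add: algebra_simps)
      then show ?case by simp
    qed
  qed (use mm in measurable)
  also have "\<dots> \<le> expectation (\<lambda>\<omega>. 2 * a\<^sup>2 * (f \<omega> - g \<omega>)^2 + 2 * b\<^sup>2 * (f' \<omega> - g' \<omega>)^2)"
  proof (rule integral_mono)
    show i': "integrable M (\<lambda>\<omega>. 2 * a\<^sup>2 * (f \<omega> - g \<omega>)^2 + 2 * b\<^sup>2 * (f' \<omega> - g' \<omega>)^2)" using i by simp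
    show "integrable M (\<lambda>\<omega>. (a * (f \<omega> - g \<omega>) + b * (f' \<omega> - g' \<omega>))^2)"
      by (rule Bochner_Integration.integrable_bound[OF i'], use mm in measurable, use p in auto)
  qed (use p in auto)
  also have "\<dots> = 2 * a\<^sup>2 * expectation (\<lambda>\<omega>. (f \<omega> - g \<omega>)^2) + 2 * b\<^sup>2 * expectation (\<lambda>\<omega>. (f' \<omega> - g' \<omega>)^2)"
    using i by simp
  also have "\<dots> \<le> 2 * a\<^sup>2 * (\<epsilon> / c) + 2 * b\<^sup>2 * (\<epsilon> / c)"
    using g(2) g'(2) by (intro add_mono mult_left_mono) auto
  also have "\<dots> = (c - 1) * (\<epsilon> / c)"
  proof -
    have "2 * a\<^sup>2 * z + 2 * b\<^sup>2 * z = (c - 1) * z" for z by (simp add: c_def algebra_simps)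
    then show ?thesis .
  qed
  also have "\<dots> < \<epsilon>"
  proof -
    have "(c - 1) * (\<epsilon> / c) = \<epsilon> - \<epsilon> / c" using c by (simp add: left_diff_distrib diff_divide_distrib)
    then show ?thesis using \<open>0 < \<epsilon> / c\<close> by linarith
  qed
  finally show "\<exists>h. inH h \<and> expectation (\<lambda>\<omega>. (a * f \<omega> + b * f' \<omega> - h \<omega>)^2) < \<epsilon>"
    using inH_linfun[OF h(1)] by blast
qed

lemma inH_add: "inH f \<Longrightarrow> inH g \<Longrightarrow> inH (\<lambda>\<omega>. f \<omega> + g \<omega>)"
  using inH_combination[of f g 1 1] by simp

lemma inH_cmult: "inH f \<Longrightarrow> inH (\<lambda>\<omega>. a * f \<omega>)"
  using inH_combination[of f f a 0] by simp

lemma inH_zero: "inH (\<lambda>_. 0)"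
proof -
  have "(\<lambda>\<omega>. \<Sum>w\<in>{}. 0 * S w T \<omega>) \<in> linfun"
    unfolding signature_linear_functions_def by (intro CollectI exI[where x="{}"] exI[where x="\<lambda>_. 0"]) simp
  then show ?thesis using inH_linfun by fastforce
qed

lemma inH_sum: "(\<And>x. x \<in> A \<Longrightarrow> inH (f x)) \<Longrightarrow> inH (\<lambda>\<omega>. \<Sum>x\<in>A. f x \<omega>)"
  by (induction A rule: infinite_finite_induct) (auto intro: inH_zero inH_add)

text \<open>Dominated convergence in L2. It serves every later passage to the limit in the closed
  span: Taylor series, Dirac approximations, indicators and simple functions.\<close>

lemma inH_dominated:
  assumes F: "\<And>n::nat. inH (F n)" and f: "f \<in> borel_measurable M"
    and lim: "AE \<omega> in M. (\<lambda>n. F n \<omega>) \<longlonglongrightarrow> f \<omega>"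
    and w: "w \<in> borel_measurable M" "integrable M (\<lambda>\<omega>. (w \<omega>)^2)" "\<And>n. AE \<omega> in M. \<bar>F n \<omega>\<bar> \<le> w \<omega>"
  shows "inH f"
proof -
  have m: "F n \<in> borel_measurable M" "integrable M (\<lambda>\<omega>. (F n \<omega>)^2)" for n using F[of n] by (auto simp: inH_def)
  have Fw: "AE \<omega> in M. \<forall>n. \<bar>F n \<omega>\<bar> \<le> w \<omega>" using w(3) by (simp add: AE_all_countable)
  have fw: "AE \<omega> in M. \<bar>f \<omega>\<bar> \<le> w \<omega>"
    using lim Fw
  proof eventually_elim
    case (elim \<omega>)
    show ?case by (rule LIMSEQ_le_const2[OF tendsto_rabs[OF elim(1)]]) (use elim(2) in auto)
  qed
  have f2: "integrable M (\<lambda>\<omega>. (f \<omega>)^2)"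
  proof (rule Bochner_Integration.integrable_bound[OF w(2)])
    show "AE \<omega> in M. norm ((f \<omega>)^2) \<le> norm ((w \<omega>)^2)"
      using fw
    proof eventually_elim
      case (elim \<omega>)
      from power_mono[OF this abs_ge_zero, of 2] show ?case by simp
    qed
  qed (use f in simp)
  have "(\<lambda>n. expectation (\<lambda>\<omega>. (f \<omega> - F n \<omega>)^2)) \<longlonglongrightarrow> expectation (\<lambda>\<omega>. 0)"
  proof (rule integral_dominated_convergence[where w="\<lambda>\<omega>. 4 * (w \<omega>)^2"])
    show "AE \<omega> in M. (\<lambda>n. (f \<omega> - F n \<omega>)^2) \<longlonglongrightarrow> 0"
      using lim
    proof eventually_elim
      case (elim \<omega>)
      then have "(\<lambda>n. (f \<omega> - F n \<omega>)^2) \<longlonglongrightarrow> (f \<omega> - f \<omega>)^2" by (intro tendsto_intros)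
      then show ?case by simp
    qed
    show "AE \<omega> in M. norm ((f \<omega> - F n \<omega>)^2) \<le> 4 * (w \<omega>)^2" for n
      using fw w(3)[of n]
    proof eventually_elim
      case (elim \<omega>)
      then have "\<bar>f \<omega> - F n \<omega>\<bar> \<le> 2 * w \<omega>" by linarith
      from power_mono[OF this, of 2] show ?case by (simp add: power_mult_distrib)
    qed
  qed (use f m w in auto)
  then have lim0: "(\<lambda>n. expectation (\<lambda>\<omega>. (f \<omega> - F n \<omega>)^2)) \<longlonglongrightarrow> 0" by simp
  show ?thesis
  proof (rule inH_closed[OF f f2])
    fix \<epsilon> :: real assume "0 < \<epsilon>"
    then have "\<forall>\<^sub>F n in sequentially. expectation (\<lambda>\<omega>. (f \<omega> - F n \<omega>)^2) < \<epsilon>" using order_tendstoD(2)[OF lim0] by blast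
    then obtain n where "expectation (\<lambda>\<omega>. (f \<omega> - F n \<omega>)^2) < \<epsilon>" using eventually_happens'[OF sequentially_bot] by blast
    then show "\<exists>h. inH h \<and> expectation (\<lambda>\<omega>. (f \<omega> - h \<omega>)^2) < \<epsilon>" using F by blast
  qed
qed

text \<open>The Taylor polynomials converge pointwise and are dominated by the exponential of
  \<open>\<bar>X\<bar>\<close>, whose square is at most
  \<open>exp (2 X) + exp (- 2 X)\<close>.\<close>

lemma inH_cos_sin:
  assumes X: "X \<in> borel_measurable M" "\<And>n. inH (\<lambda>\<omega>. X \<omega> ^ n)" "\<And>a. integrable M (\<lambda>\<omega>. exp (a * X \<omega>))"
  shows "inH (\<lambda>\<omega>. cos (X \<omega>))" "inH (\<lambda>\<omega>. sin (X \<omega>))"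
proof -
  have w: "integrable M (\<lambda>\<omega>. (exp \<bar>X \<omega>\<bar>)^2)"
  proof (rule Bochner_Integration.integrable_bound[OF Bochner_Integration.integrable_add[OF X(3)[of 2] X(3)[of "-2"]]])
    have "(exp \<bar>x\<bar>)^2 \<le> exp (2 * x) + exp (- 2 * x)" for x :: real
      by (cases "0 \<le> x") (simp_all add: power2_eq_square exp_add[symmetric])
    then show "AE \<omega> in M. norm ((exp \<bar>X \<omega>\<bar>)^2) \<le> norm (exp (2 * X \<omega>) + exp (- 2 * X \<omega>))" by simp
  qed (use X in simp)
  have wm: "(\<lambda>\<omega>. exp \<bar>X \<omega>\<bar>) \<in> borel_measurable M" using X by simp
  show "inH (\<lambda>\<omega>. cos (X \<omega>))"
  proof (rule inH_dominated[where F="\<lambda>n \<omega>. \<Sum>k<n. cos_coeff k * X \<omega> ^ k", OF _ _ _ wm w])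
    show "inH (\<lambda>\<omega>. \<Sum>k<n. cos_coeff k * X \<omega> ^ k)" for n by (intro inH_sum inH_cmult X)
    have "(\<lambda>n. \<Sum>k<n. cos_coeff k * x ^ k) \<longlonglongrightarrow> cos x" for x :: real
      using cos_converges[of x] by (simp add: sums_def)
    then show "AE \<omega> in M. (\<lambda>n. \<Sum>k<n. cos_coeff k * X \<omega> ^ k) \<longlonglongrightarrow> cos (X \<omega>)" by simp
  qed (use X cos_sin_partial_sums_bound in auto)
  show "inH (\<lambda>\<omega>. sin (X \<omega>))"
  proof (rule inH_dominated[where F="\<lambda>n \<omega>. \<Sum>k<n. sin_coeff k * X \<omega> ^ k", OF _ _ _ wm w])
    show "inH (\<lambda>\<omega>. \<Sum>k<n. sin_coeff k * X \<omega> ^ k)" for n by (intro inH_sum inH_cmult X)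
    have "(\<lambda>n. \<Sum>k<n. sin_coeff k * x ^ k) \<longlonglongrightarrow> sin x" for x :: real
      using sin_converges[of x] by (simp add: sums_def)
    then show "AE \<omega> in M. (\<lambda>n. \<Sum>k<n. sin_coeff k * X \<omega> ^ k) \<longlonglongrightarrow> sin (X \<omega>)" by simp
  qed (use X cos_sin_partial_sums_bound in auto)
qed

lemma inH_Xproc_power: "inH (\<lambda>\<omega>. Xproc \<phi> T \<omega> ^ n)"
proof -
  obtain g where g: "g \<in> linfun" "AE \<omega> in M. Xproc \<phi> T \<omega> ^ n = g \<omega>" using Xproc_power_linear by blast
  have "AE \<omega> in M. g \<omega> = Xproc \<phi> T \<omega> ^ n" using g(2) by eventually_elim simp
  then show ?thesis using Xproc_measurable[of T \<phi>] T_pos by (intro inH_cong_AE[OF inH_linfun[OF g(1)]]) auto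
qed

text \<open>The exact value \<open>exp (a^2 t / 2)\<close> is weakened to a bound uniform in
  \<open>t\<close>. Time 0 is separate, because a degenerate normal law has no density and
  \<open>B\<close> starts at 0 only almost surely.\<close>

lemma B_exp_moment:
  assumes i: "i \<in> {1..d}" and t: "t \<in> {0..T}"
  shows "integrable M (\<lambda>\<omega>. exp (a * B i t \<omega>))" "expectation (\<lambda>\<omega>. exp (a * B i t \<omega>)) \<le> exp (a\<^sup>2 * T)"
proof -
  have B0: "AE \<omega> in M. B i 0 \<omega> = 0" using AE_goodpath by eventually_elim (use i in \<open>auto simp: goodpath_def\<close>)
  have "integrable M (\<lambda>\<omega>. exp (a * B i t \<omega>)) \<and> expectation (\<lambda>\<omega>. exp (a * B i t \<omega>)) \<le> exp (a\<^sup>2 * T)"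
  proof (cases "t = 0")
    case True
    have e: "AE \<omega> in M. 1 = exp (a * B i t \<omega>)" using B0 by eventually_elim (simp add: True)
    have m: "(\<lambda>\<omega>. exp (a * B i t \<omega>)) \<in> borel_measurable M" using B_measurable[OF i t] by simp
    have "integrable M (\<lambda>\<omega>. exp (a * B i t \<omega>))"
      by (rule Bochner_Integration.integrable_cong_AE_imp[OF _ m e]) simp
    moreover have "expectation (\<lambda>\<omega>. exp (a * B i t \<omega>)) = expectation (\<lambda>_. 1)"
      by (rule integral_cong_AE) (use m e in auto)
    ultimately show ?thesis using T_pos by (simp add: prob_space)
  next
    case False
    then have t0: "0 < t" "t \<le> T" using t by auto
    have D: "distributed M lborel (\<lambda>\<omega>. B i t \<omega> - B i 0 \<omega>) (normal_density 0 (sqrt t))"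
      using B_increment_normal[OF i _ t0] by simp
    have s: "0 < sqrt t" using t0 by simp
    note N = normal_exp_moment[OF D s, of a]
    have m: "(\<lambda>\<omega>. exp (a * B i t \<omega>)) \<in> borel_measurable M" using B_measurable[OF i t] by simp
    have m0: "(\<lambda>\<omega>. exp (a * (B i t \<omega> - B i 0 \<omega>))) \<in> borel_measurable M" using N(1) by auto
    have e: "AE \<omega> in M. exp (a * (B i t \<omega> - B i 0 \<omega>)) = exp (a * B i t \<omega>)" using B0 by eventually_elim simp
    have "integrable M (\<lambda>\<omega>. exp (a * B i t \<omega>))"
      by (rule Bochner_Integration.integrable_cong_AE_imp[OF N(1) m e])
    moreover have "expectation (\<lambda>\<omega>. exp (a * B i t \<omega>)) = exp (a\<^sup>2 * t / 2)"
      using integral_cong_AE[OF m0 m e] N(2) t0 by simp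
    moreover have "a\<^sup>2 * t / 2 \<le> a\<^sup>2 * T"
    proof -
      have "a\<^sup>2 * t \<le> a\<^sup>2 * T" using t0 by (intro mult_left_mono) auto
      moreover have "0 \<le> a\<^sup>2 * T" using T_pos by simp
      ultimately show ?thesis by linarith
    qed
    ultimately show ?thesis by simp
  qed
  then show "integrable M (\<lambda>\<omega>. exp (a * B i t \<omega>))" "expectation (\<lambda>\<omega>. exp (a * B i t \<omega>)) \<le> exp (a\<^sup>2 * T)"
    by auto
qed

text \<open>By Jensen, the exponential of a Riemann sum is at most the average of the exponentials of its
  terms rescaled by their number.\<close>

lemma exp_integral_moment:
  fixes p :: "nat \<Rightarrow> real poly"
  defines "R \<equiv> \<lambda>n \<omega>. \<Sum>i\<in>{1..d}. rsum (\<lambda>r. poly (p i) r * B i r \<omega>) T n"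
  shows "\<exists>C. \<forall>n. integrable M (\<lambda>\<omega>. exp (a * R n \<omega>)) \<and> expectation (\<lambda>\<omega>. exp (a * R n \<omega>)) \<le> C"
proof -
  obtain K where K: "0 \<le> K" "\<And>i s. i \<in> {1..d} \<Longrightarrow> s \<in> {0..T} \<Longrightarrow> \<bar>poly (p i) s\<bar> \<le> K"
    using polys_bound_Lipschitz[OF less_imp_le[OF T_pos], of "{1..d}" p] by auto
  define A where "A = \<bar>a\<bar> * (real d * T) * K"
  show ?thesis
  proof (intro exI[where x="exp (A\<^sup>2 * T)"] allI)
    fix n :: nat
    define J where "J = {1..d} \<times> {..<n}"
    \<comment> \<open>Scaled so that \<open>a * R n\<close> is the plain average of the
      \<open>Y j\<close>: the step \<open>T / n\<close> equals \<open>d * T\<close> divided by the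
      number \<open>d * n\<close> of indices.\<close>
    define c where "c j = a * (real d * T) * poly (p (fst j)) (T * real (snd j) / real n)" for j :: "nat \<times> nat"
    define Y where "Y j \<omega> = c j * B (fst j) (T * real (snd j) / real n) \<omega>" for j \<omega>
    have t: "T * real (snd j) / real n \<in> {0..T}" if "j \<in> J" for j
      using that T_pos by (intro partition_mem) (auto simp: J_def)
    have cA: "(c j)\<^sup>2 \<le> A\<^sup>2" if "j \<in> J" for j
    proof -
      have "\<bar>c j\<bar> \<le> A"
        unfolding c_def A_def abs_mult using K(2)[OF _ t[OF that]] that T_pos
        by (intro mult_mono) (auto simp: J_def)
      from power_mono[OF this, of 2] show ?thesis by simp
    qed
    have EY: "integrable M (\<lambda>\<omega>. exp (Y j \<omega>))" "expectation (\<lambda>\<omega>. exp (Y j \<omega>)) \<le> exp (A\<^sup>2 * T)" if j: "j \<in> J" for j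
    proof -
      have i: "fst j \<in> {1..d}" using j by (auto simp: J_def)
      show "integrable M (\<lambda>\<omega>. exp (Y j \<omega>))" unfolding Y_def by (rule B_exp_moment(1)[OF i t[OF j]])
      have "expectation (\<lambda>\<omega>. exp (Y j \<omega>)) \<le> exp ((c j)\<^sup>2 * T)" unfolding Y_def by (rule B_exp_moment(2)[OF i t[OF j]])
      also have "\<dots> \<le> exp (A\<^sup>2 * T)" using cA[OF j] T_pos by simp
      finally show "expectation (\<lambda>\<omega>. exp (Y j \<omega>)) \<le> exp (A\<^sup>2 * T)" .
    qed
    show "integrable M (\<lambda>\<omega>. exp (a * R n \<omega>)) \<and> expectation (\<lambda>\<omega>. exp (a * R n \<omega>)) \<le> exp (A\<^sup>2 * T)"
    proof (cases "J = {}")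
      case True
      then have "R n \<omega> = 0" for \<omega> unfolding R_def rsum_def J_def by auto
      then show ?thesis using T_pos by (simp add: prob_space)
    next
      case False
      then have dn: "0 < d" "0 < n" and N0: "0 < real (card J)" by (auto simp: J_def)
      have fin: "finite J" by (simp add: J_def)
      have aR: "a * R n \<omega> = (\<Sum>j\<in>J. (1 / real (card J)) * Y j \<omega>)" for \<omega>
      proof -
        have "(\<Sum>j\<in>J. (1 / real (card J)) * Y j \<omega>) = (\<Sum>i\<in>{1..d}. \<Sum>k<n. (1 / real (card J)) * Y (i, k) \<omega>)"
          unfolding J_def by (rule sum.cartesian_product')
        also have "\<dots> = (\<Sum>i\<in>{1..d}. \<Sum>k<n. a * (poly (p i) (T * real k / real n) * B i (T * real k / real n) \<omega> * (T / real n)))"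
          using dn by (intro sum.cong refl) (simp add: Y_def c_def J_def)
        also have "\<dots> = a * R n \<omega>" unfolding R_def rsum_def by (simp add: sum_distrib_left)
        finally show ?thesis by simp
      qed
      have Jensen: "exp (a * R n \<omega>) \<le> (\<Sum>j\<in>J. (1 / real (card J)) * exp (Y j \<omega>))" for \<omega>
        unfolding aR
        using convex_on_sum[OF fin False exp_convex, of "\<lambda>_. 1 / real (card J)" "\<lambda>j. Y j \<omega>"] N0
        by simp
      have iS: "integrable M (\<lambda>\<omega>. \<Sum>j\<in>J. (1 / real (card J)) * exp (Y j \<omega>))" using EY(1) by auto
      have Rm: "R n \<in> borel_measurable M"
        unfolding R_def rsum_def using T_pos
        by (intro borel_measurable_sum borel_measurable_times borel_measurable_const B_measurable partition_mem) auto
      have iR: "integrable M (\<lambda>\<omega>. exp (a * R n \<omega>))"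
        by (rule Bochner_Integration.integrable_bound[OF iS]) (use Rm Jensen in \<open>auto intro: order_trans[OF _ abs_ge_self]\<close>)
      have "expectation (\<lambda>\<omega>. exp (a * R n \<omega>)) \<le> expectation (\<lambda>\<omega>. \<Sum>j\<in>J. (1 / real (card J)) * exp (Y j \<omega>))"
        using iR iS Jensen by (rule integral_mono)
      also have "\<dots> = (\<Sum>j\<in>J. (1 / real (card J)) * expectation (\<lambda>\<omega>. exp (Y j \<omega>)))" using EY(1) by simp
      also have "\<dots> \<le> (\<Sum>j\<in>J. (1 / real (card J)) * exp (A\<^sup>2 * T))" using EY(2) by (intro sum_mono mult_left_mono) auto
      also have "\<dots> = exp (A\<^sup>2 * T)" using N0 by simp
      finally show ?thesis using iR by simp
    qed
  qed
qed

text \<open>The boundary terms vanish at \<open>T\<close>, so \<open>Xproc\<close> is minus the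
  limit of Riemann sums whose exponential moments are uniformly bounded. \<open>L2_Fatou\<close>
  concerns squares, which explains the halved exponents.\<close>

lemma Xproc_exp_integrable:
  assumes \<phi>: "\<And>i. i \<in> {1..d} \<Longrightarrow> poly (\<phi> i) T = 0"
  shows "integrable M (\<lambda>\<omega>. exp (a * Xproc \<phi> T \<omega>))"
proof -
  define R where "R n \<omega> = (\<Sum>i\<in>{1..d}. rsum (\<lambda>r. poly (pderiv (\<phi> i)) r * B i r \<omega>) T n)" for n \<omega>
  have T: "T \<in> {0..T}" using T_pos by simp
  have Rm: "R n \<in> borel_measurable M" for n
    unfolding R_def[abs_def] rsum_def using T_pos
    by (intro borel_measurable_sum borel_measurable_times borel_measurable_const B_measurable partition_mem) auto
  have lim: "AE \<omega> in M. (\<lambda>n. exp (- a / 2 * R n \<omega>)) \<longlonglongrightarrow> exp (a / 2 * Xproc \<phi> T \<omega>)"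
    using AE_goodpath
  proof eventually_elim
    case (elim \<omega>)
    have "R n \<omega> = (\<Sum>i\<in>{1..d}. rsum (\<lambda>r. poly (pderiv (\<phi> i)) r * B i r \<omega>) T n)" for n by (simp add: R_def)
    moreover have "(\<lambda>n. \<Sum>i\<in>{1..d}. rsum (\<lambda>r. poly (pderiv (\<phi> i)) r * B i r \<omega>) T n) \<longlonglongrightarrow>
        (\<Sum>i\<in>{1..d}. integral {0..T} (\<lambda>r. poly (pderiv (\<phi> i)) r * B i r \<omega>))"
      using elim T_pos by (intro tendsto_sum rsum_tendsto continuous_on_mult continuous_on_poly continuous_on_id)
        (auto simp: goodpath_def)
    moreover have "Xproc \<phi> T \<omega> = - (\<Sum>i\<in>{1..d}. integral {0..T} (\<lambda>r. poly (pderiv (\<phi> i)) r * B i r \<omega>))"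
      unfolding Xproc_eq_pathint[OF elim T] pathint_def using \<phi> by (simp add: sum_negf)
    ultimately have "(\<lambda>n. R n \<omega>) \<longlonglongrightarrow> - Xproc \<phi> T \<omega>" by simp
    then have "(\<lambda>n. exp (- a / 2 * R n \<omega>)) \<longlonglongrightarrow> exp (- a / 2 * (- Xproc \<phi> T \<omega>))" by (intro tendsto_intros)
    then show ?case by simp
  qed
  obtain C where C: "\<forall>n. integrable M (\<lambda>\<omega>. exp (- a * R n \<omega>)) \<and> expectation (\<lambda>\<omega>. exp (- a * R n \<omega>)) \<le> C"
    using exp_integral_moment[of "- a" "\<lambda>i. pderiv (\<phi> i)"] unfolding R_def by blast
  have sq: "(exp (b / 2 * x))^2 = exp (b * x)" for b x :: real
    by (simp add: power2_eq_square exp_add[symmetric])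
  have "integrable M (\<lambda>\<omega>. (exp (a / 2 * Xproc \<phi> T \<omega>))^2)"
  proof (rule L2_Fatou[OF _ _ lim])
    show "(\<lambda>\<omega>. exp (- a / 2 * R n \<omega>)) \<in> borel_measurable M" for n using Rm[of n] by simp
    show "(\<lambda>\<omega>. exp (a / 2 * Xproc \<phi> T \<omega>)) \<in> borel_measurable M" using Xproc_measurable[OF T, of \<phi>] by simp
    show "integrable M (\<lambda>\<omega>. (exp (- a / 2 * R n \<omega>))^2)" for n using C by (simp only: sq)
    show "expectation (\<lambda>\<omega>. (exp (- a / 2 * R n \<omega>))^2) \<le> C" for n using C by (simp only: sq)
  qed
  then show ?thesis by (simp only: sq)
qed

lemma inH_cos_sin_Xproc:
  assumes "\<And>i. i \<in> {1..d} \<Longrightarrow> poly (\<phi> i) T = 0"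
  shows "inH (\<lambda>\<omega>. cos (Xproc \<phi> T \<omega>))" "inH (\<lambda>\<omega>. sin (Xproc \<phi> T \<omega>))"
  by (rule inH_cos_sin; use Xproc_measurable[of T \<phi>] T_pos inH_Xproc_power Xproc_exp_integrable[OF assms] in simp)+

end

section \<open>Polynomial approximation of Dirac masses\<close>

lemma poly_approximation:
  fixes f :: "real \<Rightarrow> real"
  assumes "continuous_on {a..b} f" "0 < e"
  shows "\<exists>p. \<forall>x\<in>{a..b}. \<bar>f x - poly p x\<bar> < e"
proof -
  obtain g where g: "real_polynomial_function g" "\<And>x. x \<in> {a..b} \<Longrightarrow> \<bar>f x - g x\<bar> < e"
    using Stone_Weierstrass_real_polynomial_function[OF compact_Icc assms] by blast
  obtain c n where c: "g = (\<lambda>x. \<Sum>i\<le>n. c i * x ^ i)"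
    using g(1) unfolding real_polynomial_function_iff_sum by (elim exE)
  have "poly (\<Sum>i\<le>n. monom (c i) i) x = g x" for x
    by (simp add: c poly_sum poly_monom)
  then show ?thesis using g(2) by (intro exI[where x="\<Sum>i\<le>n. monom (c i) i"]) simp
qed

lemma poly_antiderivative: "\<exists>p. pderiv p = (q :: real poly) \<and> poly p T = 0"
proof -
  have pderiv_sum: "pderiv (\<Sum>i\<in>A. f i) = (\<Sum>i\<in>A. pderiv (f i))" for A and f :: "nat \<Rightarrow> real poly"
    by (induction A rule: infinite_finite_induct) (auto simp: pderiv_add)
  have "\<exists>p. pderiv p = q"
  proof -
    let ?p = "\<Sum>i\<le>degree q. monom (coeff q i / real (Suc i)) (Suc i)"
    have "pderiv ?p = (\<Sum>i\<le>degree q. monom (coeff q i) i)"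
      by (simp add: pderiv_sum pderiv_monom del: of_nat_Suc)
    also have "\<dots> = q" by (rule poly_as_sum_of_monoms)
    finally show ?thesis by blast
  qed
  then obtain p where p: "pderiv p = q" by blast
  show ?thesis
    by (rule exI[where x="p - [:poly p T:]"]) (simp add: p pderiv_diff pderiv_pCons)
qed

text \<open>Weierstrass approximations of normalized tent functions at \<open>t\<close>.\<close>

lemma poly_Dirac:
  assumes T: "0 < T" and t: "t \<in> {0..T}"
  shows "\<exists>q :: nat \<Rightarrow> real poly. \<forall>b :: real \<Rightarrow> real. continuous_on {0..T} b \<longrightarrow> (\<lambda>n. integral {0..T} (\<lambda>s. poly (q n) s * b s)) \<longlonglongrightarrow> b t"
proof -
  define tent where "tent n s = max 0 (1 - real (Suc n) * \<bar>s - t\<bar>)" for n s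
  have tc: "continuous_on A (tent n)" for A n unfolding tent_def by (intro continuous_intros)
  \<comment> \<open>Part of the tent may lie outside \<open>[0, T]\<close>, so it is normalised by
    its actual integral. This is positive because a nonnegative continuous function with integral 0
    vanishes.\<close>
  define c where "c n = integral {0..T} (tent n)" for n
  have c0: "0 < c n" for n
  proof -
    have nn: "0 \<le> c n" unfolding c_def
      by (rule Henstock_Kurzweil_Integration.integral_nonneg[OF integrable_continuous_interval[OF tc]]) (simp add: tent_def)
    have "c n \<noteq> 0"
    proof
      assume "c n = 0"
      then have h: "(tent n has_integral 0) (cbox 0 T)"
        using integrable_integral[OF integrable_continuous_interval[OF tc[of "{0..T}" n]]] by (simp add: c_def)
      have "tent n t = 0"
        by (rule has_integral_0_cbox_imp_0[OF _ _ h]) (use t T tc in \<open>auto simp: tent_def\<close>)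
      then show False by (simp add: tent_def)
    qed
    with nn show ?thesis by simp
  qed
  define \<psi> where "\<psi> n s = tent n s / c n" for n s
  have \<psi>c: "continuous_on A (\<psi> n)" for A n
    unfolding \<psi>_def using c0[of n] by (intro continuous_on_divide tc continuous_on_const) auto
  have \<psi>1: "integral {0..T} (\<psi> n) = 1" for n
    unfolding \<psi>_def using c0[of n] by (simp add: c_def[symmetric])
  have \<psi>0: "0 \<le> \<psi> n s" for n s unfolding \<psi>_def tent_def using c0[of n] by (intro divide_nonneg_pos) auto
  have \<psi>s: "\<psi> n s = 0" if "1 / real (Suc n) \<le> \<bar>s - t\<bar>" for n s
    using that unfolding \<psi>_def tent_def by (simp add: field_simps)
  have "\<forall>n. \<exists>p. \<forall>s\<in>{0..T}. \<bar>\<psi> n s - poly p s\<bar> < 1 / real (Suc n)"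
    using poly_approximation[OF \<psi>c] by simp
  from choice[OF this] obtain q where q: "\<forall>n. \<forall>s\<in>{0..T}. \<bar>\<psi> n s - poly (q n) s\<bar> < 1 / real (Suc n)" ..
  \<comment> \<open>\<open>q\<close> is fixed before \<open>b\<close>: a single deterministic
    sequence has to serve all Brownian paths.\<close>
  show ?thesis
  proof (intro exI[where x=q] allI impI)
    fix b :: "real \<Rightarrow> real" assume b: "continuous_on {0..T} b"
    have "bounded (b ` {0..T})" by (intro compact_imp_bounded compact_continuous_image b) simp
    then obtain R where R: "\<forall>y\<in>b ` {0..T}. \<bar>y\<bar> \<le> R" unfolding bounded_iff real_norm_def by blast
    have R0: "0 \<le> R" using R t by force
    show "(\<lambda>n. integral {0..T} (\<lambda>s. poly (q n) s * b s)) \<longlonglongrightarrow> b t"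
    proof (rule LIMSEQ_I)
      fix e :: real assume e: "0 < e"
      have "0 < e / 2" using e by simp
      moreover have "continuous (at t within {0..T}) b" using b t by (simp add: continuous_on_eq_continuous_within)
      ultimately obtain \<delta> where \<delta>: "0 < \<delta>" "\<And>s. s \<in> {0..T} \<Longrightarrow> dist s t < \<delta> \<Longrightarrow> dist (b s) (b t) < e / 2"
        unfolding continuous_within_eps_delta by blast
      obtain N1 where N1: "1 / \<delta> < real N1" using reals_Archimedean2 by blast
      obtain N2 where N2: "2 * R * T / e < real N2" using reals_Archimedean2 by blast
      have "norm (integral {0..T} (\<lambda>s. poly (q n) s * b s) - b t) < e" if n: "n \<ge> N1 + N2" for n
      proof -
        have "1 < \<delta> * real N1" using N1 \<delta>(1) by (simp add: field_simps)
        also have "\<dots> \<le> \<delta> * real (Suc n)" using n \<delta>(1) by (intro mult_left_mono) auto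
        finally have n\<delta>: "1 / real (Suc n) < \<delta>" by (simp add: field_simps)
        have "2 * R * T < e * real N2" using N2 e by (simp add: field_simps)
        also have "\<dots> \<le> e * real (Suc n)" using n e by (intro mult_left_mono) auto
        finally have ne: "R * T / real (Suc n) < e / 2" by (simp add: field_simps)
        have pc: "continuous_on {0..T} (poly (q n))" by (rule continuous_on_poly[OF continuous_on_id])
        have i1: "(\<lambda>s. (poly (q n) s - \<psi> n s) * b s) integrable_on {0..T}"
          by (intro integrable_continuous_interval continuous_on_mult continuous_on_diff pc \<psi>c b)
        have i2: "(\<lambda>s. \<psi> n s * (b s - b t)) integrable_on {0..T}"
          by (intro integrable_continuous_interval continuous_on_mult continuous_on_diff \<psi>c b continuous_on_const)
        have i3: "(\<lambda>s. \<psi> n s * b t) integrable_on {0..T}"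
          by (intro integrable_continuous_interval continuous_on_mult \<psi>c continuous_on_const)
        have "integral {0..T} (\<lambda>s. poly (q n) s * b s)
            = integral {0..T} (\<lambda>s. ((poly (q n) s - \<psi> n s) * b s + \<psi> n s * (b s - b t)) + \<psi> n s * b t)"
          by (simp add: algebra_simps)
        \<comment> \<open>Three contributions: the uniform polynomial error, of order
          \<open>1 / Suc n\<close>; the oscillation of \<open>b\<close> near \<open>t\<close>; and
          the mass 1, which returns \<open>b t\<close>.\<close>
        also have "\<dots> = integral {0..T} (\<lambda>s. (poly (q n) s - \<psi> n s) * b s) + integral {0..T} (\<lambda>s. \<psi> n s * (b s - b t))
            + integral {0..T} (\<lambda>s. \<psi> n s * b t)"
          by (simp only: Henstock_Kurzweil_Integration.integral_add[OF i1 i2]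
              Henstock_Kurzweil_Integration.integral_add[OF integrable_add[OF i1 i2] i3])
        also have "integral {0..T} (\<lambda>s. \<psi> n s * b t) = b t" by (simp add: \<psi>1)
        finally have eq: "integral {0..T} (\<lambda>s. poly (q n) s * b s) - b t
            = integral {0..T} (\<lambda>s. (poly (q n) s - \<psi> n s) * b s) + integral {0..T} (\<lambda>s. \<psi> n s * (b s - b t))" by simp
        have e1: "norm (integral {0..T} (\<lambda>s. (poly (q n) s - \<psi> n s) * b s)) \<le> (1 / real (Suc n) * R) * (T - 0)"
        proof (rule integral_bound)
          show "continuous_on {0..T} (\<lambda>s. (poly (q n) s - \<psi> n s) * b s)"
            by (intro continuous_on_mult continuous_on_diff pc \<psi>c b)
          fix s assume s: "s \<in> {0..T}"
          have "\<bar>poly (q n) s - \<psi> n s\<bar> \<le> 1 / real (Suc n)" using q[rule_format, OF s, of n] by linarith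
          moreover have "\<bar>b s\<bar> \<le> R" using R s by blast
          ultimately show "norm ((poly (q n) s - \<psi> n s) * b s) \<le> 1 / real (Suc n) * R"
            unfolding real_norm_def abs_mult by (intro mult_mono) auto
        qed (use T in simp)
        have e2: "norm (integral {0..T} (\<lambda>s. \<psi> n s * (b s - b t))) \<le> integral {0..T} (\<lambda>s. \<psi> n s * (e / 2))"
        proof (rule integral_norm_bound_integral[OF i2])
          show "(\<lambda>s. \<psi> n s * (e / 2)) integrable_on {0..T}"
            by (intro integrable_continuous_interval continuous_on_mult \<psi>c continuous_on_const)
          fix s assume s: "s \<in> {0..T}"
          show "norm (\<psi> n s * (b s - b t)) \<le> \<psi> n s * (e / 2)"
          proof (cases "1 / real (Suc n) \<le> \<bar>s - t\<bar>")
            case True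
            then show ?thesis using \<psi>s by simp
          next
            case False
            then have "dist s t < \<delta>" using n\<delta> by (simp add: dist_real_def)
            then have "\<bar>b s - b t\<bar> \<le> e / 2" using \<delta>(2)[OF s] by (simp add: dist_real_def)
            then show ?thesis unfolding real_norm_def abs_mult using \<psi>0[of n s] by (intro mult_mono) auto
          qed
        qed
        have e3: "integral {0..T} (\<lambda>s. \<psi> n s * (e / 2)) = e / 2" using \<psi>1[of n] by (simp only: Henstock_Kurzweil_Integration.integral_mult_left)
        have "(1 / real (Suc n) * R) * (T - 0) = R * T / real (Suc n)" by simp
        then show ?thesis unfolding eq using e1 e2 e3 ne norm_triangle_ineq[of "integral {0..T} (\<lambda>s. (poly (q n) s - \<psi> n s) * b s)"
              "integral {0..T} (\<lambda>s. \<psi> n s * (b s - b t))"] by linarith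
      qed
      then show "\<exists>N. \<forall>n\<ge>N. norm (integral {0..T} (\<lambda>s. poly (q n) s * b s) - b t) < e" by blast
    qed
  qed
qed

section \<open>Trigonometric functions of finitely many values of the Brownian motion\<close>

context brownian_signature
begin

definition lincomb :: "(nat \<times> real) set \<Rightarrow> (nat \<times> real \<Rightarrow> real) \<Rightarrow> 'a \<Rightarrow> real" where
  "lincomb E c \<omega> = (\<Sum>x\<in>E. c x * B (fst x) (snd x) \<omega>)"

definition lin :: "('a \<Rightarrow> real) \<Rightarrow> bool" where
  "lin Y \<longleftrightarrow> (\<exists>E c. finite E \<and> E \<subseteq> {1..d} \<times> {0..T} \<and> Y = lincomb E c)"

lemma lin_add:
  assumes "lin X" "lin Y"
  shows "lin (\<lambda>\<omega>. a * X \<omega> + b * Y \<omega>)"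
proof -
  obtain E c where E: "finite E" "E \<subseteq> {1..d} \<times> {0..T}" "X = lincomb E c"
    using assms(1) unfolding lin_def by (elim exE conjE)
  obtain E' c' where E': "finite E'" "E' \<subseteq> {1..d} \<times> {0..T}" "Y = lincomb E' c'"
    using assms(2) unfolding lin_def by (elim exE conjE)
  define k where "k x = a * (if x \<in> E then c x else 0) + b * (if x \<in> E' then c' x else 0)" for x
  have "a * X \<omega> + b * Y \<omega> = lincomb (E \<union> E') k \<omega>" for \<omega>
  proof -
    have "(\<Sum>x\<in>E. c x * B (fst x) (snd x) \<omega>) = (\<Sum>x\<in>E \<union> E'. (if x \<in> E then c x else 0) * B (fst x) (snd x) \<omega>)"
      using E E' by (intro sum.mono_neutral_cong_left) auto
    moreover have "(\<Sum>x\<in>E'. c' x * B (fst x) (snd x) \<omega>) = (\<Sum>x\<in>E \<union> E'. (if x \<in> E' then c' x else 0) * B (fst x) (snd x) \<omega>)"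
      using E E' by (intro sum.mono_neutral_cong_left) auto
    ultimately show ?thesis unfolding E(3) E'(3) lincomb_def k_def
      by (simp only: sum_distrib_left sum.distrib[symmetric] distrib_right mult.assoc)
  qed
  then have "(\<lambda>\<omega>. a * X \<omega> + b * Y \<omega>) = lincomb (E \<union> E') k" by (rule ext)
  then show ?thesis unfolding lin_def using E E' by (intro exI[where x="E \<union> E'"] exI[where x=k]) auto
qed

lemma lin_B: "i \<in> {1..d} \<Longrightarrow> t \<in> {0..T} \<Longrightarrow> lin (\<lambda>\<omega>. a * B i t \<omega>)"
  unfolding lin_def
  by (rule exI[where x="{(i, t)}"], rule exI[where x="\<lambda>_. a"]) (auto simp: lincomb_def fun_eq_iff)

lemma inH_cos_sin_lin:
  assumes "lin Y"
  shows "inH (\<lambda>\<omega>. cos (Y \<omega>))" "inH (\<lambda>\<omega>. sin (Y \<omega>))"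
proof -
  obtain E c where E: "finite E" "E \<subseteq> {1..d} \<times> {0..T}" "Y = lincomb E c"
    using assms unfolding lin_def by (elim exE conjE)
  have T: "T \<in> {0..T}" using T_pos by simp
  have "\<forall>x. \<exists>q :: nat \<Rightarrow> real poly. x \<in> E \<longrightarrow> (\<forall>b :: real \<Rightarrow> real. continuous_on {0..T} b \<longrightarrow>
      (\<lambda>n. integral {0..T} (\<lambda>s. poly (q n) s * b s)) \<longlonglongrightarrow> b (snd x))" (is "\<forall>x. \<exists>q. ?P x q")
  proof
    fix x show "\<exists>q. ?P x q"
    proof (cases "x \<in> E")
      case True
      then have "snd x \<in> {0..T}" using E by auto
      from poly_Dirac[OF T_pos this] True show ?thesis by simp
    qed simp
  qed
  from choice[OF this] obtain q where q: "\<forall>x. ?P x (q x)" ..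
  \<comment> \<open>The sign compensates the one in \<open>Xproc\<close>, which is minus the
    integral of the derivative against \<open>B\<close> when the boundary term vanishes. The
    polynomial for coordinate \<open>i\<close> gathers all points of \<open>E\<close> in that
    coordinate.\<close>
  have "\<forall>ni. \<exists>p. pderiv p = - (\<Sum>x\<in>{x\<in>E. fst x = snd ni}. smult (c x) (q x (fst ni))) \<and> poly p T = 0"
    using poly_antiderivative by blast
  from choice[OF this] obtain p where
    p: "\<forall>ni. pderiv (p ni) = - (\<Sum>x\<in>{x\<in>E. fst x = snd ni}. smult (c x) (q x (fst ni))) \<and> poly (p ni) T = 0" ..
  define \<phi> where "\<phi> n i = p (n, i)" for n i
  have \<phi>: "pderiv (\<phi> n i) = - (\<Sum>x\<in>{x\<in>E. fst x = i}. smult (c x) (q x n))" "poly (\<phi> n i) T = 0" for n i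
    using p[rule_format, of "(n, i)"] by (simp_all add: \<phi>_def)
  have lim: "AE \<omega> in M. (\<lambda>n. Xproc (\<phi> n) T \<omega>) \<longlonglongrightarrow> Y \<omega>"
    using AE_goodpath
  proof eventually_elim
    case (elim \<omega>)
    have cont: "continuous_on {0..T} (\<lambda>s. B (fst x) s \<omega>)" if "x \<in> E" for x
      using elim E that by (auto simp: goodpath_def)
    have X: "Xproc (\<phi> n) T \<omega> = (\<Sum>x\<in>E. c x * integral {0..T} (\<lambda>s. poly (q x n) s * B (fst x) s \<omega>))" for n
    proof -
      have "Xproc (\<phi> n) T \<omega> = (\<Sum>i\<in>{1..d}. - integral {0..T} (\<lambda>r. poly (pderiv (\<phi> n i)) r * B i r \<omega>))"
        unfolding Xproc_eq_pathint[OF elim T] pathint_def by (simp add: \<phi>(2))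
      also have "\<dots> = (\<Sum>i\<in>{1..d}. \<Sum>x\<in>{x\<in>E. fst x = i}. c x * integral {0..T} (\<lambda>s. poly (q x n) s * B (fst x) s \<omega>))"
      proof (rule sum.cong[OF refl])
        fix i assume "i \<in> {1..d}"
        have "poly (pderiv (\<phi> n i)) r * B i r \<omega> = - (\<Sum>x\<in>{x\<in>E. fst x = i}. c x * (poly (q x n) r * B (fst x) r \<omega>))" for r
          unfolding \<phi>(1) by (simp add: poly_sum sum_distrib_right mult.assoc)
        then have "- integral {0..T} (\<lambda>r. poly (pderiv (\<phi> n i)) r * B i r \<omega>)
            = integral {0..T} (\<lambda>r. \<Sum>x\<in>{x\<in>E. fst x = i}. c x * (poly (q x n) r * B (fst x) r \<omega>))"
          by simp
        also have "\<dots> = (\<Sum>x\<in>{x\<in>E. fst x = i}. integral {0..T} (\<lambda>r. c x * (poly (q x n) r * B (fst x) r \<omega>)))"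
          by (rule Henstock_Kurzweil_Integration.integral_sum)
            (use E cont in \<open>auto intro!: integrable_continuous_interval continuous_on_mult continuous_on_const continuous_on_poly continuous_on_id\<close>)
        also have "\<dots> = (\<Sum>x\<in>{x\<in>E. fst x = i}. c x * integral {0..T} (\<lambda>s. poly (q x n) s * B (fst x) s \<omega>))"
          by simp
        finally show "- integral {0..T} (\<lambda>r. poly (pderiv (\<phi> n i)) r * B i r \<omega>)
            = (\<Sum>x\<in>{x\<in>E. fst x = i}. c x * integral {0..T} (\<lambda>s. poly (q x n) s * B (fst x) s \<omega>))" .
      qed
      also have "\<dots> = (\<Sum>x\<in>E. c x * integral {0..T} (\<lambda>s. poly (q x n) s * B (fst x) s \<omega>))"
        by (rule sum.group) (use E in auto)
      finally show ?thesis .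
    qed
    have "(\<lambda>n. integral {0..T} (\<lambda>s. poly (q x n) s * B (fst x) s \<omega>)) \<longlonglongrightarrow> B (fst x) (snd x) \<omega>" if "x \<in> E" for x
      using q[rule_format, OF that cont[OF that]] .
    then show ?case unfolding X E(3) lincomb_def by (intro tendsto_sum tendsto_mult tendsto_const)
  qed
  have Ym: "Y \<in> borel_measurable M"
    unfolding E(3) lincomb_def[abs_def] using E(2)
    by (intro borel_measurable_sum borel_measurable_times borel_measurable_const B_measurable) auto
  show "inH (\<lambda>\<omega>. cos (Y \<omega>))"
  proof (rule inH_dominated[where F="\<lambda>n \<omega>. cos (Xproc (\<phi> n) T \<omega>)" and w="\<lambda>_. 1"])
    show "inH (\<lambda>\<omega>. cos (Xproc (\<phi> n) T \<omega>))" for n by (rule inH_cos_sin_Xproc(1)) (simp add: \<phi>)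
    show "AE \<omega> in M. (\<lambda>n. cos (Xproc (\<phi> n) T \<omega>)) \<longlonglongrightarrow> cos (Y \<omega>)"
      using lim by eventually_elim (rule tendsto_cos)
  qed (use Ym in auto)
  show "inH (\<lambda>\<omega>. sin (Y \<omega>))"
  proof (rule inH_dominated[where F="\<lambda>n \<omega>. sin (Xproc (\<phi> n) T \<omega>)" and w="\<lambda>_. 1"])
    show "inH (\<lambda>\<omega>. sin (Xproc (\<phi> n) T \<omega>))" for n by (rule inH_cos_sin_Xproc(2)) (simp add: \<phi>)
    show "AE \<omega> in M. (\<lambda>n. sin (Xproc (\<phi> n) T \<omega>)) \<longlonglongrightarrow> sin (Y \<omega>)"
      using lim by eventually_elim (rule tendsto_sin)
  qed (use Ym in auto)
qed

text \<open>A linear span by definition and an algebra by the product-to-sum formulas. Its members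
  lie in the closed span, although products of members of the latter need not.\<close>

inductive trig :: "('a \<Rightarrow> real) \<Rightarrow> bool" where
  cos: "lin Y \<Longrightarrow> trig (\<lambda>\<omega>. cos (Y \<omega>))"
| sin: "lin Y \<Longrightarrow> trig (\<lambda>\<omega>. sin (Y \<omega>))"
| comb: "trig f \<Longrightarrow> trig g \<Longrightarrow> trig (\<lambda>\<omega>. a * f \<omega> + b * g \<omega>)"

lemma trig_inH: "trig f \<Longrightarrow> inH f"
  by (induction rule: trig.induct) (auto intro: inH_cos_sin_lin inH_combination)

lemma trig_const: "trig (\<lambda>_. c)"
proof -
  have "lin (\<lambda>_. 0)" unfolding lin_def
    by (rule exI[where x="{}"], rule exI[where x="\<lambda>_. 0"]) (auto simp: lincomb_def fun_eq_iff)
  from trig.comb[OF trig.cos[OF this] trig.cos[OF this], of c 0] show ?thesis by simp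
qed

lemma trig_mult_cos_sin:
  assumes "trig f" "lin X"
  shows "trig (\<lambda>\<omega>. cos (X \<omega>) * f \<omega>) \<and> trig (\<lambda>\<omega>. sin (X \<omega>) * f \<omega>)"
  using assms(1)
proof (induction rule: trig.induct)
  case (cos Y)
  have m: "lin (\<lambda>\<omega>. X \<omega> - Y \<omega>)" and p: "lin (\<lambda>\<omega>. X \<omega> + Y \<omega>)"
    using lin_add[OF assms(2) cos, of 1 "- 1"] lin_add[OF assms(2) cos, of 1 1] by simp_all
  show ?case
    using trig.comb[OF trig.cos[OF m] trig.cos[OF p], of "1 / 2" "1 / 2"] trig.comb[OF trig.sin[OF p] trig.sin[OF m], of "1 / 2" "1 / 2"]
    by (simp add: cos_times_cos sin_times_cos add_divide_distrib)
next
  case (sin Y)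
  have m: "lin (\<lambda>\<omega>. X \<omega> - Y \<omega>)" and p: "lin (\<lambda>\<omega>. X \<omega> + Y \<omega>)"
    using lin_add[OF assms(2) sin, of 1 "- 1"] lin_add[OF assms(2) sin, of 1 1] by simp_all
  show ?case
    using trig.comb[OF trig.cos[OF m] trig.cos[OF p], of "1 / 2" "- 1 / 2"] trig.comb[OF trig.sin[OF p] trig.sin[OF m], of "1 / 2" "- 1 / 2"]
    by (simp add: sin_times_sin cos_times_sin diff_divide_distrib)
next
  case (comb f g a b)
  have e: "z * (a * f \<omega> + b * g \<omega>) = a * (z * f \<omega>) + b * (z * g \<omega>)" for z \<omega> by (simp add: algebra_simps)
  show ?case unfolding e using comb by (intro conjI trig.comb) auto
qed

lemma trig_mult: "trig f \<Longrightarrow> trig g \<Longrightarrow> trig (\<lambda>\<omega>. f \<omega> * g \<omega>)"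
proof (induction rule: trig.induct)
  case (comb f f' a b)
  have e: "(a * f \<omega> + b * f' \<omega>) * g \<omega> = a * (f \<omega> * g \<omega>) + b * (f' \<omega> * g \<omega>)" for \<omega> by (simp add: algebra_simps)
  show ?case unfolding e using comb by (intro trig.comb) auto
qed (use trig_mult_cos_sin in auto)

lemma trig_poly: "trig f \<Longrightarrow> trig (\<lambda>\<omega>. poly p (f \<omega>))"
proof (induction p)
  case (pCons a p)
  then have "trig (\<lambda>\<omega>. 1 * a + 1 * (f \<omega> * poly p (f \<omega>)))"
    by (intro trig.comb trig_const trig_mult) auto
  then show ?case by simp
qed (simp add: trig_const)

lemma trig_prod: "(\<And>x. x \<in> A \<Longrightarrow> trig (f x)) \<Longrightarrow> trig (\<lambda>\<omega>. \<Prod>x\<in>A. f x \<omega>)"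
  by (induction A rule: infinite_finite_induct) (auto intro: trig_const trig_mult)

end

text \<open>Ramps of slope \<open>n\<close> that vanish up to \<open>a\<close> converge to the
  indicator of the open half-line, and Weierstrass replaces them by polynomials within
  \<open>1 / Suc n\<close>. Composed with an element of the algebra with values in
  \<open>[-1, 1]\<close>, these stay in the algebra and remain bounded.\<close>

lemma bounded_poly_step:
  "\<exists>P :: nat \<Rightarrow> real poly. \<forall>x\<in>{-1..1}. (\<forall>n. \<bar>poly (P n) x\<bar> \<le> 2) \<and> (\<lambda>n. poly (P n) x) \<longlonglongrightarrow> of_bool (a < x)"
proof -
  define h where "h n x = min 1 (max 0 (real n * (x - a)))" for n and x :: real
  have "\<forall>n. \<exists>p. \<forall>x\<in>{-1..1}. \<bar>h n x - poly p x\<bar> < 1 / real (Suc n)"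
    unfolding h_def by (intro allI poly_approximation continuous_intros) simp
  from choice[OF this] obtain P where P: "\<forall>n. \<forall>x\<in>{-1..1}. \<bar>h n x - poly (P n) x\<bar> < 1 / real (Suc n)" ..
  show ?thesis
  proof (intro exI[where x=P] ballI conjI allI)
    fix x :: real assume x: "x \<in> {-1..1}"
    have b: "\<bar>h n x - poly (P n) x\<bar> < 1 / real (Suc n)" for n using P x by blast
    show "\<bar>poly (P n) x\<bar> \<le> 2" for n
    proof -
      have "1 / real (Suc n) \<le> 1" by simp
      moreover have "0 \<le> h n x" "h n x \<le> 1" by (auto simp: h_def)
      ultimately show ?thesis using b[of n] by linarith
    qed
    have "(\<lambda>n. h n x - poly (P n) x) \<longlonglongrightarrow> 0"
    proof (rule tendsto_rabs_zero_cancel, rule tendsto_sandwich[OF _ _ tendsto_const])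
      show "\<forall>\<^sub>F n in sequentially. \<bar>h n x - poly (P n) x\<bar> \<le> 1 / real (Suc n)"
        using b by (intro always_eventually allI less_imp_le)
      show "(\<lambda>n. 1 / real (Suc n)) \<longlonglongrightarrow> 0" by (rule LIMSEQ_Suc[OF lim_1_over_n])
    qed simp
    moreover have "(\<lambda>n. h n x) \<longlonglongrightarrow> of_bool (a < x)"
    proof (cases "a < x")
      case True
      obtain N where N: "1 / (x - a) < real N" using reals_Archimedean2 by blast
      have "h n x = 1" if "n \<ge> N" for n
      proof -
        have "1 < real N * (x - a)" using N True by (simp add: field_simps)
        also have "\<dots> \<le> real n * (x - a)" using that True by (intro mult_right_mono) auto
        finally show ?thesis by (simp add: h_def)
      qed
      then have "\<forall>\<^sub>F n in sequentially. h n x = 1" by (auto simp: eventually_sequentially)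
      then show ?thesis using True by (simp add: tendsto_eventually)
    next
      case False
      then have "real n * (x - a) \<le> 0" for n by (intro mult_nonneg_nonpos) auto
      then have "h n x = 0" for n by (simp add: h_def)
      then show ?thesis using False by simp
    qed
    ultimately have "(\<lambda>n. h n x - (h n x - poly (P n) x)) \<longlonglongrightarrow> of_bool (a < x) - 0" by (intro tendsto_diff)
    then show "(\<lambda>n. poly (P n) x) \<longlonglongrightarrow> of_bool (a < x)" by simp
  qed
qed

text \<open>This recovers an unbounded coordinate from bounded functions in the algebra.\<close>

lemma sin_rescaled_tendsto: "(\<lambda>n. real (Suc n) * sin (y / real (Suc n))) \<longlonglongrightarrow> y"
proof (cases "y = 0")
  case False
  have "((\<lambda>h::real. sin h / h) \<longlongrightarrow> 1) (at 0)"
    using DERIV_sin[of "0::real"] by (simp add: DERIV_def)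
  moreover have "filterlim (\<lambda>n. y / real (Suc n)) (at 0) sequentially"
  proof (rule filterlim_atI)
    show "(\<lambda>n. y / real (Suc n)) \<longlonglongrightarrow> 0"
      using tendsto_mult_right[OF LIMSEQ_Suc[OF lim_1_over_n], of y] by simp
  qed (use False in auto)
  ultimately have "(\<lambda>n. sin (y / real (Suc n)) / (y / real (Suc n))) \<longlonglongrightarrow> 1"
    by (rule filterlim_compose)
  from tendsto_mult_left[OF this, of y] show ?thesis using False by (simp add: mult.commute del: of_nat_Suc)
qed simp

section \<open>Cylinder sets and the monotone class argument\<close>

context brownian_signature
begin

text \<open>Bounded coordinates with values in \<open>[-1, 1]\<close>, the domain of the polynomial
  steps. The level \<open>a\<close> is carried in the index, so that a finite set of indices encodes
  any finite list of strict inequalities, repeated coordinates included, and intersections of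
  cylinders are unions of index sets.\<close>

definition sinB :: "nat \<times> real \<times> nat \<times> real \<Rightarrow> 'a \<Rightarrow> real" where
  "sinB = (\<lambda>(i, t, n, a) \<omega>. sin (B i t \<omega> / real (Suc n)))"

definition level :: "nat \<times> real \<times> nat \<times> real \<Rightarrow> real" where
  "level = (\<lambda>(i, t, n, a). a)"

definition sinidx :: "(nat \<times> real \<times> nat \<times> real) set" where
  "sinidx = {1..d} \<times> {0..T} \<times> UNIV"

definition cyl :: "(nat \<times> real \<times> nat \<times> real) set \<Rightarrow> 'a set" where
  "cyl J = {\<omega>\<in>space M. \<forall>j\<in>J. level j < sinB j \<omega>}"

definition cyls :: "'a set set" where
  "cyls = {cyl J | J. finite J \<and> J \<subseteq> sinidx}"

lemma sinB_trig: "j \<in> sinidx \<Longrightarrow> trig (sinB j)"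
proof -
  assume "j \<in> sinidx"
  then obtain i t n a where j: "j = (i, t, n, a)" "i \<in> {1..d}" "t \<in> {0..T}" by (auto simp: sinidx_def)
  have "trig (\<lambda>\<omega>. sin (1 / real (Suc n) * B i t \<omega>))" by (intro trig.sin lin_B j)
  then show ?thesis by (simp add: sinB_def j(1))
qed

lemma sinB_measurable: "j \<in> sinidx \<Longrightarrow> sinB j \<in> borel_measurable M"
  using trig_inH[OF sinB_trig] by (simp add: inH_def)

lemma sinB_range: "sinB j \<omega> \<in> {-1..1}"
  by (auto simp: sinB_def split: prod.split)

lemma cyl_sets: "finite J \<Longrightarrow> J \<subseteq> sinidx \<Longrightarrow> cyl J \<in> sets M"
  unfolding cyl_def
proof (rule sets.sets_Collect_finite_All)
  fix j assume "J \<subseteq> sinidx" "j \<in> J"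
  then have [measurable]: "sinB j \<in> borel_measurable M" by (intro sinB_measurable) blast
  show "{\<omega>\<in>space M. level j < sinB j \<omega>} \<in> sets M" by measurable
qed auto

text \<open>The indicator is a product of step functions, hence a limit of products of polynomials
  in elements of the algebra, each factor bounded by 2.\<close>

lemma inH_cyl:
  assumes J: "finite J" "J \<subseteq> sinidx"
  shows "inH (indicator (cyl J))"
proof -
  have "\<forall>j. \<exists>P :: nat \<Rightarrow> real poly. \<forall>x\<in>{-1..1}. (\<forall>n. \<bar>poly (P n) x\<bar> \<le> 2) \<and> (\<lambda>n. poly (P n) x) \<longlonglongrightarrow> of_bool (level j < x)"
    using bounded_poly_step by blast
  from choice[OF this] obtain P :: "_ \<Rightarrow> nat \<Rightarrow> real poly" where
    P: "\<forall>j. \<forall>x\<in>{-1..1}. (\<forall>n. \<bar>poly (P j n) x\<bar> \<le> 2) \<and> (\<lambda>n. poly (P j n) x) \<longlonglongrightarrow> of_bool (level j < x)" ..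
  show ?thesis
  proof (rule inH_dominated[where F="\<lambda>n \<omega>. \<Prod>j\<in>J. poly (P j n) (sinB j \<omega>)" and w="\<lambda>_. 2 ^ card J"])
    show "inH (\<lambda>\<omega>. \<Prod>j\<in>J. poly (P j n) (sinB j \<omega>))" for n
      using J sinB_trig by (intro trig_inH trig_prod trig_poly) auto
    show "AE \<omega> in M. (\<lambda>n. \<Prod>j\<in>J. poly (P j n) (sinB j \<omega>)) \<longlonglongrightarrow> indicator (cyl J) \<omega>"
    proof (rule AE_I2)
      fix \<omega> assume \<omega>: "\<omega> \<in> space M"
      have "(\<lambda>n. \<Prod>j\<in>J. poly (P j n) (sinB j \<omega>)) \<longlonglongrightarrow> (\<Prod>j\<in>J. of_bool (level j < sinB j \<omega>))"
        using P sinB_range by (intro tendsto_prod) blast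
      moreover have "(\<Prod>j\<in>J. of_bool (level j < sinB j \<omega>)) = (indicator (cyl J) \<omega> :: real)"
        using J(1) \<omega> by (auto simp: cyl_def indicator_def intro: prod.neutral)
      ultimately show "(\<lambda>n. \<Prod>j\<in>J. poly (P j n) (sinB j \<omega>)) \<longlonglongrightarrow> indicator (cyl J) \<omega>" by simp
    qed
    show "AE \<omega> in M. \<bar>\<Prod>j\<in>J. poly (P j n) (sinB j \<omega>)\<bar> \<le> 2 ^ card J" for n
    proof (rule AE_I2)
      fix \<omega>
      have "(\<Prod>j\<in>J. \<bar>poly (P j n) (sinB j \<omega>)\<bar>) \<le> (\<Prod>j\<in>J. 2)"
      proof (rule prod_mono)
        fix j
        show "0 \<le> \<bar>poly (P j n) (sinB j \<omega>)\<bar> \<and> \<bar>poly (P j n) (sinB j \<omega>)\<bar> \<le> 2"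
          using bspec[OF spec[OF P, of j] sinB_range[of j \<omega>]] by simp
      qed
      then show "\<bar>\<Prod>j\<in>J. poly (P j n) (sinB j \<omega>)\<bar> \<le> 2 ^ card J" by (simp add: abs_prod)
    qed
  qed (use cyl_sets[OF J] in auto)
qed

text \<open>Dynkin's theorem: cylinders are stable under intersection, and the closed span admits
  complements, as it contains the constant 1 (the empty cylinder condition), and disjoint unions, as
  partial sums of indicators are dominated by 1.\<close>

lemma inH_sigma_cyls: "A \<in> sigma_sets (space M) cyls \<Longrightarrow> A \<in> sets M \<and> inH (indicator A)"
proof -
  have st: "Int_stable cyls"
  proof (rule Int_stableI)
    fix a b assume "a \<in> cyls" "b \<in> cyls"
    then obtain J J' where "a = cyl J" "b = cyl J'" "finite J" "J \<subseteq> sinidx" "finite J'" "J' \<subseteq> sinidx"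
      by (auto simp: cyls_def)
    moreover have "cyl J \<inter> cyl J' = cyl (J \<union> J')" by (auto simp: cyl_def)
    ultimately show "a \<inter> b \<in> cyls" unfolding cyls_def by (intro CollectI exI[where x="J \<union> J'"]) simp
  qed
  have cP: "cyls \<subseteq> Pow (space M)" by (auto simp: cyls_def cyl_def)
  assume "A \<in> sigma_sets (space M) cyls"
  with st cP show ?thesis
  proof (induction rule: sigma_sets_induct_disjoint)
    case (basic A)
    then show ?case using cyl_sets inH_cyl by (auto simp: cyls_def)
  next
    case empty
    have "indicator {} = (\<lambda>_::'a. 0::real)" by (auto simp: fun_eq_iff)
    then show ?case using inH_zero by simp
  next
    case (compl A)
    have "cyl {} = space M" by (simp add: cyl_def)
    then have "inH (indicator (space M))" using inH_cyl[of "{}"] by simp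
    from inH_combination[OF this, of "indicator A" 1 "-1"] compl
    have h: "inH (\<lambda>\<omega>. 1 * indicator (space M) \<omega> + (-1) * indicator A \<omega>)" by blast
    have "inH (indicator (space M - A))"
      by (rule inH_cong_AE[OF h]) (use compl in \<open>auto simp: indicator_def\<close>)
    then show ?case using compl by auto
  next
    case (union A)
    have A: "A i \<in> sets M" "inH (indicator (A i))" for i using union by auto
    have Um: "(\<Union>i. A i) \<in> sets M" using A by auto
    have fin: "(\<Sum>i<n. indicator (A i) \<omega>) = (indicator (\<Union>i<n. A i) \<omega> :: real)" for n \<omega>
      by (rule indicator_UN_disjoint[symmetric]) (use union.hyps in \<open>auto intro: disjoint_family_on_mono\<close>)
    have "inH (indicator (\<Union>i. A i))"
    proof (rule inH_dominated[where F="\<lambda>n \<omega>. \<Sum>i<n. indicator (A i) \<omega>" and w="\<lambda>_. 1"])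
      show "inH (\<lambda>\<omega>. \<Sum>i<n. indicator (A i) \<omega>)" for n by (intro inH_sum A)
      show "AE \<omega> in M. (\<lambda>n. \<Sum>i<n. indicator (A i) \<omega>) \<longlonglongrightarrow> (indicator (\<Union>i. A i) \<omega> :: real)"
        unfolding fin by (intro AE_I2 LIMSEQ_indicator_UN)
      show "AE \<omega> in M. \<bar>\<Sum>i<n. indicator (A i) \<omega> :: real\<bar> \<le> 1" for n unfolding fin by (simp add: indicator_def)
    qed (use Um in auto)
    then show ?case using Um by blast
  qed
qed

text \<open>Each superlevel set of a rescaled sine is a cylinder with one condition, so the sines,
  and with them their limits \<open>B i t\<close>, are measurable for the sigma-algebra generated by
  the cylinders.\<close>

lemma sets_brownian_sigma_subset: "sets (brownian_sigma M d T B) \<subseteq> sigma_sets (space M) cyls"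
proof -
  define N where "N = sigma (space M) cyls"
  have cP: "cyls \<subseteq> Pow (space M)" by (auto simp: cyls_def cyl_def)
  have sN: "sets N = sigma_sets (space M) cyls" "space N = space M"
    unfolding N_def using cP by (simp_all add: sets_measure_of space_measure_of)
  have sinB_N: "(\<lambda>\<omega>. sin (B i t \<omega> / real (Suc n))) \<in> borel_measurable N" if "i \<in> {1..d}" "t \<in> {0..T}" for i t n
    unfolding borel_measurable_iff_greater
  proof
    fix a
    have "cyl {(i, t, n, a)} \<in> cyls" unfolding cyls_def using that by (auto simp: sinidx_def)
    moreover have "cyl {(i, t, n, a)} = {\<omega>\<in>space N. a < sin (B i t \<omega> / real (Suc n))}"
      by (simp add: cyl_def level_def sinB_def sN)
    ultimately show "{\<omega>\<in>space N. a < sin (B i t \<omega> / real (Suc n))} \<in> sets N" by (auto simp: sN)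
  qed
  have B_N: "B i t \<in> borel_measurable N" if "i \<in> {1..d}" "t \<in> {0..T}" for i t
    by (rule borel_measurable_LIMSEQ_real[where u="\<lambda>n \<omega>. real (Suc n) * sin (B i t \<omega> / real (Suc n))"])
      (use sinB_N[OF that] sin_rescaled_tendsto in \<open>auto simp del: of_nat_Suc\<close>)
  let ?G = "{B i t -` A \<inter> space M | i t A. i \<in> {1..d} \<and> t \<in> {0..T} \<and> A \<in> sets borel}"
  have "?G \<subseteq> sets N" using B_N by (auto simp: sN(2)[symmetric] measurable_sets)
  then have "sigma_sets (space N) ?G \<subseteq> sets N" by (rule sets.sigma_sets_subset)
  moreover have "sets (brownian_sigma M d T B) = sigma_sets (space M) ?G"
    unfolding brownian_sigma_def by (rule sets_measure_of) auto
  ultimately show ?thesis by (simp add: sN)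
qed

lemma space_brownian_sigma: "space (brownian_sigma M d T B) = space M"
  unfolding brownian_sigma_def by (rule space_measure_of) auto

lemma inH_brownian_indicator: "A \<in> sets (brownian_sigma M d T B) \<Longrightarrow> A \<in> sets M \<and> inH (indicator A)"
  using sets_brownian_sigma_subset inH_sigma_cyls by blast

text \<open>Pass to a version \<open>g\<close> measurable for the Brownian sigma-algebra and
  approximate it by simple functions dominated by twice \<open>\<bar>g\<bar>\<close>; these are
  combinations of indicators already in the closed span.\<close>

lemma inH_L2_space:
  assumes "f \<in> L2_space M (brownian_sigma M d T B)"
  shows "inH f"
proof -
  let ?F = "brownian_sigma M d T B"
  have f: "f \<in> borel_measurable M" "integrable M (\<lambda>\<omega>. (f \<omega>)^2)" using assms by (auto simp: L2_space_def)
  obtain g where g: "g \<in> borel_measurable ?F" "AE \<omega> in M. f \<omega> = g \<omega>" using assms by (auto simp: L2_space_def)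
  have gm: "g \<in> borel_measurable M"
    by (rule borel_measurable_subalgebra[OF _ _ g(1)]) (use inH_brownian_indicator space_brownian_sigma in auto)
  have "integrable M (\<lambda>\<omega>. (g \<omega>)^2)"
    by (rule Bochner_Integration.integrable_cong_AE_imp[OF f(2)]) (use g gm in auto)
  then have w: "integrable M (\<lambda>\<omega>. (2 * \<bar>g \<omega>\<bar>)^2)" by (simp add: power_mult_distrib)
  obtain s where s: "\<forall>i. simple_function ?F (s i)" "\<forall>\<omega>\<in>space ?F. (\<lambda>i. s i \<omega>) \<longlonglongrightarrow> g \<omega>"
    "\<forall>i. \<forall>\<omega>\<in>space ?F. dist (s i \<omega>) 0 \<le> 2 * dist (g \<omega>) 0"
    using borel_measurable_implies_sequence_metric[OF g(1), of 0] by blast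
  have sH: "inH (s i)" for i
  proof -
    have sf: "simple_function ?F (s i)" using s(1) by blast
    have fin: "finite (s i ` space M)" using simple_functionD(1)[OF sf] by (simp add: space_brownian_sigma)
    have ps: "s i -` {y} \<inter> space M \<in> sets ?F" for y using simple_functionD(2)[OF sf, of "{y}"] by (simp add: space_brownian_sigma)
    have "inH (\<lambda>\<omega>. \<Sum>y\<in>s i ` space M. y * indicator (s i -` {y} \<inter> space M) \<omega>)"
      using ps inH_brownian_indicator by (intro inH_sum inH_cmult) blast
    then show ?thesis
    proof (rule inH_cong_AE)
      show "s i \<in> borel_measurable M"
        by (rule borel_measurable_subalgebra[OF _ _ borel_measurable_simple_function[OF sf]])
          (use inH_brownian_indicator space_brownian_sigma in auto)
      show "AE \<omega> in M. (\<Sum>y\<in>s i ` space M. y * indicator (s i -` {y} \<inter> space M) \<omega>) = s i \<omega>"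
      proof (rule AE_I2)
        fix \<omega> assume \<omega>: "\<omega> \<in> space M"
        have "(\<Sum>y\<in>s i ` space M. y * indicator (s i -` {y} \<inter> space M) \<omega>) = (\<Sum>y\<in>s i ` space M. if y = s i \<omega> then y else 0)"
          using \<omega> by (intro sum.cong refl) (auto simp: indicator_def)
        then show "(\<Sum>y\<in>s i ` space M. y * indicator (s i -` {y} \<inter> space M) \<omega>) = s i \<omega>"
          using fin \<omega> by (simp add: sum.delta)
      qed
    qed
  qed
  have gH: "inH g"
  proof (rule inH_dominated[OF sH gm _ _ w])
    show "AE \<omega> in M. (\<lambda>i. s i \<omega>) \<longlonglongrightarrow> g \<omega>" using s(2) by (simp add: space_brownian_sigma)
    show "AE \<omega> in M. \<bar>s i \<omega>\<bar> \<le> 2 * \<bar>g \<omega>\<bar>" for i using s(3) by (simp add: space_brownian_sigma)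
  qed (use gm in simp)
  have "AE \<omega> in M. g \<omega> = f \<omega>" using g(2) by eventually_elim simp
  then show ?thesis by (rule inH_cong_AE[OF gH f(1)])
qed

lemma signature_dense: "dense_in_L2 M (brownian_sigma M d T B) linfun"
  unfolding dense_in_L2_def
proof (intro conjI ballI allI impI)
  show "linfun \<subseteq> L2_space M (brownian_sigma M d T B)" by (rule signature_linear_functions_L2)
  fix f and \<epsilon> :: real assume f: "f \<in> L2_space M (brownian_sigma M d T B)" and \<epsilon>: "0 < \<epsilon>"
  have "0 < \<epsilon>\<^sup>2" using \<epsilon> by simp
  then obtain g where g: "g \<in> linfun" "expectation (\<lambda>\<omega>. (f \<omega> - g \<omega>)^2) < \<epsilon>\<^sup>2"
    using inH_L2_space[OF f] unfolding inH_def by blast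
  have "L2_norm M (\<lambda>\<omega>. f \<omega> - g \<omega>) < \<epsilon>"
    unfolding L2_norm_def using real_sqrt_less_mono[OF g(2)] \<epsilon> by simp
  with g(1) show "\<exists>g\<in>linfun. L2_norm M (\<lambda>\<omega>. f \<omega> - g \<omega>) < \<epsilon>" by blast
qed

end

theorem proposition4p10:
  fixes M :: "'a measure" and d :: nat and T :: real
    and B :: "nat \<Rightarrow> real \<Rightarrow> 'a \<Rightarrow> real"
    and S :: "nat list \<Rightarrow> real \<Rightarrow> 'a \<Rightarrow> real"
  assumes "d \<ge> 1" and "T > 0"
    and "standard_brownian_motion M d T B"
    and "is_stratonovich_signature M d T B S"
  shows "dense_in_L2 M (brownian_sigma M d T B) (signature_linear_functions d T S)"
proof -
  interpret brownian_signature M d T B S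
    by unfold_locales (use assms in auto)
  show ?thesis by (rule signature_dense)
qed

end
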